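(* Let $\mathcal C$ be a category with a specified proper factorization system $(\mathcal E,\mathcal M)$, pullbacks of two $\mathcal M$-morphisms with common codomain, and pushouts of two $\mathcal E$-morphisms with common domain. The following are equivalent: (i) $\mathcal C$ has a noetherian form inducing $(\mathcal E,\mathcal M)$; (ii) there is a conservative functor $T:\mathcal C\to\mathbf{Set}$ sending $\mathcal E$-morphisms to surjections and $\mathcal M$-morphisms to injections, and preserving pullbacks of two $\mathcal M$-morphisms with common codomain and pushouts of two $\mathcal E$-morphisms with common domain.
   Context: Conventions: categories are locally small; "set" is relative to a fixed universe. A conservative functor is one that reflects isomorphisms. A proper factorization system $(\mathcal E,\mathcal M)$ is an orthogonal factorization system with every morphism in $\mathcal E$ an epimorphism and every morphism in $\mathcal M$ a monomorphism. Forms. An (orean) form $\mathsf F$ on a category $\mathcal C$ assigns to each object $X$ a set-sized bounded lattice $\mathsf F(X)$ (the fibre over $X$; its elements are called clusters) and to each morphism $f:X\to Y$ monotone maps $f_!:\mathsf F(X)\to\mathsf F(Y)$ and $f^*:\mathsf F(Y)\to\mathsf F(X)$ with $f_!S\le T\iff S\le f^*T$, such that $(gf)_!=g_!f_!$, $(gf)^*=f^*g^*$, and identities act as identities. Put $\operatorname{Im}f=f_!\top_X$ and $\operatorname{Ker}f=f^*\bot_Y$. A cluster in $\mathsf F(X)$ is conormal if it is the image of some morphism of $\mathcal C$ with codomain $X$, and normal if it is the kernel of some morphism of $\mathcal C$ with domain $X$. An embedding of a conormal $S\in\mathsf F(X)$ is a morphism $\iota$ into $X$ with $\operatorname{Im}\iota=S$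 such that every morphism $f$ into $X$ with $\operatorname{Im}f\le S$ factors as $f=\iota h$ for a unique $h$. A quotient of a normal $K\in\mathsf F(X)$ is a morphism $\pi$ out of $X$ with $\operatorname{Ker}\pi=K$ such that every morphism $g$ out of $X$ with $K\le\operatorname{Ker}g$ factors as $g=h\pi$ for a unique $h$. The form is noetherian if: (N1) $f^*f_!S=S\vee\operatorname{Ker}f$ and $f_!f^*T=T\wedge\operatorname{Im}f$ for all $f,S,T$; (N2) every morphism $f$ factors as $f=me$ with $e$ a quotient of $\operatorname{Ker}f$ and $m$ an embedding of $\operatorname{Im}f$; (N3) the join of two normal clusters (in the same fibre) is normal, and the meet of two conormal clusters is conormal. For a noetherian form, the class $\mathcal E$ of all quotients (of normal clusters) and the class $\mathcal M$ of all embeddings (of conormal clusters) form a proper factorization system, the one induced by the form. *)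

theory Defs
  imports Main "HOL-Library.FuncSet" "HOL-Library.Equipollence" "HOL-Algebra.Lattice"
begin

section \<open>The universe of sets\<close>

text \<open>
  A fixed universe of sets is represented by a type \<open>'u\<close>: a set of any type is \<open>small\<close> (an element
  of the universe, up to bijection) if its cardinality is strictly below that of \<open>'u\<close>.  The predicate
  \<open>universe\<close> says that the cardinality of \<open>'u\<close> is an infinite regular strong limit, i.e. that the
  small sets form a Grothendieck universe up to bijection.  Every small set is in bijection
  with a small subset of \<open>'u\<close>.  Following the convention under which the hereditarily finite sets
  also form a universe, uncountability is not required; the uncountable (inaccessible) case is included.
\<close>

definition small :: "'u itself \<Rightarrow> 'b set \<Rightarrow> bool" where
  "small u A \<longleftrightarrow> A \<prec> (UNIV :: 'u set)"

definition universe :: "'u itself \<Rightarrow> bool" where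
  "universe u \<longleftrightarrow>
     infinite (UNIV :: 'u set) \<and>
     (\<forall>A :: 'u set. small u A \<longrightarrow> small u (Pow A)) \<and>
     (\<forall>(I :: 'u set) (A :: 'u \<Rightarrow> 'u set).
        small u I \<and> (\<forall>i\<in>I. small u (A i)) \<longrightarrow> small u (\<Union>i\<in>I. A i))"

section \<open>Categories\<close>

record ('o, 'a) cat =
  Obj :: "'o set"
  Arr :: "'a set"
  Dom :: "'a \<Rightarrow> 'o"
  Cod :: "'a \<Rightarrow> 'o"
  Id :: "'o \<Rightarrow> 'a"
  Comp :: "'a \<Rightarrow> 'a \<Rightarrow> 'a"  (infixr "\<cdot>\<index>" 70)

definition hom :: "('o, 'a) cat \<Rightarrow> 'o \<Rightarrow> 'o \<Rightarrow> 'a set" where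
  "hom C X Y = {f \<in> Arr C. Dom C f = X \<and> Cod C f = Y}"

locale category =
  fixes C :: "('o, 'a) cat" (structure)
  assumes Dom_in_Obj: "f \<in> Arr C \<Longrightarrow> Dom C f \<in> Obj C"
    and Cod_in_Obj: "f \<in> Arr C \<Longrightarrow> Cod C f \<in> Obj C"
    and Id_in_hom: "X \<in> Obj C \<Longrightarrow> Id C X \<in> hom C X X"
    and Comp_in_hom: "\<lbrakk>f \<in> hom C X Y; g \<in> hom C Y Z\<rbrakk> \<Longrightarrow> g \<cdot> f \<in> hom C X Z"
    and Comp_Id: "f \<in> hom C X Y \<Longrightarrow> f \<cdot> Id C X = f"
    and Id_Comp: "f \<in> hom C X Y \<Longrightarrow> Id C Y \<cdot> f = f"
    and Comp_assoc:
      "\<lbrakk>f \<in> hom C W X; g \<in> hom C X Y; h \<in> hom C Y Z\<rbrakk> \<Longrightarrow> (h \<cdot> g) \<cdot> f = h \<cdot> (g \<cdot> f)"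

definition locally_small :: "'u itself \<Rightarrow> ('o, 'a) cat \<Rightarrow> bool" where
  "locally_small u C \<longleftrightarrow> (\<forall>X\<in>Obj C. \<forall>Y\<in>Obj C. small u (hom C X Y))"

definition monic :: "('o, 'a) cat \<Rightarrow> 'a \<Rightarrow> bool" where
  "monic C m \<longleftrightarrow> m \<in> Arr C \<and>
     (\<forall>W\<in>Obj C. \<forall>f\<in>hom C W (Dom C m). \<forall>g\<in>hom C W (Dom C m).
        m \<cdot>\<^bsub>C\<^esub> f = m \<cdot>\<^bsub>C\<^esub> g \<longrightarrow> f = g)"

definition epic :: "('o, 'a) cat \<Rightarrow> 'a \<Rightarrow> bool" where
  "epic C e \<longleftrightarrow> e \<in> Arr C \<and>
     (\<forall>Z\<in>Obj C. \<forall>f\<in>hom C (Cod C e) Z. \<forall>g\<in>hom C (Cod C e) Z.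
        f \<cdot>\<^bsub>C\<^esub> e = g \<cdot>\<^bsub>C\<^esub> e \<longrightarrow> f = g)"

definition isomorphism :: "('o, 'a) cat \<Rightarrow> 'a \<Rightarrow> bool" where
  "isomorphism C f \<longleftrightarrow> f \<in> Arr C \<and>
     (\<exists>g\<in>hom C (Cod C f) (Dom C f).
        g \<cdot>\<^bsub>C\<^esub> f = Id C (Dom C f) \<and> f \<cdot>\<^bsub>C\<^esub> g = Id C (Cod C f))"

text \<open>\<open>(p, q)\<close> is a pullback of the cospan \<open>(f, g)\<close>, respectively a pushout of the span \<open>(f, g)\<close>.\<close>

definition is_pullback :: "('o, 'a) cat \<Rightarrow> 'a \<Rightarrow> 'a \<Rightarrow> 'a \<Rightarrow> 'a \<Rightarrow> bool" where
  "is_pullback C f g p q \<longleftrightarrow>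
     f \<in> Arr C \<and> g \<in> Arr C \<and> Cod C f = Cod C g \<and>
     p \<in> Arr C \<and> q \<in> Arr C \<and> Dom C p = Dom C q \<and>
     Cod C p = Dom C f \<and> Cod C q = Dom C g \<and> f \<cdot>\<^bsub>C\<^esub> p = g \<cdot>\<^bsub>C\<^esub> q \<and>
     (\<forall>W\<in>Obj C. \<forall>u\<in>hom C W (Dom C f). \<forall>v\<in>hom C W (Dom C g).
        f \<cdot>\<^bsub>C\<^esub> u = g \<cdot>\<^bsub>C\<^esub> v \<longrightarrow>
        (\<exists>!h. h \<in> hom C W (Dom C p) \<and> p \<cdot>\<^bsub>C\<^esub> h = u \<and> q \<cdot>\<^bsub>C\<^esub> h = v))"

definition is_pushout :: "('o, 'a) cat \<Rightarrow> 'a \<Rightarrow> 'a \<Rightarrow> 'a \<Rightarrow> 'a \<Rightarrow> bool" where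
  "is_pushout C f g p q \<longleftrightarrow>
     f \<in> Arr C \<and> g \<in> Arr C \<and> Dom C f = Dom C g \<and>
     p \<in> Arr C \<and> q \<in> Arr C \<and> Cod C p = Cod C q \<and>
     Dom C p = Cod C f \<and> Dom C q = Cod C g \<and> p \<cdot>\<^bsub>C\<^esub> f = q \<cdot>\<^bsub>C\<^esub> g \<and>
     (\<forall>Z\<in>Obj C. \<forall>u\<in>hom C (Cod C f) Z. \<forall>v\<in>hom C (Cod C g) Z.
        u \<cdot>\<^bsub>C\<^esub> f = v \<cdot>\<^bsub>C\<^esub> g \<longrightarrow>
        (\<exists>!h. h \<in> hom C (Cod C p) Z \<and> h \<cdot>\<^bsub>C\<^esub> p = u \<and> h \<cdot>\<^bsub>C\<^esub> q = v))"

definition has_pullbacks_of :: "('o, 'a) cat \<Rightarrow> 'a set \<Rightarrow> bool" where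
  "has_pullbacks_of C M \<longleftrightarrow>
     (\<forall>m\<in>M. \<forall>n\<in>M. Cod C m = Cod C n \<longrightarrow> (\<exists>p q. is_pullback C m n p q))"

definition has_pushouts_of :: "('o, 'a) cat \<Rightarrow> 'a set \<Rightarrow> bool" where
  "has_pushouts_of C E \<longleftrightarrow>
     (\<forall>d\<in>E. \<forall>e\<in>E. Dom C d = Dom C e \<longrightarrow> (\<exists>p q. is_pushout C d e p q))"

section \<open>Factorization systems\<close>

definition orthogonal :: "('o, 'a) cat \<Rightarrow> 'a \<Rightarrow> 'a \<Rightarrow> bool" where
  "orthogonal C e m \<longleftrightarrow>
     (\<forall>u\<in>hom C (Dom C e) (Dom C m). \<forall>v\<in>hom C (Cod C e) (Cod C m).
        v \<cdot>\<^bsub>C\<^esub> e = m \<cdot>\<^bsub>C\<^esub> u \<longrightarrow>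
        (\<exists>!d. d \<in> hom C (Cod C e) (Dom C m) \<and> d \<cdot>\<^bsub>C\<^esub> e = u \<and> m \<cdot>\<^bsub>C\<^esub> d = v))"

definition orthogonal_factorization_system ::
    "('o, 'a) cat \<Rightarrow> 'a set \<Rightarrow> 'a set \<Rightarrow> bool" where
  "orthogonal_factorization_system C E M \<longleftrightarrow>
     E = {e \<in> Arr C. \<forall>m\<in>M. orthogonal C e m} \<and>
     M = {m \<in> Arr C. \<forall>e\<in>E. orthogonal C e m} \<and>
     (\<forall>f\<in>Arr C. \<exists>e\<in>E. \<exists>m\<in>M. Cod C e = Dom C m \<and> f = m \<cdot>\<^bsub>C\<^esub> e)"

definition proper_factorization_system ::
    "('o, 'a) cat \<Rightarrow> 'a set \<Rightarrow> 'a set \<Rightarrow> bool" where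
  "proper_factorization_system C E M \<longleftrightarrow>
     orthogonal_factorization_system C E M \<and> (\<forall>e\<in>E. epic C e) \<and> (\<forall>m\<in>M. monic C m)"

section \<open>Functors and the category of sets\<close>

definition is_functor ::
    "('o, 'a) cat \<Rightarrow> ('p, 'b) cat \<Rightarrow> ('o \<Rightarrow> 'p) \<Rightarrow> ('a \<Rightarrow> 'b) \<Rightarrow> bool" where
  "is_functor C D To Ta \<longleftrightarrow>
     (\<forall>X\<in>Obj C. To X \<in> Obj D) \<and>
     (\<forall>f\<in>Arr C. Ta f \<in> hom D (To (Dom C f)) (To (Cod C f))) \<and>
     (\<forall>X\<in>Obj C. Ta (Id C X) = Id D (To X)) \<and>
     (\<forall>f\<in>Arr C. \<forall>g\<in>Arr C. Cod C f = Dom C g \<longrightarrow> Ta (g \<cdot>\<^bsub>C\<^esub> f) = Ta g \<cdot>\<^bsub>D\<^esub> Ta f)"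

definition conservative :: "('o, 'a) cat \<Rightarrow> ('p, 'b) cat \<Rightarrow> ('a \<Rightarrow> 'b) \<Rightarrow> bool" where
  "conservative C D Ta \<longleftrightarrow> (\<forall>f\<in>Arr C. isomorphism D (Ta f) \<longrightarrow> isomorphism C f)"

definition preserves_pullbacks_of ::
    "('o, 'a) cat \<Rightarrow> ('p, 'b) cat \<Rightarrow> ('a \<Rightarrow> 'b) \<Rightarrow> 'a set \<Rightarrow> bool" where
  "preserves_pullbacks_of C D Ta M \<longleftrightarrow>
     (\<forall>m\<in>M. \<forall>n\<in>M. \<forall>p q. is_pullback C m n p q \<longrightarrow> is_pullback D (Ta m) (Ta n) (Ta p) (Ta q))"

definition preserves_pushouts_of ::
    "('o, 'a) cat \<Rightarrow> ('p, 'b) cat \<Rightarrow> ('a \<Rightarrow> 'b) \<Rightarrow> 'a set \<Rightarrow> bool" where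
  "preserves_pushouts_of C D Ta E \<longleftrightarrow>
     (\<forall>d\<in>E. \<forall>e\<in>E. \<forall>p q. is_pushout C d e p q \<longrightarrow> is_pushout D (Ta d) (Ta e) (Ta p) (Ta q))"

text \<open>
  A map of sets is a triple of domain, function and codomain; the function is extensional
  (\<open>undefined\<close> outside the domain), so that equality of maps is equality of triples.
\<close>

type_synonym 'u set_map = "'u set \<times> ('u \<Rightarrow> 'u) \<times> 'u set"

fun fun_of :: "'u set_map \<Rightarrow> 'u \<Rightarrow> 'u" where
  "fun_of (A, f, B) = f"

definition SET :: "('u set, 'u set_map) cat" where
  "SET = \<lparr>Obj = {A. small TYPE('u) A},
          Arr = {(A, f, B). small TYPE('u) A \<and> small TYPE('u) B \<and> f \<in> A \<rightarrow>\<^sub>E B},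
          Dom = (\<lambda>(A, f, B). A),
          Cod = (\<lambda>(A, f, B). B),
          Id = (\<lambda>A. (A, (\<lambda>x\<in>A. x), A)),
          Comp = (\<lambda>(_, g, B') (A, f, _). (A, compose A g f, B'))\<rparr>"

lemma category_SET: "category (SET :: ('u set, 'u set_map) cat)"
proof
  fix f g h :: "'u set_map" and W X Y Z :: "'u set"
  assume "f \<in> hom SET W X" "g \<in> hom SET X Y" "h \<in> hom SET Y Z"
  then show "(h \<cdot>\<^bsub>SET\<^esub> g) \<cdot>\<^bsub>SET\<^esub> f = h \<cdot>\<^bsub>SET\<^esub> (g \<cdot>\<^bsub>SET\<^esub> f)"
    by (auto simp: SET_def hom_def compose_def PiE_iff fun_eq_iff)
qed (auto simp: SET_def hom_def compose_def PiE_iff extensional_def fun_eq_iff, metis)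

definition surjective_map :: "'u set_map \<Rightarrow> bool" where
  "surjective_map a \<longleftrightarrow> fun_of a ` Dom SET a = Cod SET a"

definition injective_map :: "'u set_map \<Rightarrow> bool" where
  "injective_map a \<longleftrightarrow> inj_on (fun_of a) (Dom SET a)"

section \<open>Forms\<close>

text \<open>
  \<open>dir F f\<close> is the direct image \<open>f\<^sub>!\<close> and \<open>inv_im F f\<close> the inverse image \<open>f\<^sup>*\<close>; only their
  values on the fibres matter.
\<close>

record ('o, 'a, 'u) form =
  fibre :: "'o \<Rightarrow> 'u gorder"
  dir :: "'a \<Rightarrow> 'u \<Rightarrow> 'u"
  inv_im :: "'a \<Rightarrow> 'u \<Rightarrow> 'u"

definition is_form :: "('o, 'a) cat \<Rightarrow> ('o, 'a, 'u) form \<Rightarrow> bool" where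
  "is_form C F \<longleftrightarrow>
     (\<forall>X\<in>Obj C. bounded_lattice (fibre F X) \<and> small TYPE('u) (carrier (fibre F X))) \<and>
     (\<forall>f\<in>Arr C. isotone (fibre F (Dom C f)) (fibre F (Cod C f)) (dir F f) \<and>
                dir F f \<in> carrier (fibre F (Dom C f)) \<rightarrow> carrier (fibre F (Cod C f)) \<and>
                isotone (fibre F (Cod C f)) (fibre F (Dom C f)) (inv_im F f) \<and>
                inv_im F f \<in> carrier (fibre F (Cod C f)) \<rightarrow> carrier (fibre F (Dom C f)) \<and>
                (\<forall>S\<in>carrier (fibre F (Dom C f)). \<forall>T\<in>carrier (fibre F (Cod C f)).
                   dir F f S \<sqsubseteq>\<^bsub>fibre F (Cod C f)\<^esub> T \<longleftrightarrow> S \<sqsubseteq>\<^bsub>fibre F (Dom C f)\<^esub> inv_im F f T)) \<and>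
     (\<forall>f\<in>Arr C. \<forall>g\<in>Arr C. Cod C f = Dom C g \<longrightarrow>
        (\<forall>S\<in>carrier (fibre F (Dom C f)). dir F (g \<cdot>\<^bsub>C\<^esub> f) S = dir F g (dir F f S)) \<and>
        (\<forall>T\<in>carrier (fibre F (Cod C g)). inv_im F (g \<cdot>\<^bsub>C\<^esub> f) T = inv_im F f (inv_im F g T))) \<and>
     (\<forall>X\<in>Obj C. \<forall>S\<in>carrier (fibre F X). dir F (Id C X) S = S \<and> inv_im F (Id C X) S = S)"

definition Im :: "('o, 'a) cat \<Rightarrow> ('o, 'a, 'u) form \<Rightarrow> 'a \<Rightarrow> 'u" where
  "Im C F f = dir F f \<top>\<^bsub>fibre F (Dom C f)\<^esub>"

definition Ker :: "('o, 'a) cat \<Rightarrow> ('o, 'a, 'u) form \<Rightarrow> 'a \<Rightarrow> 'u" where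
  "Ker C F f = inv_im F f \<bottom>\<^bsub>fibre F (Cod C f)\<^esub>"

definition conormal :: "('o, 'a) cat \<Rightarrow> ('o, 'a, 'u) form \<Rightarrow> 'o \<Rightarrow> 'u \<Rightarrow> bool" where
  "conormal C F X S \<longleftrightarrow> (\<exists>f\<in>Arr C. Cod C f = X \<and> Im C F f = S)"

definition normal :: "('o, 'a) cat \<Rightarrow> ('o, 'a, 'u) form \<Rightarrow> 'o \<Rightarrow> 'u \<Rightarrow> bool" where
  "normal C F X K \<longleftrightarrow> (\<exists>f\<in>Arr C. Dom C f = X \<and> Ker C F f = K)"

definition is_embedding ::
    "('o, 'a) cat \<Rightarrow> ('o, 'a, 'u) form \<Rightarrow> 'o \<Rightarrow> 'u \<Rightarrow> 'a \<Rightarrow> bool" where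
  "is_embedding C F X S i \<longleftrightarrow>
     conormal C F X S \<and> i \<in> Arr C \<and> Cod C i = X \<and> Im C F i = S \<and>
     (\<forall>f\<in>Arr C. Cod C f = X \<and> Im C F f \<sqsubseteq>\<^bsub>fibre F X\<^esub> S \<longrightarrow>
        (\<exists>!h. h \<in> hom C (Dom C f) (Dom C i) \<and> f = i \<cdot>\<^bsub>C\<^esub> h))"

definition is_quotient ::
    "('o, 'a) cat \<Rightarrow> ('o, 'a, 'u) form \<Rightarrow> 'o \<Rightarrow> 'u \<Rightarrow> 'a \<Rightarrow> bool" where
  "is_quotient C F X K p \<longleftrightarrow>
     normal C F X K \<and> p \<in> Arr C \<and> Dom C p = X \<and> Ker C F p = K \<and>
     (\<forall>g\<in>Arr C. Dom C g = X \<and> K \<sqsubseteq>\<^bsub>fibre F X\<^esub> Ker C F g \<longrightarrow>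
        (\<exists>!h. h \<in> hom C (Cod C p) (Cod C g) \<and> g = h \<cdot>\<^bsub>C\<^esub> p))"

definition noetherian_form :: "('o, 'a) cat \<Rightarrow> ('o, 'a, 'u) form \<Rightarrow> bool" where
  "noetherian_form C F \<longleftrightarrow>
     is_form C F \<and>
     \<comment> \<open>(N1)\<close>
     (\<forall>f\<in>Arr C.
        (\<forall>S\<in>carrier (fibre F (Dom C f)).
           inv_im F f (dir F f S) = S \<squnion>\<^bsub>fibre F (Dom C f)\<^esub> Ker C F f) \<and>
        (\<forall>T\<in>carrier (fibre F (Cod C f)).
           dir F f (inv_im F f T) = T \<sqinter>\<^bsub>fibre F (Cod C f)\<^esub> Im C F f)) \<and>
     \<comment> \<open>(N2)\<close>
     (\<forall>f\<in>Arr C. \<exists>e m.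
        is_quotient C F (Dom C f) (Ker C F f) e \<and> is_embedding C F (Cod C f) (Im C F f) m \<and>
        Cod C e = Dom C m \<and> f = m \<cdot>\<^bsub>C\<^esub> e) \<and>
     \<comment> \<open>(N3)\<close>
     (\<forall>X\<in>Obj C. \<forall>K L. normal C F X K \<and> normal C F X L \<longrightarrow> normal C F X (K \<squnion>\<^bsub>fibre F X\<^esub> L)) \<and>
     (\<forall>X\<in>Obj C. \<forall>S T. conormal C F X S \<and> conormal C F X T \<longrightarrow>
        conormal C F X (S \<sqinter>\<^bsub>fibre F X\<^esub> T))"

definition quotients :: "('o, 'a) cat \<Rightarrow> ('o, 'a, 'u) form \<Rightarrow> 'a set" where
  "quotients C F = {p. \<exists>X\<in>Obj C. \<exists>K. is_quotient C F X K p}"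

definition embeddings :: "('o, 'a) cat \<Rightarrow> ('o, 'a, 'u) form \<Rightarrow> 'a set" where
  "embeddings C F = {i. \<exists>X\<in>Obj C. \<exists>S. is_embedding C F X S i}"

definition induces :: "('o, 'a) cat \<Rightarrow> ('o, 'a, 'u) form \<Rightarrow> 'a set \<Rightarrow> 'a set \<Rightarrow> bool" where
  "induces C F E M \<longleftrightarrow> quotients C F = E \<and> embeddings C F = M"

end

theory Submission
  imports Defs
begin

text \<open>
  From a noetherian form one takes the functor sending an object to its set of clusters and a
  morphism to its direct image map: (N1) identifies the direct image along an embedding with the
  inclusion of a down-set and along a quotient with a map \<open>S \<mapsto> S \<squnion> K\<close>, and (N3) turns the
  pullbacks and pushouts of these into meets and joins.  Conversely, given the functor \<open>T\<close>, the
  clusters over \<open>X\<close> are the equivalence relations on the pointed set \<open>T X + 1\<close>.  Kernels then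
  correspond to the kernel relations of the maps \<open>T f\<close>, while the image of \<open>f\<close> is the relation
  that collapses the image of \<open>T f\<close> to the base point, so images are the subsets of \<open>T X\<close>.
  Conservativity and preservation of pushouts and pullbacks yield the universal properties of
  quotients and embeddings.
\<close>

section \<open>Categories and factorization systems\<close>

text \<open>The obstacle in building a form from \<open>T\<close> is that one lattice over
  \<open>X\<close> has to hold both kernels and images and link them by (N1). Equivalence relations
  on \<open>T X\<close> record the kernels but confuse an empty image with a one-element image,
  since collapsing either leaves the diagonal; subsets record the images but forget the kernels.
  With an added base point, the points of an image are those equivalent to the base point, so even
  the empty image remains distinguishable. Of the three axioms only (N1) is then a fact about sets.
  (N2) and (N3) depend on which morphisms and clusters \<open>C\<close> itself provides. Since
  \<open>T\<close> is not assumed full, a function that ought to be a factorization has to be turned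
  into a morphism: one forms a pushout or pullback in \<open>C\<close> and shows that one of its
  legs becomes invertible under \<open>T\<close>. A further constraint is that clusters must be
  elements of \<open>'u\<close>, while relations on \<open>T X + 1\<close> are not; a cardinality
  count shows that there are few enough of them to be encoded.\<close>

lemma homI: "f \<in> Arr C \<Longrightarrow> f \<in> hom C (Dom C f) (Cod C f)"
  by (simp add: hom_def)

lemma epicD:
  "\<lbrakk>epic C e; e \<in> hom C X Y; f \<in> hom C Y Z; g \<in> hom C Y Z; Z \<in> Obj C;
    f \<cdot>\<^bsub>C\<^esub> e = g \<cdot>\<^bsub>C\<^esub> e\<rbrakk> \<Longrightarrow> f = g"
  by (auto simp: epic_def hom_def)

lemma monicD:
  "\<lbrakk>monic C m; m \<in> hom C X Y; f \<in> hom C W X; g \<in> hom C W X; W \<in> Obj C;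
    m \<cdot>\<^bsub>C\<^esub> f = m \<cdot>\<^bsub>C\<^esub> g\<rbrakk> \<Longrightarrow> f = g"
  by (auto simp: monic_def hom_def)

section \<open>Pushouts, pullbacks and orthogonality in an arbitrary category\<close>

context category
begin

lemma hom_Obj: "f \<in> hom C X Y \<Longrightarrow> X \<in> Obj C \<and> Y \<in> Obj C"
  using Dom_in_Obj Cod_in_Obj by (auto simp: hom_def)

lemma isomorphismI:
  assumes "f \<in> hom C X Y" "g \<in> hom C Y X" "g \<cdot> f = Id C X" "f \<cdot> g = Id C Y"
  shows "isomorphism C f"
  using assms by (auto simp: isomorphism_def hom_def)

lemma isomorphismE:
  assumes "isomorphism C f" "f \<in> hom C X Y"
  obtains g where "g \<in> hom C Y X" "g \<cdot> f = Id C X" "f \<cdot> g = Id C Y"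
  using assms by (auto simp: isomorphism_def hom_def)

text \<open>The universal property is split into existence and joint cancellation. Cancellation
  mentions no cocone: if \<open>h\<close> and \<open>k\<close> agree after \<open>p\<close> and
  after \<open>q\<close>, then \<open>h \<cdot> p\<close> and \<open>h \<cdot> q\<close> already
  form a cocone, and both maps mediate it.\<close>

lemma pushoutE:
  assumes "is_pushout C f g p q" "f \<in> hom C X A" "g \<in> hom C X B"
  obtains P where "p \<in> hom C A P" "q \<in> hom C B P" "p \<cdot> f = q \<cdot> g"
    "\<And>Z u v. \<lbrakk>u \<in> hom C A Z; v \<in> hom C B Z; u \<cdot> f = v \<cdot> g\<rbrakk> \<Longrightarrow>
       \<exists>h \<in> hom C P Z. h \<cdot> p = u \<and> h \<cdot> q = v"
    "\<And>Z h k. \<lbrakk>h \<in> hom C P Z; k \<in> hom C P Z; h \<cdot> p = k \<cdot> p; h \<cdot> q = k \<cdot> q\<rbrakk> \<Longrightarrow> h = k"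
proof
  let ?P = "Cod C p"
  have fg: "f \<in> Arr C" "g \<in> Arr C" "Dom C f = X" "Dom C g = X" "Cod C f = A" "Cod C g = B"
    using assms(2,3) by (auto simp: hom_def)
  have univ: "\<exists>!h. h \<in> hom C ?P Z \<and> h \<cdot> p = u \<and> h \<cdot> q = v"
    if "u \<in> hom C A Z" "v \<in> hom C B Z" "u \<cdot> f = v \<cdot> g" for Z u v
  proof -
    have "\<forall>Z\<in>Obj C. \<forall>u\<in>hom C A Z. \<forall>v\<in>hom C B Z. u \<cdot> f = v \<cdot> g \<longrightarrow>
        (\<exists>!h. h \<in> hom C ?P Z \<and> h \<cdot> p = u \<and> h \<cdot> q = v)"
      using assms(1) unfolding is_pushout_def fg by blast
    then show ?thesis using that hom_Obj[OF that(1)] by blast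
  qed
  show p: "p \<in> hom C A ?P" and q: "q \<in> hom C B ?P" and pq: "p \<cdot> f = q \<cdot> g"
    using assms(1) fg by (auto simp: is_pushout_def hom_def)
  show "\<exists>h \<in> hom C ?P Z. h \<cdot> p = u \<and> h \<cdot> q = v"
    if "u \<in> hom C A Z" "v \<in> hom C B Z" "u \<cdot> f = v \<cdot> g" for Z u v
    using univ[OF that] by auto
  show "h = k" if h: "h \<in> hom C ?P Z" and k: "k \<in> hom C ?P Z"
    and eq: "h \<cdot> p = k \<cdot> p" "h \<cdot> q = k \<cdot> q" for Z h k
  proof -
    have "(h \<cdot> p) \<cdot> f = (h \<cdot> q) \<cdot> g"
      using Comp_assoc[OF assms(2) p h] Comp_assoc[OF assms(3) q h] pq by simp
    then show ?thesis
      using univ[OF Comp_in_hom[OF p h] Comp_in_hom[OF q h]] h k eq by auto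
  qed
qed

lemma pullbackE:
  assumes "is_pullback C f g p q" "f \<in> hom C A X" "g \<in> hom C B X"
  obtains P where "p \<in> hom C P A" "q \<in> hom C P B" "f \<cdot> p = g \<cdot> q"
    "\<And>W u v. \<lbrakk>u \<in> hom C W A; v \<in> hom C W B; f \<cdot> u = g \<cdot> v\<rbrakk> \<Longrightarrow>
       \<exists>h \<in> hom C W P. p \<cdot> h = u \<and> q \<cdot> h = v"
    "\<And>W h k. \<lbrakk>h \<in> hom C W P; k \<in> hom C W P; p \<cdot> h = p \<cdot> k; q \<cdot> h = q \<cdot> k\<rbrakk> \<Longrightarrow> h = k"
proof
  let ?P = "Dom C p"
  have fg: "f \<in> Arr C" "g \<in> Arr C" "Dom C f = A" "Dom C g = B" "Cod C f = X" "Cod C g = X"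
    using assms(2,3) by (auto simp: hom_def)
  have univ: "\<exists>!h. h \<in> hom C W ?P \<and> p \<cdot> h = u \<and> q \<cdot> h = v"
    if "u \<in> hom C W A" "v \<in> hom C W B" "f \<cdot> u = g \<cdot> v" for W u v
  proof -
    have "\<forall>W\<in>Obj C. \<forall>u\<in>hom C W A. \<forall>v\<in>hom C W B. f \<cdot> u = g \<cdot> v \<longrightarrow>
        (\<exists>!h. h \<in> hom C W ?P \<and> p \<cdot> h = u \<and> q \<cdot> h = v)"
      using assms(1) unfolding is_pullback_def fg by blast
    then show ?thesis using that hom_Obj[OF that(1)] by blast
  qed
  show p: "p \<in> hom C ?P A" and q: "q \<in> hom C ?P B" and pq: "f \<cdot> p = g \<cdot> q"
    using assms(1) fg by (auto simp: is_pullback_def hom_def)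
  show "\<exists>h \<in> hom C W ?P. p \<cdot> h = u \<and> q \<cdot> h = v"
    if "u \<in> hom C W A" "v \<in> hom C W B" "f \<cdot> u = g \<cdot> v" for W u v
    using univ[OF that] by auto
  show "h = k" if h: "h \<in> hom C W ?P" and k: "k \<in> hom C W ?P"
    and eq: "p \<cdot> h = p \<cdot> k" "q \<cdot> h = q \<cdot> k" for W h k
  proof -
    have "f \<cdot> (p \<cdot> h) = g \<cdot> (q \<cdot> h)"
      using Comp_assoc[OF h p assms(2)] Comp_assoc[OF h q assms(3)] pq by simp
    then show ?thesis
      using univ[OF Comp_in_hom[OF h p] Comp_in_hom[OF h q]] h k eq by auto
  qed
qed

text \<open>The cocone consisting of \<open>u\<close> and the identity of \<open>B\<close> gives a
  left inverse \<open>h\<close> of \<open>q\<close>. Cancelling the epimorphism \<open>d\<close>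
  yields \<open>q \<cdot> u = p\<close>, so \<open>q \<cdot> h\<close> agrees with the identity on
  both legs. The lemma is applied to pushouts of sets, and conservativity carries the conclusion
  back to \<open>C\<close>.\<close>

lemma pushout_iso:
  assumes po: "is_pushout C d e p q" and d: "d \<in> hom C X A" and e: "e \<in> hom C X B"
    and epi: "epic C d" and u: "u \<in> hom C A B" and ud: "u \<cdot> d = e"
  shows "isomorphism C q"
proof -
  from po d e obtain P where p: "p \<in> hom C A P" and q: "q \<in> hom C B P" and pq: "p \<cdot> d = q \<cdot> e"
    and ex: "\<And>Z u v. \<lbrakk>u \<in> hom C A Z; v \<in> hom C B Z; u \<cdot> d = v \<cdot> e\<rbrakk> \<Longrightarrow>
       \<exists>h \<in> hom C P Z. h \<cdot> p = u \<and> h \<cdot> q = v"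
    and uq: "\<And>Z h k. \<lbrakk>h \<in> hom C P Z; k \<in> hom C P Z; h \<cdot> p = k \<cdot> p; h \<cdot> q = k \<cdot> q\<rbrakk> \<Longrightarrow> h = k"
    by (rule pushoutE) blast
  note Obs = hom_Obj[OF p] hom_Obj[OF q]
  have "u \<cdot> d = Id C B \<cdot> e" using ud Id_Comp[OF e] by simp
  then obtain h where h: "h \<in> hom C P B" "h \<cdot> p = u" "h \<cdot> q = Id C B"
    using ex[OF u Id_in_hom] Obs by blast
  have qu: "q \<cdot> u = p"
  proof (rule epicD[OF epi d Comp_in_hom[OF u q] p])
    show "(q \<cdot> u) \<cdot> d = p \<cdot> d" using Comp_assoc[OF d u q] ud pq by simp
  qed (use Obs in auto)
  have I: "Id C P \<in> hom C P P" using Id_in_hom Obs by blast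
  have "q \<cdot> h = Id C P"
  proof (rule uq[OF Comp_in_hom[OF h(1) q] I])
    show "(q \<cdot> h) \<cdot> p = Id C P \<cdot> p"
      using Comp_assoc[OF p h(1) q] h(2) qu Id_Comp[OF p] by simp
    show "(q \<cdot> h) \<cdot> q = Id C P \<cdot> q"
      using Comp_assoc[OF q h(1) q] h(3) Id_Comp[OF q] Comp_Id[OF q] by simp
  qed
  then show ?thesis using isomorphismI[OF q h(1) h(3)] by blast
qed

text \<open>Dually, the cone consisting of \<open>u\<close> and the identity of \<open>B\<close>
  gives a right inverse \<open>h\<close> of \<open>q\<close>, and cancelling \<open>m\<close> yields
  \<open>u \<cdot> q = p\<close>, so that \<open>h \<cdot> q\<close> agrees with the identity after
  both projections.\<close>

lemma pullback_iso:
  assumes pb: "is_pullback C m n p q" and m: "m \<in> hom C A X" and n: "n \<in> hom C B X"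
    and mono: "monic C m" and u: "u \<in> hom C B A" and mu: "m \<cdot> u = n"
  shows "isomorphism C q"
proof -
  from pb m n obtain P where p: "p \<in> hom C P A" and q: "q \<in> hom C P B" and pq: "m \<cdot> p = n \<cdot> q"
    and ex: "\<And>W u v. \<lbrakk>u \<in> hom C W A; v \<in> hom C W B; m \<cdot> u = n \<cdot> v\<rbrakk> \<Longrightarrow>
       \<exists>h \<in> hom C W P. p \<cdot> h = u \<and> q \<cdot> h = v"
    and uq: "\<And>W h k. \<lbrakk>h \<in> hom C W P; k \<in> hom C W P; p \<cdot> h = p \<cdot> k; q \<cdot> h = q \<cdot> k\<rbrakk> \<Longrightarrow> h = k"
    by (rule pullbackE) blast
  note Obs = hom_Obj[OF p] hom_Obj[OF q]
  have "m \<cdot> u = n \<cdot> Id C B" using mu Comp_Id[OF n] by simp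
  then obtain h where h: "h \<in> hom C B P" "p \<cdot> h = u" "q \<cdot> h = Id C B"
    using ex[OF u Id_in_hom] Obs by blast
  have uq': "u \<cdot> q = p"
  proof (rule monicD[OF mono m Comp_in_hom[OF q u] p])
    show "m \<cdot> (u \<cdot> q) = m \<cdot> p" using Comp_assoc[OF q u m] mu pq by simp
  qed (use Obs in auto)
  have I: "Id C P \<in> hom C P P" using Id_in_hom Obs by blast
  have "h \<cdot> q = Id C P"
  proof (rule uq[OF Comp_in_hom[OF q h(1)] I])
    show "p \<cdot> (h \<cdot> q) = p \<cdot> Id C P"
      using Comp_assoc[OF q h(1) p] h(2) uq' Comp_Id[OF p] by simp
    show "q \<cdot> (h \<cdot> q) = q \<cdot> Id C P"
      using Comp_assoc[OF q h(1) q] h(3) Id_Comp[OF q] Comp_Id[OF q] by simp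
  qed
  then show ?thesis using isomorphismI[OF q h(1)] h(3) by blast
qed

lemma orthogonalD:
  assumes "orthogonal C e m" "e \<in> hom C A B" "m \<in> hom C X Y" "u \<in> hom C A X" "v \<in> hom C B Y"
    "v \<cdot> e = m \<cdot> u"
  shows "\<exists>d\<in>hom C B X. d \<cdot> e = u \<and> m \<cdot> d = v"
  using assms unfolding orthogonal_def hom_def by simp blast

text \<open>Existence of a diagonal is enough, because an epic \<open>e\<close> or a monic
  \<open>m\<close> forces its uniqueness.\<close>

lemma orthogonalI:
  assumes e: "e \<in> hom C A B" and m: "m \<in> hom C X Y" and proper: "epic C e \<or> monic C m"
    and ex: "\<And>u v. \<lbrakk>u \<in> hom C A X; v \<in> hom C B Y; v \<cdot> e = m \<cdot> u\<rbrakk> \<Longrightarrow>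
       \<exists>d\<in>hom C B X. d \<cdot> e = u \<and> m \<cdot> d = v"
  shows "orthogonal C e m"
proof -
  note Obs = hom_Obj[OF e] hom_Obj[OF m]
  have DC: "Dom C e = A" "Cod C e = B" "Dom C m = X" "Cod C m = Y"
    using e m by (auto simp: hom_def)
  show ?thesis
    unfolding orthogonal_def DC
  proof (intro ballI impI)
    fix u v
    assume "u \<in> hom C A X" "v \<in> hom C B Y" "v \<cdot> e = m \<cdot> u"
    then obtain d where d: "d \<in> hom C B X" "d \<cdot> e = u" "m \<cdot> d = v"
      using ex by blast
    moreover have "d' = d" if "d' \<in> hom C B X" "d' \<cdot> e = u" "m \<cdot> d' = v" for d'
      using proper epicD[OF _ e that(1) d(1)] monicD[OF _ m that(1) d(1)] Obs that d by auto
    ultimately show "\<exists>!d. d \<in> hom C B X \<and> d \<cdot> e = u \<and> m \<cdot> d = v"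
      by blast
  qed
qed

end

section \<open>Proper factorization systems and closure of the two classes under
  isomorphisms\<close>

locale proper_factorization = category C for C :: "('o, 'a) cat" (structure) +
  fixes E M :: "'a set"
  assumes proper: "proper_factorization_system C E M"
begin

lemma E_iff: "e \<in> E \<longleftrightarrow> e \<in> Arr C \<and> (\<forall>m\<in>M. orthogonal C e m)"
  and M_iff: "m \<in> M \<longleftrightarrow> m \<in> Arr C \<and> (\<forall>e\<in>E. orthogonal C e m)"
  using proper unfolding proper_factorization_system_def orthogonal_factorization_system_def
  by blast+

lemma E_Arr: "e \<in> E \<Longrightarrow> e \<in> Arr C"
  and M_Arr: "m \<in> M \<Longrightarrow> m \<in> Arr C"
  using E_iff M_iff by blast+

lemma E_epic: "e \<in> E \<Longrightarrow> epic C e"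
  and M_monic: "m \<in> M \<Longrightarrow> monic C m"
  using proper unfolding proper_factorization_system_def by blast+

lemma factorE:
  assumes "f \<in> hom C X Y"
  obtains e m I where "e \<in> E" "m \<in> M" "e \<in> hom C X I" "m \<in> hom C I Y" "f = m \<cdot> e"
proof -
  from assms obtain e m where em: "e \<in> E" "m \<in> M" "Cod C e = Dom C m" "f = m \<cdot> e"
    using proper
    unfolding proper_factorization_system_def orthogonal_factorization_system_def hom_def by blast
  have e: "e \<in> hom C (Dom C e) (Dom C m)" and m: "m \<in> hom C (Dom C m) (Cod C m)"
    using em E_Arr M_Arr by (auto simp: hom_def)
  have "f \<in> hom C (Dom C e) (Cod C m)" using Comp_in_hom[OF e m] em by simp
  then have "Dom C e = X" "Cod C m = Y" using assms by (auto simp: hom_def)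
  then show thesis using that em e m by auto
qed

text \<open>A lifting problem for \<open>i \<cdot> e\<close> turns into one for \<open>e\<close>
  with \<open>v \<cdot> i\<close> in place of \<open>v\<close>; its diagonal followed by
  precomposition with the inverse \<open>j\<close> solves the original. This is what places a
  quotient in \<open>E\<close>, since its universal property fixes it only up to an isomorphism of
  the codomain.\<close>

lemma E_comp_iso:
  assumes eE: "e \<in> E" and e: "e \<in> hom C X Y" and i: "i \<in> hom C Y Z" and "isomorphism C i"
  shows "i \<cdot> e \<in> E"
proof -
  obtain j where j: "j \<in> hom C Z Y" "j \<cdot> i = Id C Y" "i \<cdot> j = Id C Z"
    using assms isomorphismE by blast
  have ie: "i \<cdot> e \<in> hom C X Z" using Comp_in_hom e i by blast
  have "orthogonal C (i \<cdot> e) m" if mM: "m \<in> M" for m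
  proof (rule orthogonalI[OF ie homI])
    show "m \<in> Arr C" "epic C (i \<cdot> e) \<or> monic C m" using M_Arr M_monic mM by auto
    then have m: "m \<in> hom C (Dom C m) (Cod C m)" by (simp add: hom_def)
    fix u v
    assume u: "u \<in> hom C X (Dom C m)" and v: "v \<in> hom C Z (Cod C m)" and uv: "v \<cdot> (i \<cdot> e) = m \<cdot> u"
    have vi: "v \<cdot> i \<in> hom C Y (Cod C m)" using Comp_in_hom i v by blast
    have "(v \<cdot> i) \<cdot> e = m \<cdot> u" using uv Comp_assoc[OF e i v] by simp
    then obtain d where d: "d \<in> hom C Y (Dom C m)" "d \<cdot> e = u" "m \<cdot> d = v \<cdot> i"
      using orthogonalD[OF _ e m u vi] eE mM E_iff by blast
    have dj: "d \<cdot> j \<in> hom C Z (Dom C m)" using Comp_in_hom j d by blast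
    have "(d \<cdot> j) \<cdot> (i \<cdot> e) = d \<cdot> ((j \<cdot> i) \<cdot> e)"
      using Comp_assoc[OF ie j(1) d(1)] Comp_assoc[OF e i j(1)] by simp
    also have "\<dots> = u" using j d Id_Comp[OF e] by simp
    finally have 1: "(d \<cdot> j) \<cdot> (i \<cdot> e) = u" .
    have "m \<cdot> (d \<cdot> j) = v \<cdot> (i \<cdot> j)"
      using Comp_assoc[OF j(1) d(1) m] Comp_assoc[OF j(1) i v] d by simp
    then have "m \<cdot> (d \<cdot> j) = v" using j Comp_Id[OF v] by simp
    with 1 dj show "\<exists>d\<in>hom C Z (Dom C m). d \<cdot> (i \<cdot> e) = u \<and> m \<cdot> d = v" by blast
  qed
  then show ?thesis using E_iff ie by (auto simp: hom_def)
qed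

text \<open>The dual transport: lift against \<open>m\<close> with \<open>i \<cdot> u\<close> in
  place of \<open>u\<close>, then postcompose the diagonal with the inverse of \<open>i\<close>. An
  embedding is fixed only up to an isomorphism of its domain.\<close>

lemma M_comp_iso:
  assumes mM: "m \<in> M" and m: "m \<in> hom C X Y" and i: "i \<in> hom C W X" and "isomorphism C i"
  shows "m \<cdot> i \<in> M"
proof -
  obtain j where j: "j \<in> hom C X W" "j \<cdot> i = Id C W" "i \<cdot> j = Id C X"
    using assms isomorphismE by blast
  have mi: "m \<cdot> i \<in> hom C W Y" using Comp_in_hom m i by blast
  have "orthogonal C e (m \<cdot> i)" if eE: "e \<in> E" for e
  proof (rule orthogonalI[OF homI mi])
    show "e \<in> Arr C" "epic C e \<or> monic C (m \<cdot> i)" using E_Arr E_epic eE by auto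
    then have e: "e \<in> hom C (Dom C e) (Cod C e)" by (simp add: hom_def)
    fix u v
    assume u: "u \<in> hom C (Dom C e) W" and v: "v \<in> hom C (Cod C e) Y" and uv: "v \<cdot> e = (m \<cdot> i) \<cdot> u"
    have iu: "i \<cdot> u \<in> hom C (Dom C e) X" using Comp_in_hom i u by blast
    have "v \<cdot> e = m \<cdot> (i \<cdot> u)" using uv Comp_assoc[OF u i m] by simp
    then obtain d where d: "d \<in> hom C (Cod C e) X" "d \<cdot> e = i \<cdot> u" "m \<cdot> d = v"
      using orthogonalD[OF _ e m iu v] eE mM E_iff by blast
    have jd: "j \<cdot> d \<in> hom C (Cod C e) W" using Comp_in_hom j d by blast
    have "(j \<cdot> d) \<cdot> e = (j \<cdot> i) \<cdot> u"
      using Comp_assoc[OF e d(1) j(1)] Comp_assoc[OF u i j(1)] d by simp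
    then have 1: "(j \<cdot> d) \<cdot> e = u" using j Id_Comp[OF u] by simp
    have "(m \<cdot> i) \<cdot> (j \<cdot> d) = m \<cdot> ((i \<cdot> j) \<cdot> d)"
      using Comp_assoc[OF jd i m] Comp_assoc[OF d(1) j(1) i] by simp
    then have "(m \<cdot> i) \<cdot> (j \<cdot> d) = v" using j d Id_Comp[OF d(1)] by simp
    with 1 jd show "\<exists>d\<in>hom C (Cod C e) W. d \<cdot> e = u \<and> (m \<cdot> i) \<cdot> d = v" by blast
  qed
  then show ?thesis using M_iff mi by (auto simp: hom_def)
qed

end

section \<open>The category of sets\<close>

lemma hom_SET:
  "f \<in> hom SET A B \<longleftrightarrow>
     small TYPE('u) A \<and> small TYPE('u) B \<and> (\<exists>h \<in> A \<rightarrow>\<^sub>E B. f = (A, h, B))"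
  for A B :: "'u set"
  by (cases f) (auto simp: SET_def hom_def)

lemma SET_mapI:
  "\<lbrakk>small TYPE('u) A; small TYPE('u) B; h \<in> A \<rightarrow> B\<rbrakk> \<Longrightarrow> (A, restrict h A, B) \<in> hom SET A B"
  for A B :: "'u set"
  by (auto simp: hom_SET)

lemma SET_Obj: "f \<in> hom SET A B \<Longrightarrow> small TYPE('u) A \<and> small TYPE('u) B" for A B :: "'u set"
  by (simp add: hom_SET)

lemma Obj_SET: "A \<in> Obj SET \<longleftrightarrow> small TYPE('u) A" for A :: "'u set"
  by (simp add: SET_def)

lemma fun_of_hom: "f \<in> hom SET A B \<Longrightarrow> fun_of f \<in> A \<rightarrow> B"
  by (auto simp: hom_SET)

lemma SET_eqI:
  "\<lbrakk>f \<in> hom SET A B; g \<in> hom SET A B; \<And>x. x \<in> A \<Longrightarrow> fun_of f x = fun_of g x\<rbrakk> \<Longrightarrow> f = g"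
  by (fastforce simp: hom_SET PiE_iff intro: extensionalityI)

lemma fun_of_Comp:
  "\<lbrakk>f \<in> hom SET A B; g \<in> hom SET B D; x \<in> A\<rbrakk> \<Longrightarrow> fun_of (g \<cdot>\<^bsub>SET\<^esub> f) x = fun_of g (fun_of f x)"
  by (cases f; cases g) (auto simp: hom_SET; simp add: SET_def compose_def)

lemma fun_of_Id: "x \<in> A \<Longrightarrow> fun_of (Id SET A) x = x"
  by (simp add: SET_def)

lemma surjective_map_iff: "f \<in> hom SET A B \<Longrightarrow> surjective_map f \<longleftrightarrow> fun_of f ` A = B"
  by (simp add: surjective_map_def hom_def)

lemma injective_map_iff: "f \<in> hom SET A B \<Longrightarrow> injective_map f \<longleftrightarrow> inj_on (fun_of f) A"
  by (simp add: injective_map_def hom_def)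

lemma SET_epic:
  assumes f: "f \<in> hom SET A B" and s: "surjective_map f"
  shows "epic SET f"
  unfolding epic_def
proof (intro conjI ballI impI)
  show "f \<in> Arr SET" using f by (simp add: hom_def)
  fix Z g h
  assume gh: "g \<in> hom SET (Cod SET f) Z" "h \<in> hom SET (Cod SET f) Z"
    "g \<cdot>\<^bsub>SET\<^esub> f = h \<cdot>\<^bsub>SET\<^esub> f"
  then have g: "g \<in> hom SET B Z" and h: "h \<in> hom SET B Z" using f by (auto simp: hom_def)
  show "g = h"
  proof (rule SET_eqI[OF g h])
    fix y assume "y \<in> B"
    then obtain x where "x \<in> A" "y = fun_of f x" using s f surjective_map_iff by blast
    then show "fun_of g y = fun_of h y"
      using gh(3) fun_of_Comp[OF f g] fun_of_Comp[OF f h] by metis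
  qed
qed

lemma SET_monic:
  assumes f: "f \<in> hom SET A B" and i: "injective_map f"
  shows "monic SET f"
  unfolding monic_def
proof (intro conjI ballI impI)
  show "f \<in> Arr SET" using f by (simp add: hom_def)
  fix W g h
  assume gh: "g \<in> hom SET W (Dom SET f)" "h \<in> hom SET W (Dom SET f)"
    "f \<cdot>\<^bsub>SET\<^esub> g = f \<cdot>\<^bsub>SET\<^esub> h"
  then have g: "g \<in> hom SET W A" and h: "h \<in> hom SET W A" using f by (auto simp: hom_def)
  show "g = h"
  proof (rule SET_eqI[OF g h])
    fix x assume x: "x \<in> W"
    then have "fun_of f (fun_of g x) = fun_of f (fun_of h x)"
      using gh(3) fun_of_Comp[OF g f x] fun_of_Comp[OF h f x] by metis
    then show "fun_of g x = fun_of h x"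
      using i injective_map_iff[OF f] fun_of_hom[OF g] fun_of_hom[OF h] x
      by (auto dest: inj_onD)
  qed
qed

lemma SET_isomorphism_bij:
  assumes f: "f \<in> hom SET A B" and "isomorphism SET f"
  shows "bij_betw (fun_of f) A B"
proof -
  obtain g where g: "g \<in> hom SET B A" "g \<cdot>\<^bsub>SET\<^esub> f = Id SET A" "f \<cdot>\<^bsub>SET\<^esub> g = Id SET B"
    using assms category.isomorphismE[OF category_SET] by blast
  show ?thesis
  proof (rule bij_betwI)
    show "fun_of g (fun_of f x) = x" if "x \<in> A" for x
      using fun_of_Comp[OF f g(1) that] g(2) fun_of_Id[OF that] by metis
    show "fun_of f (fun_of g x) = x" if "x \<in> B" for x
      using fun_of_Comp[OF g(1) f that] g(3) fun_of_Id[OF that] by metis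
  qed (use fun_of_hom[OF f] fun_of_hom[OF g(1)] in auto)
qed

section \<open>Factoring functions, and recognizing pushouts and pullbacks of sets\<close>

lemma small_image: "small u A \<Longrightarrow> small u (f ` A)"
  unfolding small_def using image_lepoll lesspoll_trans1 by blast

lemma small_finite: "universe u \<Longrightarrow> finite A \<Longrightarrow> small u A" for A :: "'b set"
  unfolding small_def universe_def by (rule finite_lesspoll_infinite) auto

text \<open>\<open>inv_into\<close> selects a section of the surjection \<open>f\<close>, and
  hypothesis \<open>k\<close> makes the value of \<open>t\<close> independent of the representative
  chosen.\<close>

lemma SET_factor_surj:
  fixes A B D :: "'u set"
  assumes f: "f \<in> hom SET A B" and s: "surjective_map f" and D: "small TYPE('u) D"
    and t: "t \<in> A \<rightarrow> D" and k: "\<And>x y. \<lbrakk>x \<in> A; y \<in> A; fun_of f x = fun_of f y\<rbrakk> \<Longrightarrow> t x = t y"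
  shows "\<exists>u \<in> hom SET B D. \<forall>x\<in>A. fun_of u (fun_of f x) = t x"
proof
  define s where "s y = inv_into A (fun_of f) y" for y
  have img: "fun_of f ` A = B" using s f surjective_map_iff by blast
  have sec: "s y \<in> A" "fun_of f (s y) = y" if "y \<in> B" for y
    using that img unfolding s_def by (auto simp: inv_into_into f_inv_into_f)
  let ?u = "(B, restrict (\<lambda>y. t (s y)) B, D)"
  show "?u \<in> hom SET B D"
    by (rule SET_mapI) (use SET_Obj[OF f] D t sec in auto)
  show "\<forall>x\<in>A. fun_of ?u (fun_of f x) = t x"
  proof
    fix x assume x: "x \<in> A"
    then have fx: "fun_of f x \<in> B" using img by blast
    then show "fun_of ?u (fun_of f x) = t x"
      using k[OF sec(1)[OF fx] x sec(2)[OF fx]] by simp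
  qed
qed

lemma SET_factor_inj:
  fixes A B D :: "'u set"
  assumes f: "f \<in> hom SET A B" and D: "small TYPE('u) D"
    and k: "t ` D \<subseteq> fun_of f ` A"
  shows "\<exists>u \<in> hom SET D A. \<forall>x\<in>D. fun_of f (fun_of u x) = t x"
proof
  define s where "s y = inv_into A (fun_of f) (t y)" for y
  have sec: "s y \<in> A" "fun_of f (s y) = t y" if "y \<in> D" for y
    using that k unfolding s_def by (auto simp: inv_into_into f_inv_into_f subset_iff)
  show "(D, restrict s D, A) \<in> hom SET D A"
    by (rule SET_mapI) (use SET_Obj[OF f] D sec in auto)
  show "\<forall>x\<in>D. fun_of f (fun_of (D, restrict s D, A) x) = t x"
    using sec by simp
qed

text \<open>A commutative square of surjections is a pushout once the kernel of
  \<open>p \<cdot> f\<close> is no larger than the equivalence relation generated by the kernels of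
  \<open>f\<close> and \<open>g\<close>. Hypothesis \<open>t\<close> expresses this without
  transitive closures: every function constant on the classes of both kernels is constant on those
  of the composite. Values in \<open>'u\<close> suffice because every cocone takes its values
  there.\<close>

lemma SET_pushoutI:
  fixes X A B P :: "'u set"
  assumes f: "f \<in> hom SET X A" and g: "g \<in> hom SET X B"
    and p: "p \<in> hom SET A P" and q: "q \<in> hom SET B P"
    and comm: "p \<cdot>\<^bsub>SET\<^esub> f = q \<cdot>\<^bsub>SET\<^esub> g"
    and sf: "surjective_map f" and sg: "surjective_map g" and sp: "surjective_map p"
    and t: "\<And>(t :: 'u \<Rightarrow> 'u) x y.
      \<lbrakk>\<And>x y. \<lbrakk>x \<in> X; y \<in> X; fun_of f x = fun_of f y\<rbrakk> \<Longrightarrow> t x = t y;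
       \<And>x y. \<lbrakk>x \<in> X; y \<in> X; fun_of g x = fun_of g y\<rbrakk> \<Longrightarrow> t x = t y;
       x \<in> X; y \<in> X; fun_of p (fun_of f x) = fun_of p (fun_of f y)\<rbrakk> \<Longrightarrow> t x = t y"
  shows "is_pushout SET f g p q"
proof -
  interpret S: category "SET :: ('u set, 'u set_map) cat" by (rule category_SET)
  have DC: "Dom SET f = X" "Cod SET f = A" "Dom SET g = X" "Cod SET g = B"
    "Dom SET p = A" "Cod SET p = P" "Dom SET q = B" "Cod SET q = P"
    "f \<in> Arr SET" "g \<in> Arr SET" "p \<in> Arr SET" "q \<in> Arr SET"
    using f g p q by (auto simp: hom_def)
  have pf: "p \<cdot>\<^bsub>SET\<^esub> f \<in> hom SET X P" using S.Comp_in_hom f p by blast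
  have img: "fun_of f ` X = A" "fun_of g ` X = B" "fun_of p ` A = P"
    using f g p sf sg sp surjective_map_iff by blast+
  have spf: "surjective_map (p \<cdot>\<^bsub>SET\<^esub> f)"
    using surjective_map_iff[OF pf] fun_of_Comp[OF f p] img by (simp add: image_def) blast
  show ?thesis
    unfolding is_pushout_def DC
  proof (intro conjI ballI impI refl TrueI comm)
    fix Z u v
    assume Z: "Z \<in> Obj SET" and u: "u \<in> hom SET A Z" and v: "v \<in> hom SET B Z"
      and uv: "u \<cdot>\<^bsub>SET\<^esub> f = v \<cdot>\<^bsub>SET\<^esub> g"
    let ?t = "\<lambda>x. fun_of u (fun_of f x)"
    have t': "?t x = fun_of v (fun_of g x)" if "x \<in> X" for x
      using fun_of_Comp[OF f u that] fun_of_Comp[OF g v that] uv by simp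
    have pq: "fun_of p (fun_of f x) = fun_of q (fun_of g x)" if "x \<in> X" for x
      using fun_of_Comp[OF f p that] fun_of_Comp[OF g q that] comm by simp
    have "\<exists>h \<in> hom SET P Z. \<forall>x\<in>X. fun_of h (fun_of (p \<cdot>\<^bsub>SET\<^esub> f) x) = ?t x"
    \<comment> \<open>The mediating map is built from \<open>X\<close>: the composite of
      \<open>f\<close> and \<open>u\<close> is factored through the surjection
      \<open>p \<cdot> f\<close>, and this composite is the test function to which hypothesis
      \<open>t\<close> is applied.\<close>
    proof (rule SET_factor_surj[OF pf spf])
      show "small TYPE('u) Z" using Z Obj_SET by blast
      show "?t \<in> X \<rightarrow> Z" using fun_of_hom[OF f] fun_of_hom[OF u] by auto
      fix x y assume xy: "x \<in> X" "y \<in> X" "fun_of (p \<cdot>\<^bsub>SET\<^esub> f) x = fun_of (p \<cdot>\<^bsub>SET\<^esub> f) y"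
      show "?t x = ?t y"
      proof (rule t[of ?t])
        show "?t x = ?t y" if "x \<in> X" "y \<in> X" "fun_of g x = fun_of g y" for x y
          using t'[OF that(1)] t'[OF that(2)] that(3) by simp
      qed (use xy fun_of_Comp[OF f p] in auto)
    qed
    then obtain h where h: "h \<in> hom SET P Z"
      and ht: "\<And>x. x \<in> X \<Longrightarrow> fun_of h (fun_of p (fun_of f x)) = ?t x"
      using fun_of_Comp[OF f p] by auto
    have 1: "h \<cdot>\<^bsub>SET\<^esub> p = u"
    proof (rule SET_eqI[OF S.Comp_in_hom[OF p h] u])
      fix a assume a: "a \<in> A"
      then obtain x where "x \<in> X" "a = fun_of f x" using img by blast
      then show "fun_of (h \<cdot>\<^bsub>SET\<^esub> p) a = fun_of u a"
        using fun_of_Comp[OF p h a] ht by simp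
    qed
    have 2: "h \<cdot>\<^bsub>SET\<^esub> q = v"
    proof (rule SET_eqI[OF S.Comp_in_hom[OF q h] v])
      fix b assume b: "b \<in> B"
      then obtain x where "x \<in> X" "b = fun_of g x" using img by blast
      then show "fun_of (h \<cdot>\<^bsub>SET\<^esub> q) b = fun_of v b"
        using fun_of_Comp[OF q h b] ht pq t' by simp
    qed
    have 3: "k = h" if "k \<in> hom SET P Z" "k \<cdot>\<^bsub>SET\<^esub> p = u" for k
      using epicD[OF SET_epic[OF p sp] p that(1) h Z] that 1 by simp
    show "\<exists>!h. h \<in> hom SET P Z \<and> h \<cdot>\<^bsub>SET\<^esub> p = u \<and> h \<cdot>\<^bsub>SET\<^esub> q = v"
      using h 1 2 3 by blast
  qed (use DC in auto)
qed

text \<open>A cone sends each point into the intersection of the images of \<open>f\<close> and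
  \<open>g\<close>. Hypothesis \<open>t\<close> lifts that point to \<open>P\<close>, and
  injectivity makes the lift compatible with both projections and unique.\<close>

lemma SET_pullbackI:
  fixes X A B P :: "'u set"
  assumes f: "f \<in> hom SET A X" and g: "g \<in> hom SET B X"
    and p: "p \<in> hom SET P A" and q: "q \<in> hom SET P B"
    and comm: "f \<cdot>\<^bsub>SET\<^esub> p = g \<cdot>\<^bsub>SET\<^esub> q"
    and injf: "injective_map f" and ig: "injective_map g" and ip: "injective_map p"
    and t: "fun_of f ` A \<inter> fun_of g ` B \<subseteq> (\<lambda>x. fun_of f (fun_of p x)) ` P"
  shows "is_pullback SET f g p q"
proof -
  interpret S: category "SET :: ('u set, 'u set_map) cat" by (rule category_SET)
  have DC: "Dom SET f = A" "Cod SET f = X" "Dom SET g = B" "Cod SET g = X"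
    "Dom SET p = P" "Cod SET p = A" "Dom SET q = P" "Cod SET q = B"
    "f \<in> Arr SET" "g \<in> Arr SET" "p \<in> Arr SET" "q \<in> Arr SET"
    using f g p q by (auto simp: hom_def)
  have fp: "f \<cdot>\<^bsub>SET\<^esub> p \<in> hom SET P X" using S.Comp_in_hom f p by blast
  show ?thesis
    unfolding is_pullback_def DC
  proof (intro conjI ballI impI refl TrueI comm)
    fix Z u v
    assume Z: "Z \<in> Obj SET" and u: "u \<in> hom SET Z A" and v: "v \<in> hom SET Z B"
      and uv: "f \<cdot>\<^bsub>SET\<^esub> u = g \<cdot>\<^bsub>SET\<^esub> v"
    let ?t = "\<lambda>x. fun_of f (fun_of u x)"
    have t': "?t x = fun_of g (fun_of v x)" if "x \<in> Z" for x
      using fun_of_Comp[OF u f that] fun_of_Comp[OF v g that] uv by simp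
    have pq: "fun_of f (fun_of p x) = fun_of g (fun_of q x)" if "x \<in> P" for x
      using fun_of_Comp[OF p f that] fun_of_Comp[OF q g that] comm by simp
    \<comment> \<open>Lifting happens over \<open>X\<close>, where both legs of the cone coincide;
      cancelling \<open>f\<close> or \<open>g\<close> afterwards recovers the two projections
      separately.\<close>
    have "\<exists>h \<in> hom SET Z P. \<forall>x\<in>Z. fun_of (f \<cdot>\<^bsub>SET\<^esub> p) (fun_of h x) = ?t x"
    proof (rule SET_factor_inj[OF fp])
      show "small TYPE('u) Z" using Z Obj_SET by blast
      show "?t ` Z \<subseteq> fun_of (f \<cdot>\<^bsub>SET\<^esub> p) ` P"
      proof (clarsimp)
        fix z assume z: "z \<in> Z"
        then have "?t z \<in> fun_of f ` A \<inter> fun_of g ` B"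
          using t'[OF z] imageI[of "fun_of u z" A "fun_of f"] imageI[of "fun_of v z" B "fun_of g"]
            fun_of_hom[OF u] fun_of_hom[OF v] by auto
        then obtain x where "x \<in> P" "?t z = fun_of f (fun_of p x)" using t by blast
        then show "?t z \<in> fun_of (f \<cdot>\<^bsub>SET\<^esub> p) ` P"
          using fun_of_Comp[OF p f] by auto
      qed
    qed
    then obtain h where h: "h \<in> hom SET Z P"
      and ht: "\<And>x. x \<in> Z \<Longrightarrow> fun_of (f \<cdot>\<^bsub>SET\<^esub> p) (fun_of h x) = ?t x"
      by auto
    have ht: "fun_of f (fun_of p (fun_of h x)) = ?t x" if "x \<in> Z" for x
      using ht[OF that] fun_of_Comp[OF p f funcset_mem[OF fun_of_hom[OF h] that]] by simp
    have 1: "p \<cdot>\<^bsub>SET\<^esub> h = u"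
    proof (rule SET_eqI[OF S.Comp_in_hom[OF h p] u])
      fix z assume z: "z \<in> Z"
      then have "fun_of p (fun_of h z) = fun_of u z"
        using ht[OF z] injf injective_map_iff[OF f] fun_of_hom[OF u] fun_of_hom[OF h] fun_of_hom[OF p]
        by (auto dest!: inj_onD)
      then show "fun_of (p \<cdot>\<^bsub>SET\<^esub> h) z = fun_of u z"
        using fun_of_Comp[OF h p z] by simp
    qed
    have 2: "q \<cdot>\<^bsub>SET\<^esub> h = v"
    proof (rule SET_eqI[OF S.Comp_in_hom[OF h q] v])
      fix z assume z: "z \<in> Z"
      then have "fun_of g (fun_of q (fun_of h z)) = fun_of g (fun_of v z)"
        using ht[OF z] t'[OF z] pq[OF funcset_mem[OF fun_of_hom[OF h] z]] by simp
      then have "fun_of q (fun_of h z) = fun_of v z"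
        using z ig injective_map_iff[OF g] fun_of_hom[OF v] fun_of_hom[OF h] fun_of_hom[OF q]
        by (auto dest!: inj_onD)
      then show "fun_of (q \<cdot>\<^bsub>SET\<^esub> h) z = fun_of v z"
        using fun_of_Comp[OF h q z] by simp
    qed
    have 3: "k = h" if "k \<in> hom SET Z P" "p \<cdot>\<^bsub>SET\<^esub> k = u" for k
      using monicD[OF SET_monic[OF p ip] p that(1) h Z] that 1 by simp
    show "\<exists>!h. h \<in> hom SET Z P \<and> p \<cdot>\<^bsub>SET\<^esub> h = u \<and> q \<cdot>\<^bsub>SET\<^esub> h = v"
      using h 1 2 3 by blast
  qed (use DC in auto)
qed

text \<open>The test function \<open>t\<close> is a cocone in disguise: it descends along
  \<open>f\<close> and along \<open>g\<close> to maps into its own range, which is small as the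
  image of a small set. The mediating map then recovers \<open>t\<close> from the composite of
  \<open>f\<close> and \<open>p\<close>.\<close>

lemma SET_pushoutD:
  fixes X A B :: "'u set" and t :: "'u \<Rightarrow> 'u"
  assumes po: "is_pushout SET f g p q" and f: "f \<in> hom SET X A" and g: "g \<in> hom SET X B"
    and sf: "surjective_map f" and sg: "surjective_map g"
    and tf: "\<And>x y. \<lbrakk>x \<in> X; y \<in> X; fun_of f x = fun_of f y\<rbrakk> \<Longrightarrow> t x = t y"
    and tg: "\<And>x y. \<lbrakk>x \<in> X; y \<in> X; fun_of g x = fun_of g y\<rbrakk> \<Longrightarrow> t x = t y"
    and xy: "x \<in> X" "y \<in> X" "fun_of p (fun_of f x) = fun_of p (fun_of f y)"
  shows "t x = t y"
proof -
  interpret S: category "SET :: ('u set, 'u set_map) cat" by (rule category_SET)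
  let ?Z = "t ` X"
  have Z: "small TYPE('u) ?Z" using SET_Obj[OF f] small_image by blast
  have tZ: "t \<in> X \<rightarrow> ?Z" by auto
  obtain u where u: "u \<in> hom SET A ?Z" "\<And>x. x \<in> X \<Longrightarrow> fun_of u (fun_of f x) = t x"
    using SET_factor_surj[OF f sf Z tZ tf] by blast
  obtain v where v: "v \<in> hom SET B ?Z" "\<And>x. x \<in> X \<Longrightarrow> fun_of v (fun_of g x) = t x"
    using SET_factor_surj[OF g sg Z tZ tg] by blast
  have eq: "u \<cdot>\<^bsub>SET\<^esub> f = v \<cdot>\<^bsub>SET\<^esub> g"
    by (rule SET_eqI[OF S.Comp_in_hom[OF f u(1)] S.Comp_in_hom[OF g v(1)]])
      (simp add: fun_of_Comp[OF f u(1)] fun_of_Comp[OF g v(1)] u(2) v(2))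
  from po f g obtain P where p: "p \<in> hom SET A P" 
    and ex: "\<And>Z u v. \<lbrakk>u \<in> hom SET A Z; v \<in> hom SET B Z; u \<cdot>\<^bsub>SET\<^esub> f = v \<cdot>\<^bsub>SET\<^esub> g\<rbrakk> \<Longrightarrow>
       \<exists>h \<in> hom SET P Z. h \<cdot>\<^bsub>SET\<^esub> p = u \<and> h \<cdot>\<^bsub>SET\<^esub> q = v"
    by (rule S.pushoutE) blast
  obtain h where h: "h \<in> hom SET P ?Z" "h \<cdot>\<^bsub>SET\<^esub> p = u"
    using ex[OF u(1) v(1) eq] by blast
  have "fun_of h (fun_of p (fun_of f x)) = t x" if "x \<in> X" for x
    using fun_of_Comp[OF p h(1) funcset_mem[OF fun_of_hom[OF f] that]] u(2)[OF that] h(2) by simp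
  then show ?thesis using xy by metis
qed

text \<open>Points are maps from the set \<open>{y}\<close>, which is small because the universe is
  infinite. Preimages of \<open>y\<close> under \<open>f\<close> and \<open>g\<close> give a cone
  with vertex \<open>{y}\<close>, and its mediating map names a point of the apex over
  \<open>y\<close>.\<close>

lemma SET_pullbackD:
  fixes X A B :: "'u set"
  assumes pb: "is_pullback SET f g p q" and f: "f \<in> hom SET A X" and g: "g \<in> hom SET B X"
    and uni: "universe TYPE('u)"
    and y: "y \<in> fun_of f ` A" "y \<in> fun_of g ` B"
  shows "y \<in> fun_of (f \<cdot>\<^bsub>SET\<^esub> p) ` Dom SET p"
proof -
  interpret S: category "SET :: ('u set, 'u set_map) cat" by (rule category_SET)
  have W: "small TYPE('u) {y}" by (rule small_finite[OF uni]) simp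
  obtain u where u: "u \<in> hom SET {y} A" "fun_of f (fun_of u y) = y"
    using SET_factor_inj[OF f W, of id] y(1) by (simp del: image_iff) blast
  obtain v where v: "v \<in> hom SET {y} B" "fun_of g (fun_of v y) = y"
    using SET_factor_inj[OF g W, of id] y(2) by (simp del: image_iff) blast
  have eq: "f \<cdot>\<^bsub>SET\<^esub> u = g \<cdot>\<^bsub>SET\<^esub> v"
    by (rule SET_eqI[OF S.Comp_in_hom[OF u(1) f] S.Comp_in_hom[OF v(1) g]])
      (simp add: fun_of_Comp[OF u(1) f] fun_of_Comp[OF v(1) g] u(2) v(2))
  from pb f g obtain P where p: "p \<in> hom SET P A" 
    and ex: "\<And>Z u v. \<lbrakk>u \<in> hom SET Z A; v \<in> hom SET Z B; f \<cdot>\<^bsub>SET\<^esub> u = g \<cdot>\<^bsub>SET\<^esub> v\<rbrakk> \<Longrightarrow>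
       \<exists>h \<in> hom SET Z P. p \<cdot>\<^bsub>SET\<^esub> h = u \<and> q \<cdot>\<^bsub>SET\<^esub> h = v"
    by (rule S.pullbackE) blast
  obtain h where h: "h \<in> hom SET {y} P" "p \<cdot>\<^bsub>SET\<^esub> h = u"
    using ex[OF u(1) v(1) eq] by blast
  have hy: "fun_of h y \<in> P" using funcset_mem[OF fun_of_hom[OF h(1)]] by simp
  have "fun_of (f \<cdot>\<^bsub>SET\<^esub> p) (fun_of h y) = y"
    using fun_of_Comp[OF h(1) p, of y] fun_of_Comp[OF p f hy] h(2) u(2) by simp
  moreover have "Dom SET p = P" using p by (simp add: hom_def)
  ultimately show ?thesis using imageI[OF hy, of "fun_of (f \<cdot>\<^bsub>SET\<^esub> p)"] by simp
qed

section \<open>The functor of a noetherian form\<close>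

locale noetherian_category = category C for C :: "('o, 'a) cat" (structure) +
  fixes F :: "('o, 'a, 'u) form"
  assumes noetherian: "noetherian_form C F"
begin

abbreviation (input) clusters :: "'o \<Rightarrow> 'u set" where "clusters X \<equiv> carrier (fibre F X)"

section \<open>Order and lattice calculus in the fibres\<close>

lemma form: "is_form C F"
  using noetherian by (simp add: noetherian_form_def)

lemma fibre_lattice: "X \<in> Obj C \<Longrightarrow> bounded_lattice (fibre F X)"
  and fibre_small: "X \<in> Obj C \<Longrightarrow> small TYPE('u) (clusters X)"
  using form by (simp_all add: is_form_def)

text \<open>This and the next lemmas re-export the lattice laws with the object \<open>X\<close>
  explicit, because the arguments below move between fibres over different objects.\<close>

lemma fibre_refl: "\<lbrakk>X \<in> Obj C; S \<in> clusters X\<rbrakk> \<Longrightarrow> S \<sqsubseteq>\<^bsub>fibre F X\<^esub> S"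
proof -
  assume "X \<in> Obj C" "S \<in> clusters X"
  then interpret L: bounded_lattice "fibre F X" by (simp add: fibre_lattice)
  show ?thesis by (rule L.le_refl) fact
qed

lemma fibre_antisym:
  assumes "X \<in> Obj C" "S \<sqsubseteq>\<^bsub>fibre F X\<^esub> T" "T \<sqsubseteq>\<^bsub>fibre F X\<^esub> S" "S \<in> clusters X" "T \<in> clusters X"
  shows "S = T"
proof -
  interpret L: bounded_lattice "fibre F X" using assms(1) by (simp add: fibre_lattice)
  show ?thesis by (rule L.le_antisym) fact+
qed

lemma fibre_bounds:
  assumes "X \<in> Obj C"
  shows "\<bottom>\<^bsub>fibre F X\<^esub> \<in> clusters X" "\<top>\<^bsub>fibre F X\<^esub> \<in> clusters X"
    "S \<in> clusters X \<Longrightarrow> \<bottom>\<^bsub>fibre F X\<^esub> \<sqsubseteq>\<^bsub>fibre F X\<^esub> S"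
    "S \<in> clusters X \<Longrightarrow> S \<sqsubseteq>\<^bsub>fibre F X\<^esub> \<top>\<^bsub>fibre F X\<^esub>"
proof -
  interpret L: bounded_lattice "fibre F X" using assms(1) by (simp add: fibre_lattice)
  show "\<bottom>\<^bsub>fibre F X\<^esub> \<in> clusters X" "\<top>\<^bsub>fibre F X\<^esub> \<in> clusters X"
    "S \<in> clusters X \<Longrightarrow> \<bottom>\<^bsub>fibre F X\<^esub> \<sqsubseteq>\<^bsub>fibre F X\<^esub> S"
    "S \<in> clusters X \<Longrightarrow> S \<sqsubseteq>\<^bsub>fibre F X\<^esub> \<top>\<^bsub>fibre F X\<^esub>"
    by auto
qed

lemma fibre_le_bottom:
  "\<lbrakk>X \<in> Obj C; S \<in> clusters X; S \<sqsubseteq>\<^bsub>fibre F X\<^esub> \<bottom>\<^bsub>fibre F X\<^esub>\<rbrakk> \<Longrightarrow> S = \<bottom>\<^bsub>fibre F X\<^esub>"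
  by (rule fibre_antisym[where X = X]) (simp_all add: fibre_bounds)

lemma fibre_top_le:
  "\<lbrakk>X \<in> Obj C; S \<in> clusters X; \<top>\<^bsub>fibre F X\<^esub> \<sqsubseteq>\<^bsub>fibre F X\<^esub> S\<rbrakk> \<Longrightarrow> S = \<top>\<^bsub>fibre F X\<^esub>"
  by (rule fibre_antisym[where X = X]) (simp_all add: fibre_bounds)

lemma fibre_join:
  assumes "X \<in> Obj C" "S \<in> clusters X" "T \<in> clusters X"
  shows "S \<squnion>\<^bsub>fibre F X\<^esub> T \<in> clusters X"
    "S \<sqsubseteq>\<^bsub>fibre F X\<^esub> S \<squnion>\<^bsub>fibre F X\<^esub> T" "T \<sqsubseteq>\<^bsub>fibre F X\<^esub> S \<squnion>\<^bsub>fibre F X\<^esub> T"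
    "\<lbrakk>U \<in> clusters X; S \<sqsubseteq>\<^bsub>fibre F X\<^esub> U; T \<sqsubseteq>\<^bsub>fibre F X\<^esub> U\<rbrakk> \<Longrightarrow> S \<squnion>\<^bsub>fibre F X\<^esub> T \<sqsubseteq>\<^bsub>fibre F X\<^esub> U"
proof -
  interpret L: bounded_lattice "fibre F X" using assms(1) by (simp add: fibre_lattice)
  show "S \<squnion>\<^bsub>fibre F X\<^esub> T \<in> clusters X"
    "S \<sqsubseteq>\<^bsub>fibre F X\<^esub> S \<squnion>\<^bsub>fibre F X\<^esub> T" "T \<sqsubseteq>\<^bsub>fibre F X\<^esub> S \<squnion>\<^bsub>fibre F X\<^esub> T"
    "\<lbrakk>U \<in> clusters X; S \<sqsubseteq>\<^bsub>fibre F X\<^esub> U; T \<sqsubseteq>\<^bsub>fibre F X\<^esub> U\<rbrakk> \<Longrightarrow> S \<squnion>\<^bsub>fibre F X\<^esub> T \<sqsubseteq>\<^bsub>fibre F X\<^esub> U"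
    using assms L.join_left L.join_right L.join_le by auto
qed

lemma fibre_join_assoc:
  assumes "X \<in> Obj C" "S \<in> clusters X" "T \<in> clusters X" "U \<in> clusters X"
  shows "(S \<squnion>\<^bsub>fibre F X\<^esub> T) \<squnion>\<^bsub>fibre F X\<^esub> U = S \<squnion>\<^bsub>fibre F X\<^esub> (T \<squnion>\<^bsub>fibre F X\<^esub> U)"
proof -
  interpret L: bounded_lattice "fibre F X" using assms(1) by (simp add: fibre_lattice)
  show ?thesis using L.weak_join_assoc[OF assms(2-4)] L.eq_is_equal by simp
qed

lemma fibre_join_bot:
  assumes "X \<in> Obj C" "S \<in> clusters X"
  shows "S \<squnion>\<^bsub>fibre F X\<^esub> \<bottom>\<^bsub>fibre F X\<^esub> = S"
proof -
  interpret L: bounded_lattice "fibre F X" using assms(1) by (simp add: fibre_lattice)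
  show ?thesis using L.bottom_join[OF assms(2)] L.eq_is_equal join_comm by metis
qed

lemma fibre_meet:
  assumes "X \<in> Obj C" "S \<in> clusters X" "T \<in> clusters X"
  shows "S \<sqinter>\<^bsub>fibre F X\<^esub> T \<in> clusters X"
    "S \<sqinter>\<^bsub>fibre F X\<^esub> T \<sqsubseteq>\<^bsub>fibre F X\<^esub> S" "S \<sqinter>\<^bsub>fibre F X\<^esub> T \<sqsubseteq>\<^bsub>fibre F X\<^esub> T"
    "\<lbrakk>U \<in> clusters X; U \<sqsubseteq>\<^bsub>fibre F X\<^esub> S; U \<sqsubseteq>\<^bsub>fibre F X\<^esub> T\<rbrakk> \<Longrightarrow> U \<sqsubseteq>\<^bsub>fibre F X\<^esub> S \<sqinter>\<^bsub>fibre F X\<^esub> T"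
    "S \<sqsubseteq>\<^bsub>fibre F X\<^esub> T \<Longrightarrow> S \<sqinter>\<^bsub>fibre F X\<^esub> T = S"
proof -
  interpret L: bounded_lattice "fibre F X" using assms(1) by (simp add: fibre_lattice)
  show "S \<sqinter>\<^bsub>fibre F X\<^esub> T \<in> clusters X"
    "S \<sqinter>\<^bsub>fibre F X\<^esub> T \<sqsubseteq>\<^bsub>fibre F X\<^esub> S" "S \<sqinter>\<^bsub>fibre F X\<^esub> T \<sqsubseteq>\<^bsub>fibre F X\<^esub> T"
    "\<lbrakk>U \<in> clusters X; U \<sqsubseteq>\<^bsub>fibre F X\<^esub> S; U \<sqsubseteq>\<^bsub>fibre F X\<^esub> T\<rbrakk> \<Longrightarrow> U \<sqsubseteq>\<^bsub>fibre F X\<^esub> S \<sqinter>\<^bsub>fibre F X\<^esub> T"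
    using assms L.meet_left L.meet_right L.meet_le by auto
  show "S \<sqsubseteq>\<^bsub>fibre F X\<^esub> T \<Longrightarrow> S \<sqinter>\<^bsub>fibre F X\<^esub> T = S"
    using L.le_iff_join[OF assms(2,3)] by simp
qed

section \<open>Direct and inverse images, kernels and images of morphisms\<close>

context
  fixes f X Y
  assumes f: "f \<in> hom C X Y"
begin

lemma arrow: "f \<in> Arr C" "Dom C f = X" "Cod C f = Y" "X \<in> Obj C" "Y \<in> Obj C"
  using f hom_Obj[OF f] by (auto simp: hom_def)

lemma dir_closed: "S \<in> clusters X \<Longrightarrow> dir F f S \<in> clusters Y"
  and inv_closed: "T \<in> clusters Y \<Longrightarrow> inv_im F f T \<in> clusters X"
  and dir_mono: "\<lbrakk>S \<in> clusters X; T \<in> clusters X; S \<sqsubseteq>\<^bsub>fibre F X\<^esub> T\<rbrakk> \<Longrightarrow>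
    dir F f S \<sqsubseteq>\<^bsub>fibre F Y\<^esub> dir F f T"
  and inv_mono: "\<lbrakk>U \<in> clusters Y; V \<in> clusters Y; U \<sqsubseteq>\<^bsub>fibre F Y\<^esub> V\<rbrakk> \<Longrightarrow>
    inv_im F f U \<sqsubseteq>\<^bsub>fibre F X\<^esub> inv_im F f V"
  and adjunction: "\<lbrakk>S \<in> clusters X; U \<in> clusters Y\<rbrakk> \<Longrightarrow>
    dir F f S \<sqsubseteq>\<^bsub>fibre F Y\<^esub> U \<longleftrightarrow> S \<sqsubseteq>\<^bsub>fibre F X\<^esub> inv_im F f U"
  using form arrow unfolding is_form_def isotone_def by auto

lemma Im_eq: "Im C F f = dir F f \<top>\<^bsub>fibre F X\<^esub>"
  and Ker_eq: "Ker C F f = inv_im F f \<bottom>\<^bsub>fibre F Y\<^esub>"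
  using arrow by (simp_all add: Im_def Ker_def)

lemma Im_closed: "Im C F f \<in> clusters Y"
  and Ker_closed: "Ker C F f \<in> clusters X"
  unfolding Im_eq Ker_eq using dir_closed inv_closed fibre_bounds arrow by auto

lemma inv_dir: "S \<in> clusters X \<Longrightarrow> inv_im F f (dir F f S) = S \<squnion>\<^bsub>fibre F X\<^esub> Ker C F f"
  and dir_inv: "T \<in> clusters Y \<Longrightarrow> dir F f (inv_im F f T) = T \<sqinter>\<^bsub>fibre F Y\<^esub> Im C F f"
  using noetherian arrow unfolding noetherian_form_def by auto

lemma dir_le_Im: "S \<in> clusters X \<Longrightarrow> dir F f S \<sqsubseteq>\<^bsub>fibre F Y\<^esub> Im C F f"
  unfolding Im_eq using dir_mono fibre_bounds arrow by auto

text \<open>A left adjoint preserves the least element.\<close>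

lemma dir_bot: "dir F f \<bottom>\<^bsub>fibre F X\<^esub> = \<bottom>\<^bsub>fibre F Y\<^esub>"
proof (rule fibre_le_bottom)
  show "dir F f \<bottom>\<^bsub>fibre F X\<^esub> \<sqsubseteq>\<^bsub>fibre F Y\<^esub> \<bottom>\<^bsub>fibre F Y\<^esub>"
    using adjunction fibre_bounds arrow inv_closed by simp
qed (simp_all add: dir_closed fibre_bounds arrow)

text \<open>By the first half of (N1) the join is the inverse image of \<open>dir F f S\<close>; by
  the second half its direct image is \<open>dir F f S \<sqinter> Im f\<close>, which is
  \<open>dir F f S\<close> again. So joining with the kernel is invisible to the direct
  image.\<close>

lemma dir_inv_dir:
  assumes S: "S \<in> clusters X"
  shows "dir F f (S \<squnion>\<^bsub>fibre F X\<^esub> Ker C F f) = dir F f S"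
  using inv_dir[OF S] dir_inv[OF dir_closed[OF S]] fibre_meet(5)[OF arrow(5) dir_closed[OF S] Im_closed]
    dir_le_Im[OF S] by simp

lemma factorization:
  obtains e m I where "is_quotient C F X (Ker C F f) e" "is_embedding C F Y (Im C F f) m"
    "e \<in> hom C X I" "m \<in> hom C I Y" "f = m \<cdot> e"
proof -
  obtain e m where "is_quotient C F X (Ker C F f) e" "is_embedding C F Y (Im C F f) m"
    "Cod C e = Dom C m" "f = m \<cdot> e"
    using noetherian arrow unfolding noetherian_form_def by blast
  then show thesis
    by (intro that[of e m "Dom C m"]) (auto simp: is_quotient_def is_embedding_def hom_def)
qed

end

lemma dir_Comp:
  "\<lbrakk>f \<in> hom C X Y; g \<in> hom C Y Z; S \<in> clusters X\<rbrakk> \<Longrightarrow> dir F (g \<cdot> f) S = dir F g (dir F f S)"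
  and inv_Comp:
  "\<lbrakk>f \<in> hom C X Y; g \<in> hom C Y Z; T \<in> clusters Z\<rbrakk> \<Longrightarrow> inv_im F (g \<cdot> f) T = inv_im F f (inv_im F g T)"
  using form unfolding is_form_def hom_def by auto

lemma dir_Id: "\<lbrakk>X \<in> Obj C; S \<in> clusters X\<rbrakk> \<Longrightarrow> dir F (Id C X) S = S"
  and inv_Id: "\<lbrakk>X \<in> Obj C; S \<in> clusters X\<rbrakk> \<Longrightarrow> inv_im F (Id C X) S = S"
  using form unfolding is_form_def by auto

lemma Im_Id: "X \<in> Obj C \<Longrightarrow> Im C F (Id C X) = \<top>\<^bsub>fibre F X\<^esub>"
  and Ker_Id: "X \<in> Obj C \<Longrightarrow> Ker C F (Id C X) = \<bottom>\<^bsub>fibre F X\<^esub>"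
  using Im_eq[OF Id_in_hom] Ker_eq[OF Id_in_hom] dir_Id inv_Id fibre_bounds by auto

lemma Im_Comp:
  assumes f: "f \<in> hom C X Y" and g: "g \<in> hom C Y Z"
  shows "Im C F (g \<cdot> f) = dir F g (Im C F f)"
    and "Im C F (g \<cdot> f) \<sqsubseteq>\<^bsub>fibre F Z\<^esub> Im C F g"
proof -
  show *: "Im C F (g \<cdot> f) = dir F g (Im C F f)"
    using Im_eq[OF Comp_in_hom[OF f g]] Im_eq[OF f] dir_Comp[OF f g] fibre_bounds hom_Obj[OF f] by simp
  show "Im C F (g \<cdot> f) \<sqsubseteq>\<^bsub>fibre F Z\<^esub> Im C F g"
    unfolding * using dir_le_Im[OF g Im_closed[OF f]] .
qed

lemma Ker_Comp:
  assumes f: "f \<in> hom C X Y" and g: "g \<in> hom C Y Z"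
  shows "Ker C F (g \<cdot> f) = inv_im F f (Ker C F g)"
    and "Ker C F f \<sqsubseteq>\<^bsub>fibre F X\<^esub> Ker C F (g \<cdot> f)"
proof -
  note Obs = hom_Obj[OF f] hom_Obj[OF g]
  show *: "Ker C F (g \<cdot> f) = inv_im F f (Ker C F g)"
    using Ker_eq[OF Comp_in_hom[OF f g]] Ker_eq[OF g] inv_Comp[OF f g] fibre_bounds Obs by simp
  show "Ker C F f \<sqsubseteq>\<^bsub>fibre F X\<^esub> Ker C F (g \<cdot> f)"
    unfolding * Ker_eq[OF f]
    using inv_mono[OF f] fibre_bounds Ker_closed[OF g] Obs by simp
qed

text \<open>The identity of \<open>Y\<close> factors through \<open>f\<close>, and the image of a
  composite lies below the image of its last factor.\<close>

lemma split_epi_Im: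
  assumes f: "f \<in> hom C X Y" and g: "g \<in> hom C Y X" and fg: "f \<cdot> g = Id C Y"
  shows "Im C F f = \<top>\<^bsub>fibre F Y\<^esub>"
proof -
  have Y: "Y \<in> Obj C" using hom_Obj f by blast
  show ?thesis
    using Im_Comp(2)[OF g f] fg Im_Id[OF Y] fibre_top_le[OF Y Im_closed[OF f]] by simp
qed

lemma split_mono_Ker:
  assumes f: "f \<in> hom C X Y" and g: "g \<in> hom C Y X" and gf: "g \<cdot> f = Id C X"
  shows "Ker C F f = \<bottom>\<^bsub>fibre F X\<^esub>"
proof -
  have X: "X \<in> Obj C" using hom_Obj f by blast
  show ?thesis
    using Ker_Comp(2)[OF f g] gf Ker_Id[OF X] fibre_le_bottom[OF X Ker_closed[OF f]] by simp
qed

section \<open>Cancellation for quotients and embeddings, and when direct images are injective or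
  surjective\<close>

lemma quotient_factor:
  assumes e: "is_quotient C F X K e" and h: "e \<in> hom C X A"
    and g: "g \<in> hom C X Y" and "K \<sqsubseteq>\<^bsub>fibre F X\<^esub> Ker C F g"
  shows "\<exists>h \<in> hom C A Y. g = h \<cdot> e"
    and "\<lbrakk>h \<in> hom C A Y; k \<in> hom C A Y; h \<cdot> e = g; k \<cdot> e = g\<rbrakk> \<Longrightarrow> h = k"
proof -
  have DC: "g \<in> Arr C" "Dom C g = X" "Cod C g = Y" "Cod C e = A"
    using g h by (simp_all add: hom_def)
  then have *: "\<exists>!h. h \<in> hom C A Y \<and> g = h \<cdot> e"
    using assms(1,4) unfolding is_quotient_def by metis
  show "\<exists>h \<in> hom C A Y. g = h \<cdot> e"
    using ex1_implies_ex[OF *] by blast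
  show "h = k" if "h \<in> hom C A Y" "k \<in> hom C A Y" "h \<cdot> e = g" "k \<cdot> e = g"
    by (rule ex1E[OF *]) (use that in metis)
qed

text \<open>The uniqueness clause in the definition of a quotient applies to
  \<open>k \<cdot> e\<close>, since composing after \<open>e\<close> can only enlarge the
  kernel.\<close>

lemma quotient_epic:
  assumes e: "is_quotient C F X K e" and h: "e \<in> hom C X A"
    and hk: "h \<in> hom C A Y" "k \<in> hom C A Y" "h \<cdot> e = k \<cdot> e"
  shows "h = k"
proof -
  have "K = Ker C F e" using e by (simp add: is_quotient_def)
  then have "K \<sqsubseteq>\<^bsub>fibre F X\<^esub> Ker C F (k \<cdot> e)" using Ker_Comp(2)[OF h hk(2)] by simp
  then show ?thesis
    by (rule quotient_factor(2)[OF e h Comp_in_hom[OF h hk(2)] _ hk(1,2) hk(3) refl])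
qed

lemma embedding_factor:
  assumes m: "is_embedding C F X S m" and h: "m \<in> hom C A X"
    and g: "g \<in> hom C Y X" and "Im C F g \<sqsubseteq>\<^bsub>fibre F X\<^esub> S"
  shows "\<exists>h \<in> hom C Y A. g = m \<cdot> h"
    and "\<lbrakk>h \<in> hom C Y A; k \<in> hom C Y A; m \<cdot> h = g; m \<cdot> k = g\<rbrakk> \<Longrightarrow> h = k"
proof -
  have DC: "g \<in> Arr C" "Cod C g = X" "Dom C g = Y" "Dom C m = A"
    using g h by (simp_all add: hom_def)
  then have *: "\<exists>!h. h \<in> hom C Y A \<and> g = m \<cdot> h"
    using assms(1,4) unfolding is_embedding_def by metis
  show "\<exists>h \<in> hom C Y A. g = m \<cdot> h"
    using ex1_implies_ex[OF *] by blast
  show "h = k" if "h \<in> hom C Y A" "k \<in> hom C Y A" "m \<cdot> h = g" "m \<cdot> k = g"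
    by (rule ex1E[OF *]) (use that in metis)
qed

lemma embedding_monic:
  assumes m: "is_embedding C F X S m" and h: "m \<in> hom C A X"
    and hk: "h \<in> hom C Y A" "k \<in> hom C Y A" "m \<cdot> h = m \<cdot> k"
  shows "h = k"
proof -
  have "S = Im C F m" using m by (simp add: is_embedding_def)
  then have "Im C F (m \<cdot> k) \<sqsubseteq>\<^bsub>fibre F X\<^esub> S" using Im_Comp(2)[OF hk(2) h] by simp
  then show ?thesis
    by (rule embedding_factor(2)[OF m h Comp_in_hom[OF hk(2) h] _ hk(1,2) hk(3) refl])
qed

text \<open>Factor \<open>q = m \<cdot> e\<close> by (N2). The factor \<open>e\<close> has the same
  kernel as \<open>q\<close>, so \<open>e = k \<cdot> q\<close> for some \<open>k\<close>, and
  cancelling \<open>q\<close> gives \<open>m \<cdot> k = Id\<close>. Hence the embedding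
  \<open>m\<close> of the image of \<open>q\<close> is split epic, and this image is the greatest
  cluster.\<close>

lemma quotient_Im:
  assumes q: "is_quotient C F X K q" and h: "q \<in> hom C X A"
  shows "Im C F q = \<top>\<^bsub>fibre F A\<^esub>"
proof -
  have K: "K = Ker C F q" using q by (simp add: is_quotient_def)
  obtain e m I where e: "is_quotient C F X (Ker C F q) e" and m: "is_embedding C F A (Im C F q) m"
    and em: "e \<in> hom C X I" "m \<in> hom C I A" "q = m \<cdot> e"
    using factorization[OF h] by metis
  have "Ker C F q \<sqsubseteq>\<^bsub>fibre F X\<^esub> Ker C F e"
    using e fibre_refl Ker_closed[OF h] hom_Obj[OF h] by (simp add: is_quotient_def)
  then obtain k where k: "k \<in> hom C A I" "e = k \<cdot> q"
    using quotient_factor(1)[OF q h em(1)] K by blast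
  have "(m \<cdot> k) \<cdot> q = Id C A \<cdot> q"
    using Comp_assoc[OF h k(1) em(2)] k(2)[symmetric] em(3)[symmetric] Id_Comp[OF h] by simp
  then have "m \<cdot> k = Id C A"
    using quotient_epic[OF q h Comp_in_hom[OF k(1) em(2)]] Id_in_hom hom_Obj[OF h] by blast
  then have "Im C F m = \<top>\<^bsub>fibre F A\<^esub>" using split_epi_Im em k by blast
  then show ?thesis using m by (simp add: is_embedding_def)
qed

text \<open>The dual argument: the embedding \<open>m\<close> in the (N2) factorization of
  \<open>i\<close> factors through \<open>i\<close>, which makes the quotient \<open>e\<close> of
  its kernel split monic.\<close>

lemma embedding_Ker:
  assumes i: "is_embedding C F X S i" and h: "i \<in> hom C A X"
  shows "Ker C F i = \<bottom>\<^bsub>fibre F A\<^esub>"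
proof -
  have S: "S = Im C F i" using i by (simp add: is_embedding_def)
  obtain e m I where e: "is_quotient C F A (Ker C F i) e" and m: "is_embedding C F X (Im C F i) m"
    and em: "e \<in> hom C A I" "m \<in> hom C I X" "i = m \<cdot> e"
    using factorization[OF h] by metis
  have "Im C F m \<sqsubseteq>\<^bsub>fibre F X\<^esub> Im C F i"
    using m fibre_refl Im_closed[OF h] hom_Obj[OF h] by (simp add: is_embedding_def)
  then obtain k where k: "k \<in> hom C I A" "m = i \<cdot> k"
    using embedding_factor(1)[OF i h em(2)] S by blast
  have "i \<cdot> (k \<cdot> e) = i \<cdot> Id C A"
    using Comp_assoc[OF em(1) k(1) h] k(2)[symmetric] em(3)[symmetric] Comp_Id[OF h] by simp
  then have "k \<cdot> e = Id C A"
    using embedding_monic[OF i h Comp_in_hom[OF em(1) k(1)]] Id_in_hom hom_Obj[OF h] by blast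
  then have "Ker C F e = \<bottom>\<^bsub>fibre F A\<^esub>" using split_mono_Ker em k by blast
  then show ?thesis using e by (simp add: is_quotient_def)
qed

text \<open>If \<open>dir F f\<close> is injective, the kernel equals the least cluster because both
  are sent to the least cluster. If the kernel is trivial, (N1) makes the inverse image a retraction
  of the direct image.\<close>

lemma dir_inj_iff:
  assumes f: "f \<in> hom C X Y"
  shows "inj_on (dir F f) (clusters X) \<longleftrightarrow> Ker C F f = \<bottom>\<^bsub>fibre F X\<^esub>"
proof
  note Obs = hom_Obj[OF f]
  assume inj: "inj_on (dir F f) (clusters X)"
  have bot: "\<bottom>\<^bsub>fibre F Y\<^esub> \<in> clusters Y" using fibre_bounds Obs by blast
  have "dir F f (Ker C F f) = \<bottom>\<^bsub>fibre F Y\<^esub>"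
    unfolding Ker_eq[OF f] dir_inv[OF f bot]
    using fibre_meet(5) fibre_bounds Obs Im_closed[OF f] by blast
  then show "Ker C F f = \<bottom>\<^bsub>fibre F X\<^esub>"
    using inj dir_bot[OF f] fibre_bounds Obs Ker_closed[OF f] by (metis inj_onD)
next
  note Obs = hom_Obj[OF f]
  assume "Ker C F f = \<bottom>\<^bsub>fibre F X\<^esub>"
  then have "inv_im F f (dir F f S) = S" if "S \<in> clusters X" for S
    using inv_dir[OF f that] fibre_join_bot that Obs by simp
  then show "inj_on (dir F f) (clusters X)" by (metis inj_onI)
qed

text \<open>Every direct image lies below \<open>Im C F f\<close>, so surjectivity forces this to be
  the greatest cluster. When it is, (N1) makes the inverse image a section of the direct
  image.\<close>

lemma dir_surj_iff:
  assumes f: "f \<in> hom C X Y"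
  shows "dir F f ` clusters X = clusters Y \<longleftrightarrow> Im C F f = \<top>\<^bsub>fibre F Y\<^esub>"
proof
  note Obs = hom_Obj[OF f]
  assume "dir F f ` clusters X = clusters Y"
  then have "\<top>\<^bsub>fibre F Y\<^esub> \<in> dir F f ` clusters X" using fibre_bounds(2) Obs by simp
  then obtain S where "S \<in> clusters X" "dir F f S = \<top>\<^bsub>fibre F Y\<^esub>"
    by (elim imageE) simp
  then have "\<top>\<^bsub>fibre F Y\<^esub> \<sqsubseteq>\<^bsub>fibre F Y\<^esub> Im C F f" using dir_le_Im[OF f, of S] by simp
  then show "Im C F f = \<top>\<^bsub>fibre F Y\<^esub>"
    using fibre_top_le Im_closed[OF f] Obs by simp
next
  note Obs = hom_Obj[OF f]
  assume "Im C F f = \<top>\<^bsub>fibre F Y\<^esub>"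
  then have sec: "dir F f (inv_im F f T) = T" if "T \<in> clusters Y" for T
    using dir_inv[OF f that] fibre_meet(5)[OF _ that] fibre_bounds that Obs by simp
  show "dir F f ` clusters X = clusters Y"
  proof (intro subset_antisym subsetI)
    show "T \<in> dir F f ` clusters X" if "T \<in> clusters Y" for T
      using imageI[OF inv_closed[OF f that], of "dir F f"] sec[OF that] by simp
  qed (use dir_closed[OF f] in blast)
qed

section \<open>The functor of clusters\<close>

definition cluster_set :: "'o \<Rightarrow> 'u set" where
  "cluster_set X = clusters X"

text \<open>Clusters are already elements of \<open>'u\<close>, so a fibre serves as a set of the
  universe without encoding. The restriction makes the underlying function extensional, as equality
  of set maps demands.\<close>

definition cluster_map :: "'a \<Rightarrow> 'u set_map" where
  "cluster_map f = (clusters (Dom C f), restrict (dir F f) (clusters (Dom C f)), clusters (Cod C f))"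

lemma cluster_map_hom:
  assumes "f \<in> hom C X Y"
  shows "cluster_map f \<in> hom SET (clusters X) (clusters Y)"
proof -
  have "(clusters X, restrict (dir F f) (clusters X), clusters Y) \<in> hom SET (clusters X) (clusters Y)"
    by (intro SET_mapI fibre_small funcsetI dir_closed[OF assms] arrow[OF assms])
  then show ?thesis using arrow[OF assms] by (simp add: cluster_map_def)
qed

lemma fun_of_cluster_map:
  "\<lbrakk>f \<in> hom C X Y; S \<in> clusters X\<rbrakk> \<Longrightarrow> fun_of (cluster_map f) S = dir F f S"
  by (simp add: cluster_map_def hom_def)

lemma cluster_map_injective_iff:
  assumes "f \<in> hom C X Y"
  shows "injective_map (cluster_map f) \<longleftrightarrow> Ker C F f = \<bottom>\<^bsub>fibre F X\<^esub>"
  unfolding injective_map_iff[OF cluster_map_hom[OF assms]] dir_inj_iff[OF assms, symmetric]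
  by (rule inj_on_cong) (simp add: fun_of_cluster_map[OF assms])

lemma cluster_map_surjective_iff:
  assumes "f \<in> hom C X Y"
  shows "surjective_map (cluster_map f) \<longleftrightarrow> Im C F f = \<top>\<^bsub>fibre F Y\<^esub>"
  unfolding surjective_map_iff[OF cluster_map_hom[OF assms]] dir_surj_iff[OF assms, symmetric]
  by (simp add: fun_of_cluster_map[OF assms] cong: image_cong_simp)

lemma cluster_map_Comp:
  assumes f: "f \<in> hom C X Y" and g: "g \<in> hom C Y Z"
  shows "cluster_map (g \<cdot> f) = cluster_map g \<cdot>\<^bsub>SET\<^esub> cluster_map f"
proof (rule SET_eqI)
  note gf = Comp_in_hom[OF f g]
  show "cluster_map (g \<cdot> f) \<in> hom SET (clusters X) (clusters Z)"
    by (rule cluster_map_hom[OF gf])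
  show "cluster_map g \<cdot>\<^bsub>SET\<^esub> cluster_map f \<in> hom SET (clusters X) (clusters Z)"
    by (rule category.Comp_in_hom[OF category_SET cluster_map_hom[OF f] cluster_map_hom[OF g]])
  fix S assume S: "S \<in> clusters X"
  show "fun_of (cluster_map (g \<cdot> f)) S = fun_of (cluster_map g \<cdot>\<^bsub>SET\<^esub> cluster_map f) S"
    using fun_of_Comp[OF cluster_map_hom[OF f] cluster_map_hom[OF g] S] fun_of_cluster_map[OF gf S]
      fun_of_cluster_map[OF f S] fun_of_cluster_map[OF g dir_closed[OF f S]] dir_Comp[OF f g S]
    by simp
qed

lemma cluster_functor: "is_functor C SET cluster_set cluster_map"
  unfolding is_functor_def
proof (intro conjI ballI impI)
  show "cluster_set X \<in> Obj SET" if "X \<in> Obj C" for X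
    using fibre_small[OF that] Obj_SET unfolding cluster_set_def by blast
  show "cluster_map f \<in> hom SET (cluster_set (Dom C f)) (cluster_set (Cod C f))" if "f \<in> Arr C" for f
    unfolding cluster_set_def by (rule cluster_map_hom[OF homI[OF that]])
  show "cluster_map (Id C X) = Id SET (cluster_set X)" if X: "X \<in> Obj C" for X
  proof (rule SET_eqI)
    show "cluster_map (Id C X) \<in> hom SET (clusters X) (clusters X)"
      by (rule cluster_map_hom[OF Id_in_hom[OF X]])
    show "Id SET (cluster_set X) \<in> hom SET (clusters X) (clusters X)"
      unfolding cluster_set_def
      by (rule category.Id_in_hom[OF category_SET]) (simp add: Obj_SET fibre_small[OF X])
    show "fun_of (cluster_map (Id C X)) S = fun_of (Id SET (cluster_set X)) S" if "S \<in> clusters X" for S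
      using fun_of_cluster_map[OF Id_in_hom[OF X] that] dir_Id[OF X that] fun_of_Id[OF that]
      by (simp add: cluster_set_def)
  qed
  show "cluster_map (g \<cdot> f) = cluster_map g \<cdot>\<^bsub>SET\<^esub> cluster_map f"
    if "f \<in> Arr C" "g \<in> Arr C" "Cod C f = Dom C g" for f g
    using cluster_map_Comp[of f "Dom C f" "Cod C f" g "Cod C g"] that by (simp add: hom_def)
qed

text \<open>A bijective direct image means a trivial kernel and a full image. Both factors in (N2)
  are then invertible: \<open>e\<close> is split monic and epic, \<open>m\<close> is split epic and
  monic.\<close>

lemma cluster_conservative: "conservative C SET cluster_map"
  unfolding conservative_def
proof (intro ballI impI)
  fix f assume "f \<in> Arr C" and iso: "isomorphism SET (cluster_map f)"
  from \<open>f \<in> Arr C\<close> obtain X Y where f: "f \<in> hom C X Y" by (rule homI[THEN that])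
  note Obs = hom_Obj[OF f]
  have bij: "bij_betw (fun_of (cluster_map f)) (clusters X) (clusters Y)"
    by (rule SET_isomorphism_bij[OF cluster_map_hom[OF f] iso])
  have K: "Ker C F f = \<bottom>\<^bsub>fibre F X\<^esub>"
    using bij cluster_map_injective_iff[OF f] injective_map_iff[OF cluster_map_hom[OF f]]
    by (simp add: bij_betw_def)
  have I: "Im C F f = \<top>\<^bsub>fibre F Y\<^esub>"
    using bij cluster_map_surjective_iff[OF f] surjective_map_iff[OF cluster_map_hom[OF f]]
    by (simp add: bij_betw_def)
  obtain e m J where e: "is_quotient C F X (Ker C F f) e" and m: "is_embedding C F Y (Im C F f) m"
    and em: "e \<in> hom C X J" "m \<in> hom C J Y" "f = m \<cdot> e"
    using factorization[OF f] by metis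
  \<comment> \<open>Through a quotient of the least cluster every morphism out of \<open>X\<close>
    factors, in particular the identity; dually for an embedding of the greatest cluster.\<close>
  have idX: "Id C X \<in> hom C X X" and idY: "Id C Y \<in> hom C Y Y" using Id_in_hom Obs by blast+
  obtain k where k: "k \<in> hom C J X" "Id C X = k \<cdot> e"
    using quotient_factor(1)[OF e em(1) idX] K Ker_Id fibre_refl fibre_bounds(1) Obs by auto
  obtain l where l: "l \<in> hom C Y J" "Id C Y = m \<cdot> l"
    using embedding_factor(1)[OF m em(2) idY] I Im_Id fibre_refl fibre_bounds(2) Obs by auto
  have J: "J \<in> Obj C" using hom_Obj em by blast
  have "(e \<cdot> k) \<cdot> e = Id C J \<cdot> e"
    using Comp_assoc[OF em(1) k(1) em(1)] k Comp_Id[OF em(1)] Id_Comp[OF em(1)] by simp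
  then have ek: "e \<cdot> k = Id C J"
    using quotient_epic[OF e em(1) Comp_in_hom[OF k(1) em(1)] Id_in_hom[OF J]] by blast
  have "m \<cdot> (l \<cdot> m) = m \<cdot> Id C J"
    using Comp_assoc[OF em(2) l(1) em(2)] l Comp_Id[OF em(2)] Id_Comp[OF em(2)] by simp
  then have lm: "l \<cdot> m = Id C J"
    using embedding_monic[OF m em(2) Comp_in_hom[OF em(2) l(1)] Id_in_hom[OF J]] by blast
  have kl: "k \<cdot> l \<in> hom C Y X" using Comp_in_hom k l by blast
  have "(k \<cdot> l) \<cdot> f = k \<cdot> ((l \<cdot> m) \<cdot> e)"
    using Comp_assoc[OF f l(1) k(1)] Comp_assoc[OF em(1,2) l(1)] em(3) by simp
  then have 1: "(k \<cdot> l) \<cdot> f = Id C X" using lm k Id_Comp[OF em(1)] by simp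
  have "f \<cdot> (k \<cdot> l) = m \<cdot> ((e \<cdot> k) \<cdot> l)"
    using Comp_assoc[OF kl em(1,2)] Comp_assoc[OF l(1) k(1) em(1)] em(3) by simp
  then have 2: "f \<cdot> (k \<cdot> l) = Id C Y" using ek l Id_Comp[OF l(1)] by simp
  show "isomorphism C f" by (rule isomorphismI[OF f kl 1 2])
qed

section \<open>Pushouts of quotients and pullbacks of embeddings under the cluster functor\<close>

text \<open>By (N3) there is a quotient \<open>k\<close> of \<open>K \<squnion> L\<close>; it
  factors through \<open>d\<close> and through \<open>e\<close>, hence through the pushout by some
  \<open>h\<close>. The kernel of \<open>p \<cdot> d\<close> therefore lies below
  \<open>K \<squnion> L\<close>, and it lies above since \<open>p \<cdot> d = q \<cdot> e\<close>.
  Conversely \<open>p \<cdot> d\<close> factors through \<open>k\<close> by some \<open>s\<close>,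
  which is split epic with section \<open>h\<close>; this makes the image full.\<close>

lemma pushout_quotients:
  assumes po: "is_pushout C d e p q"
    and d: "is_quotient C F X K d" "d \<in> hom C X A" and e: "is_quotient C F X L e" "e \<in> hom C X B"
    and p: "p \<in> hom C A P" and q: "q \<in> hom C B P"
  shows "Ker C F (p \<cdot> d) = K \<squnion>\<^bsub>fibre F X\<^esub> L" and "Im C F (p \<cdot> d) = \<top>\<^bsub>fibre F P\<^esub>"
proof -
  note Obs = hom_Obj[OF d(2)] hom_Obj[OF p]
  from po d(2) e(2) obtain P' where p': "p \<in> hom C A P'" and "q \<in> hom C B P'"
    and pq: "p \<cdot> d = q \<cdot> e"
    and ex: "\<And>Z u v. \<lbrakk>u \<in> hom C A Z; v \<in> hom C B Z; u \<cdot> d = v \<cdot> e\<rbrakk> \<Longrightarrow>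
       \<exists>h \<in> hom C P' Z. h \<cdot> p = u \<and> h \<cdot> q = v"
    and uq: "\<And>Z h k. \<lbrakk>h \<in> hom C P' Z; k \<in> hom C P' Z; h \<cdot> p = k \<cdot> p; h \<cdot> q = k \<cdot> q\<rbrakk> \<Longrightarrow> h = k"
    by (rule pushoutE) blast
  \<comment> \<open>The eliminator introduces an apex of its own, which is the codomain of
    \<open>p\<close>.\<close>
  have "P' = P" using p p' by (simp add: hom_def)
  note ex = ex[unfolded this] and uq = uq[unfolded this]
  let ?r = "p \<cdot> d"
  have r: "?r \<in> hom C X P" using Comp_in_hom d p by blast
  have K: "Ker C F d = K" "K \<in> clusters X" and L: "Ker C F e = L" "L \<in> clusters X"
    using d e Ker_closed by (auto simp: is_quotient_def)
  have "normal C F X (K \<squnion>\<^bsub>fibre F X\<^esub> L)"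
    using noetherian d e Obs unfolding noetherian_form_def is_quotient_def by blast
  then obtain g where "g \<in> Arr C" "Dom C g = X" and gK: "Ker C F g = K \<squnion>\<^bsub>fibre F X\<^esub> L"
    unfolding normal_def by blast
  then have g: "g \<in> hom C X (Cod C g)" by (simp add: hom_def)
  obtain k m I where k: "is_quotient C F X (K \<squnion>\<^bsub>fibre F X\<^esub> L) k" "k \<in> hom C X I"
    by (rule factorization[OF g]) (use gK in auto)
  have kK: "Ker C F k = K \<squnion>\<^bsub>fibre F X\<^esub> L" using k by (simp add: is_quotient_def)
  obtain u where u: "u \<in> hom C A I" "k = u \<cdot> d"
    using quotient_factor(1)[OF d k(2)] fibre_join(2)[OF _ K(2) L(2)] kK Obs by auto
  obtain v where v: "v \<in> hom C B I" "k = v \<cdot> e"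
    using quotient_factor(1)[OF e k(2)] fibre_join(3)[OF _ K(2) L(2)] kK Obs by auto
  obtain h where h: "h \<in> hom C P I" "h \<cdot> p = u" "h \<cdot> q = v"
    using ex[OF u(1) v(1)] trans[OF u(2)[symmetric] v(2)] by blast
  have hr: "h \<cdot> ?r = k" using Comp_assoc[OF d(2) p h(1)] h(2) u(2) by simp
  show KJ: "Ker C F ?r = K \<squnion>\<^bsub>fibre F X\<^esub> L"
  proof (rule fibre_antisym[where X = X])
    show "Ker C F ?r \<sqsubseteq>\<^bsub>fibre F X\<^esub> K \<squnion>\<^bsub>fibre F X\<^esub> L"
      using Ker_Comp(2)[OF r h(1)] hr kK by simp
    show "K \<squnion>\<^bsub>fibre F X\<^esub> L \<sqsubseteq>\<^bsub>fibre F X\<^esub> Ker C F ?r"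
      using fibre_join(4)[OF _ K(2) L(2) Ker_closed[OF r]] Ker_Comp(2)[OF d(2) p]
        Ker_Comp(2)[OF e(2) q] pq K L Obs by simp
  qed (simp_all add: Obs Ker_closed[OF r] fibre_join(1)[OF _ K(2) L(2)])
  obtain s where s: "s \<in> hom C I P" "?r = s \<cdot> k"
    using quotient_factor(1)[OF k r] fibre_refl[OF _ Ker_closed[OF r]] Obs unfolding KJ by auto
  have sh: "s \<cdot> h \<in> hom C P P" using Comp_in_hom h s by blast
  have I: "Id C P \<in> hom C P P" using Id_in_hom Obs by blast
  have "s \<cdot> h = Id C P"
  proof (rule uq[OF sh I])
    have "((s \<cdot> h) \<cdot> p) \<cdot> d = p \<cdot> d"
      using Comp_assoc[OF d(2) p sh] Comp_assoc[OF r h(1) s(1)] hr s(2)[symmetric] by simp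
    then show "(s \<cdot> h) \<cdot> p = Id C P \<cdot> p"
      using quotient_epic[OF d Comp_in_hom[OF p sh] p] Id_Comp[OF p] by simp
    have "((s \<cdot> h) \<cdot> q) \<cdot> e = q \<cdot> e"
      using Comp_assoc[OF e(2) q sh] Comp_assoc[OF r h(1) s(1)] hr s(2)[symmetric] pq[symmetric] by simp
    then show "(s \<cdot> h) \<cdot> q = Id C P \<cdot> q"
      using quotient_epic[OF e Comp_in_hom[OF q sh] q] Id_Comp[OF q] by simp
  qed
  then have "Im C F s = \<top>\<^bsub>fibre F P\<^esub>" by (rule split_epi_Im[OF s(1) h(1)])
  then show "Im C F ?r = \<top>\<^bsub>fibre F P\<^esub>"
    using Im_Comp(1)[OF k(2) s(1)] quotient_Im[OF k] Im_eq[OF s(1)] s(2) by simp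
qed

text \<open>The dual comparison, with an embedding of \<open>S \<sqinter> T\<close> obtained from
  (N3). The comparison \<open>s\<close> from the pullback to its domain is split monic, so the
  composite into \<open>X\<close> has trivial kernel.\<close>

lemma pullback_embeddings:
  assumes pb: "is_pullback C m n p q"
    and m: "is_embedding C F X S m" "m \<in> hom C A X" and n: "is_embedding C F X T n" "n \<in> hom C B X"
    and p: "p \<in> hom C P A" and q: "q \<in> hom C P B"
  shows "Im C F (m \<cdot> p) = S \<sqinter>\<^bsub>fibre F X\<^esub> T" and "Ker C F (m \<cdot> p) = \<bottom>\<^bsub>fibre F P\<^esub>"
proof -
  note Obs = hom_Obj[OF m(2)] hom_Obj[OF p]
  from pb m(2) n(2) obtain P' where p': "p \<in> hom C P' A" and "q \<in> hom C P' B"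
    and pq: "m \<cdot> p = n \<cdot> q"
    and ex: "\<And>W u v. \<lbrakk>u \<in> hom C W A; v \<in> hom C W B; m \<cdot> u = n \<cdot> v\<rbrakk> \<Longrightarrow>
       \<exists>h \<in> hom C W P'. p \<cdot> h = u \<and> q \<cdot> h = v"
    and uq: "\<And>W h k. \<lbrakk>h \<in> hom C W P'; k \<in> hom C W P'; p \<cdot> h = p \<cdot> k; q \<cdot> h = q \<cdot> k\<rbrakk> \<Longrightarrow> h = k"
    by (rule pullbackE) blast
  have "P' = P" using p p' by (simp add: hom_def)
  note ex = ex[unfolded this] and uq = uq[unfolded this]
  let ?r = "m \<cdot> p"
  have r: "?r \<in> hom C P X" using Comp_in_hom m p by blast
  have S: "Im C F m = S" "S \<in> clusters X" and T: "Im C F n = T" "T \<in> clusters X"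
    using m n Im_closed by (auto simp: is_embedding_def)
  have "conormal C F X (S \<sqinter>\<^bsub>fibre F X\<^esub> T)"
    using noetherian m n Obs unfolding noetherian_form_def is_embedding_def by blast
  then obtain g where "g \<in> Arr C" "Cod C g = X" and gS: "Im C F g = S \<sqinter>\<^bsub>fibre F X\<^esub> T"
    unfolding conormal_def by blast
  then have g: "g \<in> hom C (Dom C g) X" by (simp add: hom_def)
  obtain k I where k: "is_embedding C F X (S \<sqinter>\<^bsub>fibre F X\<^esub> T) k" "k \<in> hom C I X"
    by (rule factorization[OF g]) (use gS in auto)
  have kS: "Im C F k = S \<sqinter>\<^bsub>fibre F X\<^esub> T" using k by (simp add: is_embedding_def)
  obtain u where u: "u \<in> hom C I A" "k = m \<cdot> u"
    using embedding_factor(1)[OF m k(2)] fibre_meet(2)[OF _ S(2) T(2)] kS Obs by auto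
  obtain v where v: "v \<in> hom C I B" "k = n \<cdot> v"
    using embedding_factor(1)[OF n k(2)] fibre_meet(3)[OF _ S(2) T(2)] kS Obs by auto
  obtain h where h: "h \<in> hom C I P" "p \<cdot> h = u" "q \<cdot> h = v"
    using ex[OF u(1) v(1)] trans[OF u(2)[symmetric] v(2)] by blast
  have rh: "?r \<cdot> h = k" using Comp_assoc[OF h(1) p m(2)] h(2) u(2) by simp
  show SJ: "Im C F ?r = S \<sqinter>\<^bsub>fibre F X\<^esub> T"
  proof (rule fibre_antisym[where X = X])
    show "S \<sqinter>\<^bsub>fibre F X\<^esub> T \<sqsubseteq>\<^bsub>fibre F X\<^esub> Im C F ?r"
      using Im_Comp(2)[OF h(1) r] rh kS by simp
    show "Im C F ?r \<sqsubseteq>\<^bsub>fibre F X\<^esub> S \<sqinter>\<^bsub>fibre F X\<^esub> T"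
      using fibre_meet(4)[OF _ S(2) T(2) Im_closed[OF r]] Im_Comp(2)[OF p m(2)]
        Im_Comp(2)[OF q n(2)] pq S T Obs by simp
  qed (simp_all add: Obs Im_closed[OF r] fibre_meet(1)[OF _ S(2) T(2)])
  obtain s where s: "s \<in> hom C P I" "?r = k \<cdot> s"
    using embedding_factor(1)[OF k r] fibre_refl[OF _ Im_closed[OF r]] Obs unfolding SJ by auto
  have hs: "h \<cdot> s \<in> hom C P P" using Comp_in_hom h s by blast
  have I: "Id C P \<in> hom C P P" using Id_in_hom Obs by blast
  have "h \<cdot> s = Id C P"
  proof (rule uq[OF hs I])
    have "m \<cdot> (p \<cdot> (h \<cdot> s)) = m \<cdot> p"
      using Comp_assoc[OF hs p m(2)] Comp_assoc[OF s(1) h(1) r] rh s(2)[symmetric] by simp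
    then show "p \<cdot> (h \<cdot> s) = p \<cdot> Id C P"
      using embedding_monic[OF m Comp_in_hom[OF hs p] p] Comp_Id[OF p] by simp
    have "n \<cdot> (q \<cdot> (h \<cdot> s)) = n \<cdot> q"
      using Comp_assoc[OF hs q n(2)] Comp_assoc[OF s(1) h(1) r] rh s(2)[symmetric] pq[symmetric] by simp
    then show "q \<cdot> (h \<cdot> s) = q \<cdot> Id C P"
      using embedding_monic[OF n Comp_in_hom[OF hs q] q] Comp_Id[OF q] by simp
  qed
  then have "Ker C F s = \<bottom>\<^bsub>fibre F P\<^esub>" by (rule split_mono_Ker[OF s(1) h(1)])
  then show "Ker C F ?r = \<bottom>\<^bsub>fibre F P\<^esub>"
    using Ker_Comp(1)[OF s(1) k(2)] embedding_Ker[OF k] Ker_eq[OF s(1)] s(2) by simp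
qed

text \<open>The composite into the pushout has kernel \<open>K \<squnion> L\<close>, so it
  identifies two clusters only when their joins with \<open>K \<squnion> L\<close> agree. Each
  cluster is linked to that join by the identifications that \<open>d\<close> and \<open>e\<close>
  make, so these generate the whole kernel relation.\<close>

lemma cluster_preserves_pushouts:
  "preserves_pushouts_of C SET cluster_map (quotients C F)"
  unfolding preserves_pushouts_of_def
proof (intro ballI allI impI)
  fix d e p q
  assume "d \<in> quotients C F" "e \<in> quotients C F" and po: "is_pushout C d e p q"
  then obtain X K L where q: "is_quotient C F X K d" "is_quotient C F X L e"
    unfolding quotients_def is_pushout_def is_quotient_def by auto
  then have d: "d \<in> hom C X (Cod C d)" and e: "e \<in> hom C X (Cod C e)"
    by (auto simp: is_quotient_def hom_def)
  obtain P where p: "p \<in> hom C (Cod C d) P" and q': "q \<in> hom C (Cod C e) P" and pq: "p \<cdot> d = q \<cdot> e"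
    using pushoutE[OF po d e] by metis
  note Obs = hom_Obj[OF d] hom_Obj[OF p]
  have r: "p \<cdot> d \<in> hom C X P" using Comp_in_hom d p by blast
  have K: "Ker C F d = K" "K \<in> clusters X" and L: "Ker C F e = L" "L \<in> clusters X"
    using q Ker_closed d e by (auto simp: is_quotient_def)
  note kr = pushout_quotients(1)[OF po q(1) d q(2) e p q']
    and ir = pushout_quotients(2)[OF po q(1) d q(2) e p q']
  show "is_pushout SET (cluster_map d) (cluster_map e) (cluster_map p) (cluster_map q)"
  proof (rule SET_pushoutI[OF cluster_map_hom[OF d] cluster_map_hom[OF e] cluster_map_hom[OF p]
        cluster_map_hom[OF q']])
    show "cluster_map p \<cdot>\<^bsub>SET\<^esub> cluster_map d = cluster_map q \<cdot>\<^bsub>SET\<^esub> cluster_map e"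
      using cluster_map_Comp[OF d p] cluster_map_Comp[OF e q'] pq by simp
    show "surjective_map (cluster_map d)" "surjective_map (cluster_map e)"
      using cluster_map_surjective_iff quotient_Im q d e by blast+
    have "\<top>\<^bsub>fibre F P\<^esub> \<sqsubseteq>\<^bsub>fibre F P\<^esub> Im C F p" using Im_Comp(2)[OF d p] ir by simp
    then have "Im C F p = \<top>\<^bsub>fibre F P\<^esub>"
      using fibre_top_le Im_closed[OF p] Obs by simp
    then show "surjective_map (cluster_map p)" using cluster_map_surjective_iff[OF p] by blast
    fix t :: "'u \<Rightarrow> 'u" and S T
    assume td: "\<And>S T. \<lbrakk>S \<in> clusters X; T \<in> clusters X;
        fun_of (cluster_map d) S = fun_of (cluster_map d) T\<rbrakk> \<Longrightarrow> t S = t T"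
      and te: "\<And>S T. \<lbrakk>S \<in> clusters X; T \<in> clusters X;
        fun_of (cluster_map e) S = fun_of (cluster_map e) T\<rbrakk> \<Longrightarrow> t S = t T"
      and ST: "S \<in> clusters X" "T \<in> clusters X"
        "fun_of (cluster_map p) (fun_of (cluster_map d) S) =
          fun_of (cluster_map p) (fun_of (cluster_map d) T)"
    \<comment> \<open>Two links suffice: \<open>d\<close> identifies \<open>S\<close> with
      \<open>S \<squnion> K\<close>, and \<open>e\<close> identifies the latter with
      \<open>(S \<squnion> K) \<squnion> L\<close>, both by \<open>dir_inv_dir\<close>.\<close>
    have t: "t (S \<squnion>\<^bsub>fibre F X\<^esub> (K \<squnion>\<^bsub>fibre F X\<^esub> L)) = t S" if S: "S \<in> clusters X" for S
    proof -
      have SK: "S \<squnion>\<^bsub>fibre F X\<^esub> K \<in> clusters X" using fibre_join S K Obs by blast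
      have SKL: "(S \<squnion>\<^bsub>fibre F X\<^esub> K) \<squnion>\<^bsub>fibre F X\<^esub> L \<in> clusters X" using fibre_join SK L Obs by blast
      have "t ((S \<squnion>\<^bsub>fibre F X\<^esub> K) \<squnion>\<^bsub>fibre F X\<^esub> L) = t (S \<squnion>\<^bsub>fibre F X\<^esub> K)"
        by (rule te[OF SKL SK])
          (use dir_inv_dir[OF e SK] fun_of_cluster_map[OF e SK] fun_of_cluster_map[OF e SKL] L in simp)
      also have "\<dots> = t S"
        by (rule td[OF SK S])
          (use dir_inv_dir[OF d S] fun_of_cluster_map[OF d SK] fun_of_cluster_map[OF d S] K in simp)
      finally show ?thesis using fibre_join_assoc S K L Obs by simp
    qed
    have "dir F (p \<cdot> d) S = dir F (p \<cdot> d) T"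
      using ST fun_of_cluster_map[OF d] fun_of_cluster_map[OF p] dir_closed[OF d] dir_Comp[OF d p]
      by simp
    \<comment> \<open>Taking inverse images of the equal direct images gives the joins with the
      kernel, by (N1).\<close>
    then have "S \<squnion>\<^bsub>fibre F X\<^esub> (K \<squnion>\<^bsub>fibre F X\<^esub> L) = T \<squnion>\<^bsub>fibre F X\<^esub> (K \<squnion>\<^bsub>fibre F X\<^esub> L)"
      using inv_dir[OF r] kr ST by metis
    then show "t S = t T" using t ST by metis
  qed
qed

text \<open>A cluster that is a direct image along both \<open>m\<close> and \<open>n\<close> lies
  below \<open>S \<sqinter> T\<close>, the image of the composite \<open>m \<cdot> p\<close>. By
  (N1) everything below an image is the direct image of its own inverse image.\<close>

lemma cluster_preserves_pullbacks:
  "preserves_pullbacks_of C SET cluster_map (embeddings C F)"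
  unfolding preserves_pullbacks_of_def
proof (intro ballI allI impI)
  fix m n p q
  assume "m \<in> embeddings C F" "n \<in> embeddings C F" and pb: "is_pullback C m n p q"
  then obtain X S T where em: "is_embedding C F X S m" "is_embedding C F X T n"
    unfolding embeddings_def is_pullback_def is_embedding_def by auto
  then have m: "m \<in> hom C (Dom C m) X" and n: "n \<in> hom C (Dom C n) X"
    by (auto simp: is_embedding_def hom_def)
  obtain P where p: "p \<in> hom C P (Dom C m)" and q: "q \<in> hom C P (Dom C n)" and pq: "m \<cdot> p = n \<cdot> q"
    using pullbackE[OF pb m n] by metis
  note Obs = hom_Obj[OF m] hom_Obj[OF p]
  have r: "m \<cdot> p \<in> hom C P X" using Comp_in_hom m p by blast
  have S: "Im C F m = S" "S \<in> clusters X" and T: "Im C F n = T" "T \<in> clusters X"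
    using em Im_closed m n by (auto simp: is_embedding_def)
  note ir = pullback_embeddings(1)[OF pb em(1) m em(2) n p q]
    and kr = pullback_embeddings(2)[OF pb em(1) m em(2) n p q]
  show "is_pullback SET (cluster_map m) (cluster_map n) (cluster_map p) (cluster_map q)"
  proof (rule SET_pullbackI[OF cluster_map_hom[OF m] cluster_map_hom[OF n] cluster_map_hom[OF p]
        cluster_map_hom[OF q]])
    show "cluster_map m \<cdot>\<^bsub>SET\<^esub> cluster_map p = cluster_map n \<cdot>\<^bsub>SET\<^esub> cluster_map q"
      using cluster_map_Comp[OF p m] cluster_map_Comp[OF q n] pq by simp
    show "injective_map (cluster_map m)" "injective_map (cluster_map n)"
      using cluster_map_injective_iff embedding_Ker em m n by blast+
    have "Ker C F p \<sqsubseteq>\<^bsub>fibre F P\<^esub> \<bottom>\<^bsub>fibre F P\<^esub>" using Ker_Comp(2)[OF p m] kr by simp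
    then have "Ker C F p = \<bottom>\<^bsub>fibre F P\<^esub>"
      using fibre_le_bottom Ker_closed[OF p] Obs by simp
    then show "injective_map (cluster_map p)" using cluster_map_injective_iff[OF p] by blast
    show "fun_of (cluster_map m) ` clusters (Dom C m) \<inter> fun_of (cluster_map n) ` clusters (Dom C n)
      \<subseteq> (\<lambda>S. fun_of (cluster_map m) (fun_of (cluster_map p) S)) ` clusters P"
    proof
      fix U
      assume "U \<in> fun_of (cluster_map m) ` clusters (Dom C m) \<inter>
        fun_of (cluster_map n) ` clusters (Dom C n)"
      then obtain V W where V: "V \<in> clusters (Dom C m)" "U = dir F m V"
        and W: "W \<in> clusters (Dom C n)" "U = dir F n W"
        using fun_of_cluster_map[OF m] fun_of_cluster_map[OF n] by auto
      have U: "U \<in> clusters X" using dir_closed[OF m] V by simp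
      have "U \<sqsubseteq>\<^bsub>fibre F X\<^esub> S \<sqinter>\<^bsub>fibre F X\<^esub> T"
        using fibre_meet(4)[OF _ S(2) T(2) U] dir_le_Im[OF m V(1)] dir_le_Im[OF n W(1)] V W S T Obs
        by simp
      then have "dir F (m \<cdot> p) (inv_im F (m \<cdot> p) U) = U"
        using dir_inv[OF r U] ir fibre_meet(5)[OF _ U] fibre_meet(1)[OF _ S(2) T(2)] Obs by simp
      moreover have iU: "inv_im F (m \<cdot> p) U \<in> clusters P" using inv_closed[OF r U] .
      ultimately have "U = fun_of (cluster_map m) (fun_of (cluster_map p) (inv_im F (m \<cdot> p) U))"
        using fun_of_cluster_map[OF p iU] fun_of_cluster_map[OF m dir_closed[OF p iU]]
          dir_Comp[OF p m iU] by simp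
      then show "U \<in> (\<lambda>S. fun_of (cluster_map m) (fun_of (cluster_map p) S)) ` clusters P"
        using iU by blast
    qed
  qed
qed

lemma cluster_quotient_surjective: "e \<in> quotients C F \<Longrightarrow> surjective_map (cluster_map e)"
proof -
  assume "e \<in> quotients C F"
  then obtain X K where q: "is_quotient C F X K e" by (auto simp: quotients_def)
  then have e: "e \<in> hom C X (Cod C e)" by (simp add: is_quotient_def hom_def)
  show ?thesis using cluster_map_surjective_iff[OF e] quotient_Im[OF q e] by blast
qed

lemma cluster_embedding_injective: "m \<in> embeddings C F \<Longrightarrow> injective_map (cluster_map m)"
proof -
  assume "m \<in> embeddings C F"
  then obtain X S where i: "is_embedding C F X S m" by (auto simp: embeddings_def)
  then have m: "m \<in> hom C (Dom C m) X" by (simp add: is_embedding_def hom_def)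
  show ?thesis using cluster_map_injective_iff[OF m] embedding_Ker[OF i m] by blast
qed

end

section \<open>The form of pointed equivalence relations\<close>

lemma trancl_least: "\<lbrakk>S \<subseteq> Q; trans Q\<rbrakk> \<Longrightarrow> S\<^sup>+ \<subseteq> Q"
  using trancl_mono_subset[of S Q] trancl_id[of Q] by simp

lemma equiv_trancl: "\<lbrakk>S \<subseteq> A \<times> A; Id_on A \<subseteq> S; sym S\<rbrakk> \<Longrightarrow> equiv A (S\<^sup>+)"
proof (rule equivI)
  assume S: "S \<subseteq> A \<times> A" "Id_on A \<subseteq> S" "sym S"
  show "S\<^sup>+ \<subseteq> A \<times> A" using S trancl_subset_Sigma by blast
  show "refl_on A (S\<^sup>+)" using S by (auto simp: refl_on_def)
  show "sym (S\<^sup>+)" using S sym_trancl by blast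
qed (rule trans_trancl)

lemma equiv_Id_on: "equiv A R \<Longrightarrow> Id_on A \<subseteq> R"
  by (auto simp: equiv_def refl_on_def)

lemma equiv_join:
  assumes "equiv A R" "equiv A S"
  shows "equiv A ((R \<union> S)\<^sup>+)"
proof (rule equiv_trancl)
  show "sym (R \<union> S)" using assms by (auto simp: equiv_def intro: sym_Un)
qed (use assms equiv_Id_on in \<open>auto simp: equiv_def\<close>)

lemma equiv_meet: "\<lbrakk>equiv A R; equiv A S\<rbrakk> \<Longrightarrow> equiv A (R \<inter> S)"
  by (auto simp: equiv_def refl_on_def intro: sym_Int trans_Int)

definition pull :: "'a set \<Rightarrow> ('a \<Rightarrow> 'b) \<Rightarrow> 'b rel \<Rightarrow> 'a rel" where
  "pull A g Q = {(x, y) \<in> A \<times> A. (g x, g y) \<in> Q}"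

text \<open>This is the equivalence relation on \<open>B\<close> generated by the image of
  \<open>R\<close>: the diagonal supplies reflexivity off the image of \<open>g\<close>, and
  symmetry is inherited from \<open>R\<close>.\<close>

definition push :: "'b set \<Rightarrow> ('a \<Rightarrow> 'b) \<Rightarrow> 'a rel \<Rightarrow> 'b rel" where
  "push B g R = (Id_on B \<union> map_prod g g ` R)\<^sup>+"

lemma equiv_pull: "\<lbrakk>g \<in> A \<rightarrow> B; equiv B Q\<rbrakk> \<Longrightarrow> equiv A (pull A g Q)"
proof (rule equivI)
  assume g: "g \<in> A \<rightarrow> B" and Q: "equiv B Q"
  then have Q: "refl_on B Q" "sym Q" "trans Q" by (auto simp: equiv_def)
  show "refl_on A (pull A g Q)" using g Q(1) by (auto simp: refl_on_def pull_def)
  show "sym (pull A g Q)" by (rule symI) (use Q(2) in \<open>auto simp: pull_def dest: symD\<close>)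
  show "trans (pull A g Q)" by (rule transI) (use Q(3) in \<open>auto simp: pull_def dest: transD\<close>)
qed (auto simp: pull_def)

lemma equiv_push:
  assumes g: "g \<in> A \<rightarrow> B" and R: "equiv A R"
  shows "equiv B (push B g R)"
  unfolding push_def
proof (rule equiv_trancl)
  have R': "R \<subseteq> A \<times> A" "sym R" using R by (auto simp: equiv_def)
  show "Id_on B \<union> map_prod g g ` R \<subseteq> B \<times> B" using R'(1) g by auto
  show "sym (Id_on B \<union> map_prod g g ` R)"
  proof (rule symI)
    fix a b assume "(a, b) \<in> Id_on B \<union> map_prod g g ` R"
    then consider "a = b" "a \<in> B" | x y where "(x, y) \<in> R" "a = g x" "b = g y" by auto
    then show "(b, a) \<in> Id_on B \<union> map_prod g g ` R"
    proof cases
      case 2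
      have "map_prod g g (y, x) \<in> map_prod g g ` R" by (rule imageI[OF symD[OF R'(2) 2(1)]])
      then show ?thesis using 2 by simp
    qed auto
  qed
qed auto

text \<open>An equivalence relation contains the generated one as soon as it contains the
  generators. This is the adjunction between direct and inverse images.\<close>

lemma push_le_iff:
  assumes g: "g \<in> A \<rightarrow> B" and R: "R \<subseteq> A \<times> A" and Q: "equiv B Q"
  shows "push B g R \<subseteq> Q \<longleftrightarrow> R \<subseteq> pull A g Q"
proof
  assume *: "push B g R \<subseteq> Q"
  show "R \<subseteq> pull A g Q"
  proof clarify
    fix x y assume xy: "(x, y) \<in> R"
    then have "map_prod g g (x, y) \<in> push B g R"
      unfolding push_def by (intro r_into_trancl' UnI2 imageI)
    then show "(x, y) \<in> pull A g Q" using * xy R by (auto simp: pull_def)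
  qed
next
  assume *: "R \<subseteq> pull A g Q"
  have "trans Q" using Q by (simp add: equiv_def)
  moreover have "Id_on B \<union> map_prod g g ` R \<subseteq> Q"
    using * equiv_Id_on[OF Q] by (auto simp: pull_def)
  ultimately show "push B g R \<subseteq> Q" unfolding push_def by (intro trancl_least)
qed

text \<open>An element of an order is determined by its upper bounds; it is enough to compare them
  at \<open>S\<close> and at the direct image itself.\<close>

lemma push_eqI:
  assumes g: "g \<in> A \<rightarrow> B" and R: "equiv A R" and S: "equiv B S"
    and le: "\<And>Q. equiv B Q \<Longrightarrow> S \<subseteq> Q \<longleftrightarrow> R \<subseteq> pull A g Q"
  shows "push B g R = S"
proof -
  have "R \<subseteq> A \<times> A" using R by (simp add: equiv_def)
  note iff = push_le_iff[OF g this]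
  show ?thesis
    using iff[OF S] iff[OF equiv_push[OF g R]] le[OF S] le[OF equiv_push[OF g R]] by simp
qed

lemma push_Comp:
  assumes f: "f \<in> A \<rightarrow> B" and g: "g \<in> B \<rightarrow> D" and R: "equiv A R"
    and h: "\<And>x. x \<in> A \<Longrightarrow> h x = g (f x)"
  shows "push D h R = push D g (push B f R)"
proof (rule push_eqI[of _ A])
  show "h \<in> A \<rightarrow> D" using f g h by auto
  note pR = equiv_push[OF f R]
  show "equiv D (push D g (push B f R))" by (rule equiv_push[OF g pR])
  fix Q assume Q: "equiv D Q"
  have "pull A h Q = pull A f (pull B g Q)" using f h by (auto simp: pull_def)
  then show "push D g (push B f R) \<subseteq> Q \<longleftrightarrow> R \<subseteq> pull A h Q"
    using push_le_iff[OF g _ Q] push_le_iff[OF f _ equiv_pull[OF g Q]] R pR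
    by (simp add: equiv_def)
qed fact

lemma pull_Comp:
  assumes f: "f \<in> A \<rightarrow> B" and h: "\<And>x. x \<in> A \<Longrightarrow> h x = g (f x)"
  shows "pull A h Q = pull A f (pull B g Q)"
  using assms by (auto simp: pull_def)

text \<open>This is the first half of (N1), with \<open>pull A g (Id_on B)\<close> in the role of
  the kernel. The join is contained in the left side by the adjunction; the other inclusion needs an
  analysis of generating chains.\<close>

lemma pull_push:
  assumes g: "g \<in> A \<rightarrow> B" and R: "equiv A R"
  shows "pull A g (push B g R) = (R \<union> pull A g (Id_on B))\<^sup>+" (is "_ = ?J")
proof
  have RA: "R \<subseteq> A \<times> A" using R by (simp add: equiv_def)
  have J: "R \<subseteq> ?J" "pull A g (Id_on B) \<subseteq> ?J" "trans ?J" by auto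
  have ker: "(x, y) \<in> ?J" if "x \<in> A" "y \<in> A" "g x = g y" for x y
  proof -
    have "(x, y) \<in> pull A g (Id_on B)" using that g by (auto simp: pull_def)
    then show ?thesis using J(2) by blast
  qed
  have P: "equiv B (push B g R)" by (rule equiv_push[OF g R])
  show "?J \<subseteq> pull A g (push B g R)"
  proof (rule trancl_least)
    show "R \<union> pull A g (Id_on B) \<subseteq> pull A g (push B g R)"
      using push_le_iff[OF g RA P] equiv_Id_on[OF P] by (auto simp: pull_def)
    show "trans (pull A g (push B g R))" using equiv_pull[OF g P] by (simp add: equiv_def)
  qed
  \<comment> \<open>A nontrivial step of a generating chain stays in the image of \<open>g\<close>, so the chain lifts
    to \<open>A\<close> up to the kernel of \<open>g\<close>.\<close>
  have chain: "c \<in> g ` A \<and> (\<forall>y\<in>A. g y = c \<longrightarrow> (x, y) \<in> ?J)"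
    if "(b, c) \<in> push B g R" "x \<in> A" "g x = b" for b c x
    using that(1) unfolding push_def
  proof (induction rule: trancl_induct)
    case (base c)
    show ?case
    proof (cases "c = b")
      case True
      then show ?thesis using that(2,3) ker by blast
    next
      case False
      then obtain r s where rs: "(r, s) \<in> R" "b = g r" "c = g s" using base by auto
      have "(x, r) \<in> ?J" using rs RA that(2,3) by (intro ker) auto
      then have xs: "(x, s) \<in> ?J" using rs(1) J(1,3) by (meson subsetD transD)
      have "(s, y) \<in> ?J" if "y \<in> A" "g y = c" for y
        using that rs RA by (intro ker) auto
      then show ?thesis using xs rs RA by (auto intro: trancl_trans)
    qed
  next
    case (step c d)
    show ?case
    proof (cases "c = d")
      case True then show ?thesis using step.IH by simp
    next
      case False
      then obtain r s where rs: "(r, s) \<in> R" "c = g r" "d = g s" using step.hyps(2) by auto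
      have "(x, r) \<in> ?J" using step.IH rs RA by auto
      then have xs: "(x, s) \<in> ?J" using rs(1) J(1,3) by (meson subsetD transD)
      have "(s, y) \<in> ?J" if "y \<in> A" "g y = d" for y
        using that rs RA by (intro ker) auto
      then show ?thesis using xs rs RA by (auto intro: trancl_trans)
    qed
  qed
  show "pull A g (push B g R) \<subseteq> ?J"
    using chain by (auto simp: pull_def)
qed

text \<open>The relation whose blocks are the set of values of \<open>g\<close> and the remaining
  singletons is already transitive, so generation adds nothing to it. This is the shape of every
  image in the form.\<close>

lemma push_full:
  assumes "g \<in> A \<rightarrow> B"
  shows "push B g (A \<times> A) = Id_on B \<union> g ` A \<times> g ` A"
proof (rule push_eqI[OF assms])
  show "equiv A (A \<times> A)" by (auto simp: equiv_def refl_on_def sym_def trans_def)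
  show "equiv B (Id_on B \<union> g ` A \<times> g ` A)"
    using assms by (auto simp: equiv_def refl_on_def sym_def trans_def)
  fix Q assume Q: "equiv B Q"
  show "Id_on B \<union> g ` A \<times> g ` A \<subseteq> Q \<longleftrightarrow> A \<times> A \<subseteq> pull A g Q"
    using equiv_Id_on[OF Q] by (auto simp: pull_def)
qed

text \<open>This is the second half of (N1). A pair in \<open>Q\<close> whose members are both
  values of \<open>g\<close> lifts to a pair in the inverse image, and a pair on the diagonal is
  covered by reflexivity.\<close>

lemma push_pull:
  assumes g: "g \<in> A \<rightarrow> B" and Q: "equiv B Q"
  shows "push B g (pull A g Q) = Q \<inter> push B g (A \<times> A)"
proof
  have full: "equiv A (A \<times> A)" by (auto simp: equiv_def refl_on_def sym_def trans_def)
  have e: "equiv B (Q \<inter> push B g (A \<times> A))"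
    using equiv_meet[OF Q equiv_push[OF g full]] .
  have sub: "pull A g Q \<subseteq> A \<times> A" by (auto simp: pull_def)
  show "push B g (pull A g Q) \<subseteq> Q \<inter> push B g (A \<times> A)"
    unfolding push_le_iff[OF g sub e] using g by (auto simp: push_full[OF g] pull_def)
  have P: "equiv B (push B g (pull A g Q))" by (rule equiv_push[OF g equiv_pull[OF g Q]])
  have "pull A g Q \<subseteq> pull A g (push B g (pull A g Q))" using push_le_iff[OF g sub P] by blast
  then show "Q \<inter> push B g (A \<times> A) \<subseteq> push B g (pull A g Q)"
    using equiv_Id_on[OF P] unfolding push_full[OF g] by (auto simp: pull_def)
qed

section \<open>Pointed sets, and encoding their equivalence relations in the universe\<close>

definition pointed :: "'a set \<Rightarrow> 'a option set" where
  "pointed A = insert None (Some ` A)"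

definition pointed_equivs :: "'a set \<Rightarrow> 'a option rel set" where
  "pointed_equivs A = {R. equiv (pointed A) R}"

lemma map_option_pointed: "h \<in> A \<rightarrow> B \<Longrightarrow> map_option h \<in> pointed A \<rightarrow> pointed B"
  by (auto simp: pointed_def)

lemma map_option_image_pointed: "map_option h ` pointed A = pointed (h ` A)"
  by (simp add: pointed_def image_image)

lemma full_pointed: "equiv (pointed A) (pointed A \<times> pointed A)"
  and Id_pointed: "equiv (pointed A) (Id_on (pointed A))"
  by (auto simp: equiv_def refl_on_def sym_def trans_def)

text \<open>For infinite \<open>A\<close>, pairs of points of \<open>pointed A\<close> are no more
  numerous than \<open>A\<close>, so the relations inject into \<open>Pow A\<close>, which is small
  by the strong limit property. A finite \<open>A\<close> is treated separately because adding a
  point changes its size; there finiteness against an infinite universe decides.\<close>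

lemma pointed_equivs_lepoll:
  fixes A :: "'u set"
  assumes uni: "universe TYPE('u)" and A: "small TYPE('u) A"
  shows "pointed_equivs A \<prec> (UNIV :: 'u set)"
proof -
  let ?P = "pointed A \<times> pointed A"
  have sub: "pointed_equivs A \<subseteq> Pow ?P" by (auto simp: pointed_equivs_def equiv_def)
  show ?thesis
  proof (cases "finite A")
    case True
    then have "finite (Pow ?P)" by (simp add: pointed_def)
    then have "finite (pointed_equivs A)" using sub finite_subset by blast
    then show ?thesis using uni unfolding universe_def by (intro finite_lesspoll_infinite) auto
  next
    case False
    have "Some ` A \<approx> A" by (simp add: inj_on_image_eqpoll_self)
    moreover have "insert None (Some ` A) \<approx> Some ` A"
      using False by (intro infinite_insert_eqpoll) (simp add: finite_image_iff)
    ultimately have "pointed A \<approx> A" unfolding pointed_def using eqpoll_trans by blast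
    then have "?P \<approx> A \<times> A" by (intro times_eqpoll_cong)
    moreover have "A \<times> A \<approx> A"
      unfolding eqpoll_iff_card_of_ordIso by (rule card_of_Times_same_infinite[OF False])
    ultimately have "?P \<lesssim> A" using eqpoll_trans eqpoll_imp_lepoll by blast
    then obtain f where f: "inj_on f ?P" "f ` ?P \<subseteq> A" by (auto simp: lepoll_def)
    have "image f ` Pow ?P \<subseteq> Pow A" using image_Pow_mono[OF f(2)] .
    then have "Pow ?P \<lesssim> Pow A" unfolding lepoll_def using inj_on_image_Pow[OF f(1)] by blast
    then have "pointed_equivs A \<lesssim> Pow A" using sub subset_imp_lepoll lepoll_trans by blast
    moreover have "Pow A \<prec> (UNIV :: 'u set)"
      using uni A unfolding universe_def small_def by blast
    ultimately show ?thesis by (rule lesspoll_trans1)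
  qed
qed

text \<open>The clusters of a small set are its pointed equivalence relations, encoded as elements of the
  universe by an arbitrary injection.\<close>

definition code :: "'u set \<Rightarrow> 'u option rel \<Rightarrow> 'u" where
  "code A = (SOME c. inj_on c (pointed_equivs A))"

definition decode :: "'u set \<Rightarrow> 'u \<Rightarrow> 'u option rel" where
  "decode A = inv_into (pointed_equivs A) (code A)"

text \<open>Inclusion of relations is transported along the encoding. Choosing \<open>(=)\<close>
  for \<open>eq\<close> turns the equivalences of the lattice locales into equalities.\<close>

definition equiv_fibre :: "'u set \<Rightarrow> 'u gorder" where
  "equiv_fibre A = \<lparr>carrier = code A ` pointed_equivs A, eq = (=),
     le = (\<lambda>S T. decode A S \<subseteq> decode A T)\<rparr>"

text \<open>The form is set up on all small sets, where the form laws and (N1) can be checked for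
  arbitrary functions; the form on \<open>C\<close> is obtained from it by composing with the
  functor.\<close>

definition equiv_form :: "('u set, 'u set_map, 'u) form" where
  "equiv_form = \<lparr>fibre = equiv_fibre,
     dir = (\<lambda>f S. code (Cod SET f)
       (push (pointed (Cod SET f)) (map_option (fun_of f)) (decode (Dom SET f) S))),
     inv_im = (\<lambda>f T. code (Dom SET f)
       (pull (pointed (Dom SET f)) (map_option (fun_of f)) (decode (Cod SET f) T)))\<rparr>"

context
  fixes A :: "'u set"
  assumes uni: "universe TYPE('u)" and A: "small TYPE('u) A"
begin

lemma inj_code: "inj_on (code A) (pointed_equivs A)"
proof -
  have "\<exists>c :: 'u option rel \<Rightarrow> 'u. inj_on c (pointed_equivs A)"
    using pointed_equivs_lepoll[OF uni A] unfolding lesspoll_def lepoll_def by blast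
  then show ?thesis unfolding code_def by (rule someI_ex)
qed

lemma decode_code: "equiv (pointed A) R \<Longrightarrow> decode A (code A R) = R"
  unfolding decode_def by (rule inv_into_f_f[OF inj_code]) (simp add: pointed_equivs_def)

lemma code_in_fibre: "equiv (pointed A) R \<Longrightarrow> code A R \<in> carrier (equiv_fibre A)"
  by (simp add: equiv_fibre_def pointed_equivs_def)

lemma in_fibreE:
  assumes "S \<in> carrier (equiv_fibre A)"
  obtains R where "equiv (pointed A) R" "S = code A R"
  using assms by (auto simp: equiv_fibre_def pointed_equivs_def)

lemma code_le_iff:
  "\<lbrakk>equiv (pointed A) R; equiv (pointed A) S\<rbrakk> \<Longrightarrow>
    code A R \<sqsubseteq>\<^bsub>equiv_fibre A\<^esub> code A S \<longleftrightarrow> R \<subseteq> S"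
  by (simp add: equiv_fibre_def decode_code)

lemma equiv_fibre_small: "small TYPE('u) (carrier (equiv_fibre A))"
proof -
  have "code A ` pointed_equivs A \<prec> (UNIV :: 'u set)"
    using image_lepoll pointed_equivs_lepoll[OF uni A] by (rule lesspoll_trans1)
  then show ?thesis by (simp add: equiv_fibre_def small_def)
qed

lemma equiv_fibre_least_sup:
  assumes R: "equiv (pointed A) R" and S: "equiv (pointed A) S"
  shows "least (equiv_fibre A) (code A ((R \<union> S)\<^sup>+)) (Upper (equiv_fibre A) {code A R, code A S})"
    and "greatest (equiv_fibre A) (code A (R \<inter> S)) (Lower (equiv_fibre A) {code A R, code A S})"
proof -
  let ?L = "equiv_fibre A"
  note J = equiv_join[OF R S] and I = equiv_meet[OF R S]
  show "least ?L (code A ((R \<union> S)\<^sup>+)) (Upper ?L {code A R, code A S})"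
    unfolding least_def
  proof (intro conjI ballI)
    show "code A ((R \<union> S)\<^sup>+) \<in> Upper ?L {code A R, code A S}"
      using R S J by (auto simp: Upper_def code_le_iff code_in_fibre)
    fix u assume "u \<in> Upper ?L {code A R, code A S}"
    then have u: "u \<in> carrier ?L" "code A R \<sqsubseteq>\<^bsub>?L\<^esub> u" "code A S \<sqsubseteq>\<^bsub>?L\<^esub> u"
      using code_in_fibre R S by (auto simp: Upper_def)
    then obtain U where U: "equiv (pointed A) U" "u = code A U" by (auto elim: in_fibreE)
    then show "code A ((R \<union> S)\<^sup>+) \<sqsubseteq>\<^bsub>?L\<^esub> u"
      using u R S J trancl_least[of "R \<union> S" U] by (simp add: code_le_iff equiv_def)
  qed (auto simp: Upper_def)
  show "greatest ?L (code A (R \<inter> S)) (Lower ?L {code A R, code A S})"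
    unfolding greatest_def
  proof (intro conjI ballI)
    show "code A (R \<inter> S) \<in> Lower ?L {code A R, code A S}"
      using R S I by (auto simp: Lower_def code_le_iff code_in_fibre)
    fix u assume "u \<in> Lower ?L {code A R, code A S}"
    then have u: "u \<in> carrier ?L" "u \<sqsubseteq>\<^bsub>?L\<^esub> code A R" "u \<sqsubseteq>\<^bsub>?L\<^esub> code A S"
      using code_in_fibre R S by (auto simp: Lower_def)
    then obtain U where U: "equiv (pointed A) U" "u = code A U" by (auto elim: in_fibreE)
    then show "u \<sqsubseteq>\<^bsub>?L\<^esub> code A (R \<inter> S)"
      using u R S I by (simp add: code_le_iff)
  qed (auto simp: Lower_def)
qed

lemma equiv_fibre_bounds:
  assumes "S \<in> carrier (equiv_fibre A)"
  shows "code A (Id_on (pointed A)) \<sqsubseteq>\<^bsub>equiv_fibre A\<^esub> S"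
    and "S \<sqsubseteq>\<^bsub>equiv_fibre A\<^esub> code A (pointed A \<times> pointed A)"
proof -
  from in_fibreE[OF assms] obtain R where R: "equiv (pointed A) R" "S = code A R" .
  moreover have "R \<subseteq> pointed A \<times> pointed A" using R(1) by (simp add: equiv_def)
  ultimately show "code A (Id_on (pointed A)) \<sqsubseteq>\<^bsub>equiv_fibre A\<^esub> S"
    and "S \<sqsubseteq>\<^bsub>equiv_fibre A\<^esub> code A (pointed A \<times> pointed A)"
    by (simp_all add: code_le_iff Id_pointed full_pointed equiv_Id_on)
qed

lemma equiv_fibre_bounded_lattice: "bounded_lattice (equiv_fibre A)"
proof
  let ?L = "equiv_fibre A"
  show "eq ?L = (=)" by (simp add: equiv_fibre_def)
  then show "x .=\<^bsub>?L\<^esub> x" "x .=\<^bsub>?L\<^esub> y \<Longrightarrow> y .=\<^bsub>?L\<^esub> x"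
    "\<lbrakk>x .=\<^bsub>?L\<^esub> y; y .=\<^bsub>?L\<^esub> z\<rbrakk> \<Longrightarrow> x .=\<^bsub>?L\<^esub> z"
    "\<lbrakk>x .=\<^bsub>?L\<^esub> y; z .=\<^bsub>?L\<^esub> w\<rbrakk> \<Longrightarrow> x \<sqsubseteq>\<^bsub>?L\<^esub> z \<longleftrightarrow> y \<sqsubseteq>\<^bsub>?L\<^esub> w" for x y z w
    by simp_all
  show "x \<sqsubseteq>\<^bsub>?L\<^esub> x" for x by (simp add: equiv_fibre_def)
  show "x .=\<^bsub>?L\<^esub> y" if "x \<sqsubseteq>\<^bsub>?L\<^esub> y" "y \<sqsubseteq>\<^bsub>?L\<^esub> x" "x \<in> carrier ?L" "y \<in> carrier ?L" for x y
  proof -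
    from that(3) obtain R where "equiv (pointed A) R" "x = code A R" by (rule in_fibreE)
    moreover from that(4) obtain S where "equiv (pointed A) S" "y = code A S" by (rule in_fibreE)
    ultimately show ?thesis using that \<open>eq ?L = (=)\<close> by (simp add: code_le_iff)
  qed
  show "\<lbrakk>x \<sqsubseteq>\<^bsub>?L\<^esub> y; y \<sqsubseteq>\<^bsub>?L\<^esub> z\<rbrakk> \<Longrightarrow> x \<sqsubseteq>\<^bsub>?L\<^esub> z" for x y z by (auto simp: equiv_fibre_def)
  show "\<exists>s. least ?L s (Upper ?L {x, y})" "\<exists>s. greatest ?L s (Lower ?L {x, y})"
    if "x \<in> carrier ?L" "y \<in> carrier ?L" for x y
  proof -
    from that(1) obtain R where R: "equiv (pointed A) R" "x = code A R" by (rule in_fibreE)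
    from that(2) obtain S where S: "equiv (pointed A) S" "y = code A S" by (rule in_fibreE)
    show "\<exists>s. least ?L s (Upper ?L {x, y})" "\<exists>s. greatest ?L s (Lower ?L {x, y})"
      unfolding R(2) S(2)
      by (rule exI, rule equiv_fibre_least_sup(1)[OF R(1) S(1)])
        (rule exI, rule equiv_fibre_least_sup(2)[OF R(1) S(1)])
  qed
  show "\<exists>x. least ?L x (carrier ?L)"
  proof
    show "least ?L (code A (Id_on (pointed A))) (carrier ?L)"
      by (simp add: least_def equiv_fibre_bounds code_in_fibre Id_pointed)
  qed
  show "\<exists>x. greatest ?L x (carrier ?L)"
  proof
    show "greatest ?L (code A (pointed A \<times> pointed A)) (carrier ?L)"
      by (simp add: greatest_def equiv_fibre_bounds code_in_fibre full_pointed)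
  qed
qed

interpretation fib: bounded_lattice "equiv_fibre A"
  by (rule equiv_fibre_bounded_lattice)

lemma equiv_fibre_join:
  "\<lbrakk>equiv (pointed A) R; equiv (pointed A) S\<rbrakk> \<Longrightarrow>
    code A R \<squnion>\<^bsub>equiv_fibre A\<^esub> code A S = code A ((R \<union> S)\<^sup>+)"
  by (rule fib.joinI) (auto intro: fib.least_unique equiv_fibre_least_sup code_in_fibre)

lemma equiv_fibre_meet:
  "\<lbrakk>equiv (pointed A) R; equiv (pointed A) S\<rbrakk> \<Longrightarrow>
    code A R \<sqinter>\<^bsub>equiv_fibre A\<^esub> code A S = code A (R \<inter> S)"
  by (rule fib.meetI) (auto intro: fib.greatest_unique equiv_fibre_least_sup code_in_fibre)

lemma equiv_fibre_bottom: "\<bottom>\<^bsub>equiv_fibre A\<^esub> = code A (Id_on (pointed A))"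
  by (rule fib.bottom_eq[symmetric]) (simp_all add: code_in_fibre Id_pointed equiv_fibre_bounds)

lemma equiv_fibre_top: "\<top>\<^bsub>equiv_fibre A\<^esub> = code A (pointed A \<times> pointed A)"
  by (rule fib.top_eq[symmetric]) (simp_all add: code_in_fibre full_pointed equiv_fibre_bounds)

end

section \<open>The form laws and (N1) for maps of sets\<close>

lemma SET_homD:
  assumes "f \<in> hom SET A B"
  shows "Dom SET f = A" "Cod SET f = B" "f \<in> Arr SET"
    "map_option (fun_of f) \<in> pointed A \<rightarrow> pointed B"
  using assms map_option_pointed[OF fun_of_hom[OF assms]] by (auto simp: hom_def)

context
  fixes f :: "'u set_map" and A B :: "'u set"
  assumes uni: "universe TYPE('u)" and f: "f \<in> hom SET A B"
begin

lemma small_hom: "small TYPE('u) A" "small TYPE('u) B"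
  using SET_Obj[OF f] by auto

lemma equiv_form_dir:
  "equiv (pointed A) R \<Longrightarrow>
    dir equiv_form f (code A R) = code B (push (pointed B) (map_option (fun_of f)) R)"
  by (simp add: equiv_form_def SET_homD[OF f] decode_code[OF uni small_hom(1)])

lemma equiv_form_inv:
  "equiv (pointed B) R \<Longrightarrow>
    inv_im equiv_form f (code B R) = code A (pull (pointed A) (map_option (fun_of f)) R)"
  by (simp add: equiv_form_def SET_homD[OF f] decode_code[OF uni small_hom(2)])

lemma equiv_form_Ker:
  "Ker SET equiv_form f = code A (pull (pointed A) (map_option (fun_of f)) (Id_on (pointed B)))"
proof -
  have "Ker SET equiv_form f = inv_im equiv_form f (code B (Id_on (pointed B)))"
    using equiv_fibre_bottom[OF uni small_hom(2)] by (simp add: Ker_def SET_homD[OF f] equiv_form_def)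
  then show ?thesis by (simp only: equiv_form_inv Id_pointed)
qed

lemma equiv_form_Im:
  "Im SET equiv_form f = code B (push (pointed B) (map_option (fun_of f)) (pointed A \<times> pointed A))"
proof -
  have "Im SET equiv_form f = dir equiv_form f (code A (pointed A \<times> pointed A))"
    using equiv_fibre_top[OF uni small_hom(1)] by (simp add: Im_def SET_homD[OF f] equiv_form_def)
  then show ?thesis by (simp only: equiv_form_dir full_pointed)
qed

text \<open>Decoding reduces the two equations to \<open>pull_push\<close> and
  \<open>push_pull\<close>, with the transitive closure of a union as join and intersection as
  meet.\<close>

lemma equiv_form_N1:
  "S \<in> carrier (equiv_fibre A) \<Longrightarrow>
    inv_im equiv_form f (dir equiv_form f S) = S \<squnion>\<^bsub>equiv_fibre A\<^esub> Ker SET equiv_form f"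
  "T \<in> carrier (equiv_fibre B) \<Longrightarrow>
    dir equiv_form f (inv_im equiv_form f T) = T \<sqinter>\<^bsub>equiv_fibre B\<^esub> Im SET equiv_form f"
proof -
  note g = SET_homD(4)[OF f]
  show "inv_im equiv_form f (dir equiv_form f S) = S \<squnion>\<^bsub>equiv_fibre A\<^esub> Ker SET equiv_form f"
    if "S \<in> carrier (equiv_fibre A)"
  proof -
    from in_fibreE[OF uni small_hom(1) that] obtain R where R: "equiv (pointed A) R" "S = code A R" .
    then show ?thesis
      by (simp add: equiv_form_dir equiv_form_inv equiv_push[OF g] equiv_form_Ker pull_push[OF g]
          equiv_fibre_join[OF uni small_hom(1)] equiv_pull[OF g] Id_pointed)
  qed
  show "dir equiv_form f (inv_im equiv_form f T) = T \<sqinter>\<^bsub>equiv_fibre B\<^esub> Im SET equiv_form f"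
    if "T \<in> carrier (equiv_fibre B)"
  proof -
    from in_fibreE[OF uni small_hom(2) that] obtain R where R: "equiv (pointed B) R" "T = code B R" .
    then show ?thesis
      by (simp add: equiv_form_dir equiv_form_inv equiv_pull[OF g] equiv_form_Im push_pull[OF g]
          equiv_fibre_meet[OF uni small_hom(2)] equiv_push[OF g] full_pointed)
  qed
qed

lemma equiv_form_closed:
  "S \<in> carrier (equiv_fibre A) \<Longrightarrow> dir equiv_form f S \<in> carrier (equiv_fibre B)"
  "T \<in> carrier (equiv_fibre B) \<Longrightarrow> inv_im equiv_form f T \<in> carrier (equiv_fibre A)"
  using equiv_push[OF SET_homD(4)[OF f]] equiv_pull[OF SET_homD(4)[OF f]]
    code_in_fibre[OF uni small_hom(1)] code_in_fibre[OF uni small_hom(2)]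
  by (auto elim!: in_fibreE[OF uni small_hom(1)] in_fibreE[OF uni small_hom(2)]
      simp: equiv_form_dir equiv_form_inv)

lemma equiv_form_adjunction:
  assumes "S \<in> carrier (equiv_fibre A)" "T \<in> carrier (equiv_fibre B)"
  shows "dir equiv_form f S \<sqsubseteq>\<^bsub>equiv_fibre B\<^esub> T \<longleftrightarrow> S \<sqsubseteq>\<^bsub>equiv_fibre A\<^esub> inv_im equiv_form f T"
proof -
  note g = SET_homD(4)[OF f]
  from in_fibreE[OF uni small_hom(1) assms(1)] obtain R where R: "equiv (pointed A) R" "S = code A R" .
  from in_fibreE[OF uni small_hom(2) assms(2)] obtain Q where Q: "equiv (pointed B) Q" "T = code B Q" .
  have "R \<subseteq> pointed A \<times> pointed A" using R by (simp add: equiv_def)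
  from push_le_iff[OF g this Q(1)] show ?thesis
    using R Q equiv_push[OF g R(1)] equiv_pull[OF g Q(1)]
    by (simp add: equiv_form_dir equiv_form_inv code_le_iff[OF uni small_hom(1)]
        code_le_iff[OF uni small_hom(2)])
qed

end

lemma fibre_equiv_form: "fibre equiv_form = equiv_fibre"
  by (simp add: equiv_form_def)

text \<open>Monotonicity comes from the unit and counit inequalities, so it does not have to be
  checked separately for relations.\<close>

lemma isotone_adjoints:
  assumes "bounded_lattice L" "bounded_lattice N"
    and l: "\<And>x. x \<in> carrier L \<Longrightarrow> l x \<in> carrier N" and r: "\<And>y. y \<in> carrier N \<Longrightarrow> r y \<in> carrier L"
    and adj: "\<And>x y. \<lbrakk>x \<in> carrier L; y \<in> carrier N\<rbrakk> \<Longrightarrow> l x \<sqsubseteq>\<^bsub>N\<^esub> y \<longleftrightarrow> x \<sqsubseteq>\<^bsub>L\<^esub> r y"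
  shows "isotone L N l" "isotone N L r"
proof -
  interpret L: bounded_lattice L by fact
  interpret N: bounded_lattice N by fact
  show "isotone L N l"
  proof (rule isotoneI)
    fix x y assume xy: "x \<in> carrier L" "y \<in> carrier L" "x \<sqsubseteq>\<^bsub>L\<^esub> y"
    have "y \<sqsubseteq>\<^bsub>L\<^esub> r (l y)" using adj[OF xy(2) l[OF xy(2)]] l[OF xy(2)] by simp
    then have "x \<sqsubseteq>\<^bsub>L\<^esub> r (l y)" using L.le_trans[OF xy(3)] xy l r by simp
    then show "l x \<sqsubseteq>\<^bsub>N\<^esub> l y" using adj xy l by simp
  qed unfold_locales
  show "isotone N L r"
  proof (rule isotoneI)
    fix x y assume xy: "x \<in> carrier N" "y \<in> carrier N" "x \<sqsubseteq>\<^bsub>N\<^esub> y"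
    have "l (r x) \<sqsubseteq>\<^bsub>N\<^esub> x" using adj[OF r[OF xy(1)] xy(1)] r[OF xy(1)] by simp
    then have "l (r x) \<sqsubseteq>\<^bsub>N\<^esub> y" using N.le_trans[OF _ xy(3)] xy l r by simp
    then show "r x \<sqsubseteq>\<^bsub>L\<^esub> r y" using adj xy r by simp
  qed unfold_locales
qed

lemma equiv_form_Comp:
  fixes A B D :: "'u set"
  assumes uni: "universe TYPE('u)" and f: "f \<in> hom SET A B" and g: "g \<in> hom SET B D"
  shows "S \<in> carrier (equiv_fibre A) \<Longrightarrow>
      dir equiv_form (g \<cdot>\<^bsub>SET\<^esub> f) S = dir equiv_form g (dir equiv_form f S)"
    and "T \<in> carrier (equiv_fibre D) \<Longrightarrow>
      inv_im equiv_form (g \<cdot>\<^bsub>SET\<^esub> f) T = inv_im equiv_form f (inv_im equiv_form g T)"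
proof -
  have gf: "g \<cdot>\<^bsub>SET\<^esub> f \<in> hom SET A D"
    by (rule category.Comp_in_hom[OF category_SET f g])
  note A = SET_Obj[OF f, THEN conjunct1] and D = SET_Obj[OF g, THEN conjunct2]
  have comp: "map_option (fun_of (g \<cdot>\<^bsub>SET\<^esub> f)) x = map_option (fun_of g) (map_option (fun_of f) x)"
    if "x \<in> pointed A" for x
    using that fun_of_Comp[OF f g] by (auto simp: pointed_def)
  show "dir equiv_form (g \<cdot>\<^bsub>SET\<^esub> f) S = dir equiv_form g (dir equiv_form f S)"
    if "S \<in> carrier (equiv_fibre A)"
  proof -
    from in_fibreE[OF uni A that] obtain R where R: "equiv (pointed A) R" "S = code A R" .
    then show ?thesis
      using push_Comp[OF SET_homD(4)[OF f] SET_homD(4)[OF g] R(1) comp] equiv_push[OF SET_homD(4)[OF f] R(1)]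
      by (simp add: equiv_form_dir[OF uni f] equiv_form_dir[OF uni g] equiv_form_dir[OF uni gf])
  qed
  show "inv_im equiv_form (g \<cdot>\<^bsub>SET\<^esub> f) T = inv_im equiv_form f (inv_im equiv_form g T)"
    if "T \<in> carrier (equiv_fibre D)"
  proof -
    from in_fibreE[OF uni D that] obtain R where R: "equiv (pointed D) R" "T = code D R" .
    then show ?thesis
      using pull_Comp[OF SET_homD(4)[OF f], of _ "map_option (fun_of g)", OF comp] equiv_pull[OF SET_homD(4)[OF g] R(1)]
      by (simp add: equiv_form_inv[OF uni f] equiv_form_inv[OF uni g] equiv_form_inv[OF uni gf])
  qed
qed

lemma equiv_form_Id:
  fixes A :: "'u set"
  assumes uni: "universe TYPE('u)" and A: "small TYPE('u) A" and S: "S \<in> carrier (equiv_fibre A)"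
  shows "dir equiv_form (Id SET A) S = S" and "inv_im equiv_form (Id SET A) S = S"
proof -
  have I: "Id SET A \<in> hom SET A A"
    by (rule category.Id_in_hom[OF category_SET]) (simp add: Obj_SET A)
  from in_fibreE[OF uni A S] obtain R where R: "equiv (pointed A) R" "S = code A R" .
  have id: "map_option (fun_of (Id SET A)) x = x" if "x \<in> pointed A" for x
    using that fun_of_Id by (auto simp: pointed_def)
  have pull: "pull (pointed A) (map_option (fun_of (Id SET A))) Q = Q" if "equiv (pointed A) Q" for Q
    using that id by (auto simp: pull_def equiv_def)
  then show "inv_im equiv_form (Id SET A) S = S"
    using R equiv_form_inv[OF uni I] by simp
  have "push (pointed A) (map_option (fun_of (Id SET A))) R = R"
    by (rule push_eqI[OF SET_homD(4)[OF I] R(1) R(1)]) (simp add: pull)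
  then show "dir equiv_form (Id SET A) S = S"
    using R equiv_form_dir[OF uni I] by simp
qed

lemma is_form_equiv_form:
  assumes "universe TYPE('u)"
  shows "is_form SET (equiv_form :: ('u set, 'u set_map, 'u) form)"
  unfolding is_form_def fibre_equiv_form
proof (intro conjI ballI impI)
  fix A :: "'u set" assume "A \<in> Obj SET"
  then have A: "small TYPE('u) A" by (simp add: Obj_SET)
  show "bounded_lattice (equiv_fibre A)" by (rule equiv_fibre_bounded_lattice[OF assms A])
  show "small TYPE('u) (carrier (equiv_fibre A))" by (rule equiv_fibre_small[OF assms A])
  fix S assume S: "S \<in> carrier (equiv_fibre A)"
  show "dir equiv_form (Id SET A) S = S" "inv_im equiv_form (Id SET A) S = S"
    by (rule equiv_form_Id[OF assms A S])+
next
  fix f :: "'u set_map" assume "f \<in> Arr SET"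
  then have f: "f \<in> hom SET (Dom SET f) (Cod SET f)" by (rule homI)
  note AB = SET_Obj[OF f, THEN conjunct1] SET_Obj[OF f, THEN conjunct2]
  note iso = isotone_adjoints[OF equiv_fibre_bounded_lattice[OF assms AB(1)]
      equiv_fibre_bounded_lattice[OF assms AB(2)] equiv_form_closed[OF assms f]
      equiv_form_adjunction[OF assms f]]
  show "isotone (equiv_fibre (Dom SET f)) (equiv_fibre (Cod SET f)) (dir equiv_form f)"
    and "isotone (equiv_fibre (Cod SET f)) (equiv_fibre (Dom SET f)) (inv_im equiv_form f)"
    using iso by simp_all
  show "dir equiv_form f \<in> carrier (equiv_fibre (Dom SET f)) \<rightarrow> carrier (equiv_fibre (Cod SET f))"
    and "inv_im equiv_form f \<in> carrier (equiv_fibre (Cod SET f)) \<rightarrow> carrier (equiv_fibre (Dom SET f))"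
    using equiv_form_closed[OF assms f] by blast+
  show "dir equiv_form f S \<sqsubseteq>\<^bsub>equiv_fibre (Cod SET f)\<^esub> T \<longleftrightarrow>
      S \<sqsubseteq>\<^bsub>equiv_fibre (Dom SET f)\<^esub> inv_im equiv_form f T"
    if "S \<in> carrier (equiv_fibre (Dom SET f))" "T \<in> carrier (equiv_fibre (Cod SET f))" for S T
    by (rule equiv_form_adjunction[OF assms f that])
  fix g :: "'u set_map" assume "g \<in> Arr SET" "Cod SET f = Dom SET g"
  then have g: "g \<in> hom SET (Cod SET f) (Cod SET g)" by (simp add: hom_def)
  show "dir equiv_form (g \<cdot>\<^bsub>SET\<^esub> f) S = dir equiv_form g (dir equiv_form f S)"
    if "S \<in> carrier (equiv_fibre (Dom SET f))" for S
    by (rule equiv_form_Comp(1)[OF assms f g that])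
  show "inv_im equiv_form (g \<cdot>\<^bsub>SET\<^esub> f) T = inv_im equiv_form f (inv_im equiv_form g T)"
    if "T \<in> carrier (equiv_fibre (Cod SET g))" for T
    by (rule equiv_form_Comp(2)[OF assms f g that])
qed

section \<open>Comparing, joining and intersecting kernels and images of maps of sets\<close>

text \<open>Only \<open>None\<close> is sent to \<open>None\<close>, so the base point is alone in
  its class: kernels amount to ordinary kernel relations on \<open>A\<close>.\<close>

lemma pull_pointed_Id:
  assumes "h \<in> A \<rightarrow> B"
  shows "pull (pointed A) (map_option h) (Id_on (pointed B)) =
    insert (None, None) {(Some x, Some y) | x y. x \<in> A \<and> y \<in> A \<and> h x = h y}"
proof -
  have "h x \<in> B" if "x \<in> A" for x using assms that by blast
  then show ?thesis by (auto simp: pull_def pointed_def)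
qed

lemma equiv_form_Ker_le_iff:
  fixes A B D :: "'u set"
  assumes uni: "universe TYPE('u)" and f: "f \<in> hom SET A B" and g: "g \<in> hom SET A D"
  shows "Ker SET equiv_form f \<sqsubseteq>\<^bsub>equiv_fibre A\<^esub> Ker SET equiv_form g \<longleftrightarrow>
    (\<forall>x\<in>A. \<forall>y\<in>A. fun_of f x = fun_of f y \<longrightarrow> fun_of g x = fun_of g y)"
proof -
  have A: "small TYPE('u) A" using SET_Obj[OF f] by blast
  note eq = equiv_pull[OF SET_homD(4)[OF f] Id_pointed] equiv_pull[OF SET_homD(4)[OF g] Id_pointed]
  have "Ker SET equiv_form f \<sqsubseteq>\<^bsub>equiv_fibre A\<^esub> Ker SET equiv_form g \<longleftrightarrow>
    pull (pointed A) (map_option (fun_of f)) (Id_on (pointed B)) \<subseteq>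
    pull (pointed A) (map_option (fun_of g)) (Id_on (pointed D))"
    unfolding equiv_form_Ker[OF uni f] equiv_form_Ker[OF uni g] by (rule code_le_iff[OF uni A eq])
  also have "\<dots> \<longleftrightarrow> (\<forall>x\<in>A. \<forall>y\<in>A. fun_of f x = fun_of f y \<longrightarrow> fun_of g x = fun_of g y)"
    unfolding pull_pointed_Id[OF fun_of_hom[OF f]] pull_pointed_Id[OF fun_of_hom[OF g]] by auto
  finally show ?thesis .
qed

text \<open>The base point belongs to the collapsed block, so the block can be recovered from the
  relation as the class of \<open>None\<close>, even when the image is empty.\<close>

lemma equiv_form_Im_le_iff:
  fixes A B D :: "'u set"
  assumes uni: "universe TYPE('u)" and f: "f \<in> hom SET A D" and g: "g \<in> hom SET B D"
  shows "Im SET equiv_form f \<sqsubseteq>\<^bsub>equiv_fibre D\<^esub> Im SET equiv_form g \<longleftrightarrow>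
    fun_of f ` A \<subseteq> fun_of g ` B"
proof -
  have D: "small TYPE('u) D" using SET_Obj[OF f] by blast
  note eq = equiv_push[OF SET_homD(4)[OF f] full_pointed] equiv_push[OF SET_homD(4)[OF g] full_pointed]
  have "Im SET equiv_form f \<sqsubseteq>\<^bsub>equiv_fibre D\<^esub> Im SET equiv_form g \<longleftrightarrow>
    push (pointed D) (map_option (fun_of f)) (pointed A \<times> pointed A) \<subseteq>
    push (pointed D) (map_option (fun_of g)) (pointed B \<times> pointed B)"
    unfolding equiv_form_Im[OF uni f] equiv_form_Im[OF uni g] by (rule code_le_iff[OF uni D eq])
  also have "\<dots> \<longleftrightarrow> pointed (fun_of f ` A) \<subseteq> pointed (fun_of g ` B)"
  proof -
    have "pointed X \<subseteq> pointed Y"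
      if *: "Id_on P \<union> pointed X \<times> pointed X \<subseteq> Id_on P \<union> pointed Y \<times> pointed Y" for P and X Y :: "'u set"
    proof
      fix x assume "x \<in> pointed X"
      \<comment> \<open>Being related to \<open>None\<close> means membership in the block of
        \<open>Y\<close>, or being \<open>None\<close> itself, which lies in that block
        anyway.\<close>
      then have "(x, None) \<in> Id_on P \<union> pointed Y \<times> pointed Y"
        by (intro subsetD[OF *] UnI2) (simp add: pointed_def)
      then show "x \<in> pointed Y" by (auto simp: pointed_def)
    qed
    then have "Id_on P \<union> pointed X \<times> pointed X \<subseteq> Id_on P \<union> pointed Y \<times> pointed Y \<longleftrightarrow>
        pointed X \<subseteq> pointed Y" for P and X Y :: "'u set"
      by (intro iffI Un_mono Sigma_mono) auto
    then show ?thesis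
      unfolding push_full[OF SET_homD(4)[OF f]] push_full[OF SET_homD(4)[OF g]] map_option_image_pointed .
  qed
  also have "\<dots> \<longleftrightarrow> fun_of f ` A \<subseteq> fun_of g ` B" by (auto simp: pointed_def)
  finally show ?thesis .
qed

text \<open>Hypothesis \<open>t\<close> is the form in which \<open>SET_pushoutD\<close> delivers a
  pushout. To extract membership in the join from it, a test function has to separate the classes of
  the join; its values must be elements of \<open>'u\<close>, so it uses representatives rather than
  the classes themselves.\<close>

lemma equiv_form_Ker_join:
  fixes A B D Z :: "'u set"
  assumes uni: "universe TYPE('u)"
    and f: "f \<in> hom SET A B" and g: "g \<in> hom SET A D" and h: "h \<in> hom SET A Z"
    and fh: "\<And>x y. \<lbrakk>x \<in> A; y \<in> A; fun_of f x = fun_of f y\<rbrakk> \<Longrightarrow> fun_of h x = fun_of h y"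
    and gh: "\<And>x y. \<lbrakk>x \<in> A; y \<in> A; fun_of g x = fun_of g y\<rbrakk> \<Longrightarrow> fun_of h x = fun_of h y"
    and t: "\<And>(t :: 'u \<Rightarrow> 'u) x y.
      \<lbrakk>\<And>x y. \<lbrakk>x \<in> A; y \<in> A; fun_of f x = fun_of f y\<rbrakk> \<Longrightarrow> t x = t y;
       \<And>x y. \<lbrakk>x \<in> A; y \<in> A; fun_of g x = fun_of g y\<rbrakk> \<Longrightarrow> t x = t y;
       x \<in> A; y \<in> A; fun_of h x = fun_of h y\<rbrakk> \<Longrightarrow> t x = t y"
  shows "Ker SET equiv_form f \<squnion>\<^bsub>equiv_fibre A\<^esub> Ker SET equiv_form g = Ker SET equiv_form h"
proof -
  have A: "small TYPE('u) A" using SET_Obj[OF f] by blast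
  let ?K = "pull (pointed A) (map_option (fun_of f)) (Id_on (pointed B))"
  let ?L = "pull (pointed A) (map_option (fun_of g)) (Id_on (pointed D))"
  let ?N = "pull (pointed A) (map_option (fun_of h)) (Id_on (pointed Z))"
  note eq = equiv_pull[OF SET_homD(4)[OF f] Id_pointed] equiv_pull[OF SET_homD(4)[OF g] Id_pointed]
    equiv_pull[OF SET_homD(4)[OF h] Id_pointed]
  note pulls = pull_pointed_Id[OF fun_of_hom[OF f]] pull_pointed_Id[OF fun_of_hom[OF g]]
    pull_pointed_Id[OF fun_of_hom[OF h]]
  define R where "R = (?K \<union> ?L)\<^sup>+"
  have R: "equiv (pointed A) R" unfolding R_def by (rule equiv_join[OF eq(1,2)])
  have sym: "sym R" and trans: "trans R" and refl: "refl_on (pointed A) R"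
    using R by (simp_all add: equiv_def)
  have KR: "?K \<subseteq> R" "?L \<subseteq> R" unfolding R_def by auto
  have "R = ?N"
  proof
    show "R \<subseteq> ?N" unfolding R_def
    proof (rule trancl_least)
      show "trans ?N" using eq(3) by (simp add: equiv_def)
      show "?K \<union> ?L \<subseteq> ?N"
        unfolding pulls by (auto intro: fh gh)
    qed
    \<comment> \<open>\<open>r\<close> picks a representative of each class, so \<open>t\<close> applied to it tests membership in \<open>R\<close>.\<close>
    define r where "r x = (SOME y. (Some x, Some y) \<in> R)" for x
    have ref: "(Some x, Some x) \<in> R" if "x \<in> A" for x
      by (rule refl_onD[OF refl]) (simp add: that pointed_def)
    have r: "(Some x, Some (r x)) \<in> R" if "x \<in> A" for x
      unfolding r_def by (rule someI[of "\<lambda>y. (Some x, Some y) \<in> R", OF ref[OF that]])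
    have cong: "r x = r y" if "(Some x, Some y) \<in> R" for x y
    proof -
      have "R `` {Some x} = R `` {Some y}" using equiv_class_eq[OF R that] .
      then have "(Some x, Some z) \<in> R \<longleftrightarrow> (Some y, Some z) \<in> R" for z by blast
      then show ?thesis unfolding r_def by simp
    qed
    have RI: "(Some x, Some y) \<in> R" if "x \<in> A" "y \<in> A" "fun_of h x = fun_of h y" for x y
    proof -
      have "r x = r y"
      proof (rule t[OF _ _ that])
        show "r x = r y" if "x \<in> A" "y \<in> A" "fun_of f x = fun_of f y" for x y
          by (rule cong[OF subsetD[OF KR(1)]]) (simp add: pulls that)
        show "r x = r y" if "x \<in> A" "y \<in> A" "fun_of g x = fun_of g y" for x y
          by (rule cong[OF subsetD[OF KR(2)]]) (simp add: pulls that)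
      qed
      then have "(Some (r x), Some y) \<in> R"
        using symD[OF sym r[OF that(2)]] by simp
      then show ?thesis by (rule transD[OF trans r[OF that(1)]])
    qed
    have "(None, None) \<in> R" by (rule refl_onD[OF refl]) (simp add: pointed_def)
    then show "?N \<subseteq> R" unfolding pulls by (auto intro: RI)
  qed
  then show ?thesis
    unfolding equiv_form_Ker[OF uni f] equiv_form_Ker[OF uni g] equiv_form_Ker[OF uni h]
      equiv_fibre_join[OF uni A eq(1,2)] R_def by simp
qed

text \<open>Each image is the diagonal together with a square block, so intersecting two of them
  intersects the blocks, and both blocks share the base point.\<close>

lemma equiv_form_Im_meet:
  fixes A B D Z :: "'u set"
  assumes uni: "universe TYPE('u)"
    and f: "f \<in> hom SET A D" and g: "g \<in> hom SET B D" and h: "h \<in> hom SET Z D"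
    and img: "fun_of h ` Z = fun_of f ` A \<inter> fun_of g ` B"
  shows "Im SET equiv_form f \<sqinter>\<^bsub>equiv_fibre D\<^esub> Im SET equiv_form g = Im SET equiv_form h"
proof -
  have D: "small TYPE('u) D" using SET_Obj[OF f] by blast
  note eq = equiv_push[OF SET_homD(4)[OF f] full_pointed] equiv_push[OF SET_homD(4)[OF g] full_pointed]
  have "pointed (fun_of h ` Z) = pointed (fun_of f ` A) \<inter> pointed (fun_of g ` B)"
    unfolding img by (auto simp: pointed_def)
  then have "(Id_on (pointed D) \<union> pointed (fun_of f ` A) \<times> pointed (fun_of f ` A)) \<inter>
      (Id_on (pointed D) \<union> pointed (fun_of g ` B) \<times> pointed (fun_of g ` B)) =
      Id_on (pointed D) \<union> pointed (fun_of h ` Z) \<times> pointed (fun_of h ` Z)"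
    by (simp only: Times_Int_Times[symmetric] Un_Int_distrib[symmetric])
  then show ?thesis
    unfolding equiv_form_Im[OF uni f] equiv_form_Im[OF uni g] equiv_form_Im[OF uni h]
      equiv_fibre_meet[OF uni D eq]
    by (simp only: push_full[OF SET_homD(4)[OF f]] push_full[OF SET_homD(4)[OF g]]
      push_full[OF SET_homD(4)[OF h]] map_option_image_pointed)
qed

section \<open>The form of a conservative functor\<close>

text \<open>The fibres are borrowed from the target category, but which clusters are normal or
  conormal depends on the morphisms of the source. So the form laws and (N1) are inherited, while
  (N2) and (N3) have to be proved anew.\<close>

definition reindex ::
    "('o \<Rightarrow> 'p) \<Rightarrow> ('a \<Rightarrow> 'b) \<Rightarrow> ('p, 'b, 'u) form \<Rightarrow> ('o, 'a, 'u) form" where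
  "reindex To Ta G = \<lparr>fibre = (\<lambda>X. fibre G (To X)), dir = (\<lambda>f. dir G (Ta f)),
     inv_im = (\<lambda>f. inv_im G (Ta f))\<rparr>"

lemma functor_hom:
  "\<lbrakk>is_functor C D To Ta; f \<in> hom C X Y\<rbrakk> \<Longrightarrow> Ta f \<in> hom D (To X) (To Y)"
  unfolding is_functor_def hom_def by blast

lemma functor_Comp:
  "\<lbrakk>is_functor C D To Ta; f \<in> hom C X Y; g \<in> hom C Y Z\<rbrakk> \<Longrightarrow>
    Ta (g \<cdot>\<^bsub>C\<^esub> f) = Ta g \<cdot>\<^bsub>D\<^esub> Ta f"
  by (simp add: is_functor_def hom_def)

lemma is_form_reindex:
  fixes G :: "('p, 'b, 'u) form"
  assumes fn: "is_functor C D To Ta" and form: "is_form D G"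
  shows "is_form C (reindex To Ta G)"
proof -
  have Ob: "To X \<in> Obj D" "Ta (Id C X) = Id D (To X)" if "X \<in> Obj C" for X
    using fn that by (simp_all add: is_functor_def)
  have Ar: "Ta f \<in> Arr D" "Dom D (Ta f) = To (Dom C f)" "Cod D (Ta f) = To (Cod C f)"
    if "f \<in> Arr C" for f
    using fn that by (simp_all add: is_functor_def hom_def)
  have Co: "Ta (g \<cdot>\<^bsub>C\<^esub> f) = Ta g \<cdot>\<^bsub>D\<^esub> Ta f"
    if "f \<in> Arr C" "g \<in> Arr C" "Cod C f = Dom C g" for f g
    using fn that by (simp add: is_functor_def)
  note G = form[unfolded is_form_def]
  note G1 = G[THEN conjunct1] and G2 = G[THEN conjunct2, THEN conjunct1]
    and G3 = G[THEN conjunct2, THEN conjunct2, THEN conjunct1]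
    and G4 = G[THEN conjunct2, THEN conjunct2, THEN conjunct2]
  have "bounded_lattice (fibre G (To X)) \<and> small TYPE('u) (carrier (fibre G (To X)))"
    if "X \<in> Obj C" for X
    using bspec[OF G1 Ob(1)[OF that]] .
  moreover note bspec[OF G2 Ar(1), unfolded Ar]
  moreover have "(\<forall>S\<in>carrier (fibre G (To (Dom C f))). dir G (Ta (g \<cdot>\<^bsub>C\<^esub> f)) S = dir G (Ta g) (dir G (Ta f) S)) \<and>
      (\<forall>T\<in>carrier (fibre G (To (Cod C g))).
        inv_im G (Ta (g \<cdot>\<^bsub>C\<^esub> f)) T = inv_im G (Ta f) (inv_im G (Ta g) T))"
    if "f \<in> Arr C" "g \<in> Arr C" "Cod C f = Dom C g" for f g
    using bspec[OF bspec[OF G3 Ar(1)[OF that(1)]] Ar(1)[OF that(2)]] that by (simp add: Ar Co)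
  moreover have "dir G (Ta (Id C X)) S = S \<and> inv_im G (Ta (Id C X)) S = S"
    if "X \<in> Obj C" "S \<in> carrier (fibre G (To X))" for X S
    using bspec[OF bspec[OF G4 Ob(1)[OF that(1)]] that(2)] by (simp add: Ob that)
  ultimately show ?thesis
    unfolding is_form_def by (simp add: reindex_def Ar)
qed

lemma
  assumes "is_functor C D To Ta" and "f \<in> hom C X Y"
  shows Ker_reindex: "Ker C (reindex To Ta G) f = Ker D G (Ta f)"
    and Im_reindex: "Im C (reindex To Ta G) f = Im D G (Ta f)"
  using functor_hom[OF assms] assms(2) by (simp_all add: Ker_def Im_def reindex_def hom_def)

section \<open>The reindexed form: its quotients and embeddings, and the noetherian axioms\<close>

locale concrete_factorization = proper_factorization C E M
  for C :: "('o, 'a) cat" (structure) and E M +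
  fixes To :: "'o \<Rightarrow> 'u set" and Ta :: "'a \<Rightarrow> 'u set_map"
  assumes uni: "universe TYPE('u)"
    and pullbacks: "has_pullbacks_of C M" and pushouts: "has_pushouts_of C E"
    and fn: "is_functor C SET To Ta" and conservative: "conservative C SET Ta"
    and E_surjective: "\<And>e. e \<in> E \<Longrightarrow> surjective_map (Ta e)"
    and M_injective: "\<And>m. m \<in> M \<Longrightarrow> injective_map (Ta m)"
    and pres_pullbacks: "preserves_pullbacks_of C SET Ta M"
    and pres_pushouts: "preserves_pushouts_of C SET Ta E"
begin

abbreviation F :: "('o, 'a, 'u) form" where "F \<equiv> reindex To Ta equiv_form"
abbreviation ap :: "'a \<Rightarrow> 'u \<Rightarrow> 'u" where "ap f \<equiv> fun_of (Ta f)"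

lemmas T_hom = functor_hom[OF fn]

lemma ap_Comp: "\<lbrakk>f \<in> hom C X Y; g \<in> hom C Y Z; x \<in> To X\<rbrakk> \<Longrightarrow> ap (g \<cdot> f) x = ap g (ap f x)"
  using fun_of_Comp[OF T_hom T_hom] functor_Comp[OF fn] by simp

lemma ap_closed: "\<lbrakk>f \<in> hom C X Y; x \<in> To X\<rbrakk> \<Longrightarrow> ap f x \<in> To Y"
  using funcset_mem[OF fun_of_hom[OF T_hom]] .

lemma ap_surj: "\<lbrakk>e \<in> E; e \<in> hom C X Y\<rbrakk> \<Longrightarrow> ap e ` To X = To Y"
  using surjective_map_iff[OF T_hom] E_surjective by blast

lemma ap_inj: "\<lbrakk>m \<in> M; m \<in> hom C X Y; x \<in> To X; y \<in> To X\<rbrakk> \<Longrightarrow> ap m x = ap m y \<longleftrightarrow> x = y"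
  using injective_map_iff[OF T_hom] M_injective inj_on_eq_iff by metis

lemma fibre_F: "fibre F X = equiv_fibre (To X)"
  by (simp add: reindex_def fibre_equiv_form)

lemma form_F: "is_form C F"
  by (rule is_form_reindex[OF fn is_form_equiv_form[OF uni]])

lemma small_T: "X \<in> Obj C \<Longrightarrow> small TYPE('u) (To X)"
  using fn Obj_SET unfolding is_functor_def by blast

lemma Ker_le_iff:
  "\<lbrakk>f \<in> hom C X Y; g \<in> hom C X Z\<rbrakk> \<Longrightarrow> Ker C F f \<sqsubseteq>\<^bsub>fibre F X\<^esub> Ker C F g \<longleftrightarrow>
    (\<forall>x\<in>To X. \<forall>y\<in>To X. ap f x = ap f y \<longrightarrow> ap g x = ap g y)"
  by (simp add: fibre_F Ker_reindex[OF fn] equiv_form_Ker_le_iff[OF uni T_hom T_hom])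

lemma Im_le_iff:
  "\<lbrakk>f \<in> hom C X Z; g \<in> hom C Y Z\<rbrakk> \<Longrightarrow> Im C F f \<sqsubseteq>\<^bsub>fibre F Z\<^esub> Im C F g \<longleftrightarrow>
    ap f ` To X \<subseteq> ap g ` To Y"
  by (simp add: fibre_F Im_reindex[OF fn] equiv_form_Im_le_iff[OF uni T_hom T_hom])

lemma Ker_in: "f \<in> hom C X Y \<Longrightarrow> Ker C F f \<in> carrier (fibre F X)"
  and Im_in: "f \<in> hom C X Y \<Longrightarrow> Im C F f \<in> carrier (fibre F Y)"
proof -
  assume f: "f \<in> hom C X Y"
  note T = T_hom[OF f] and Tf = SET_homD(4)[OF T_hom[OF f]]
  note S = SET_Obj[OF T, THEN conjunct1] SET_Obj[OF T, THEN conjunct2]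
  show "Ker C F f \<in> carrier (fibre F X)"
    unfolding fibre_F Ker_reindex[OF fn f] equiv_form_Ker[OF uni T]
    by (rule code_in_fibre[OF uni S(1) equiv_pull[OF Tf Id_pointed]])
  show "Im C F f \<in> carrier (fibre F Y)"
    unfolding fibre_F Im_reindex[OF fn f] equiv_form_Im[OF uni T]
    by (rule code_in_fibre[OF uni S(2) equiv_push[OF Tf full_pointed]])
qed

lemma le_antisym_F:
  assumes "X \<in> Obj C" "S \<in> carrier (fibre F X)" "T \<in> carrier (fibre F X)"
    "S \<sqsubseteq>\<^bsub>fibre F X\<^esub> T" "T \<sqsubseteq>\<^bsub>fibre F X\<^esub> S"
  shows "S = T"
proof -
  interpret L: bounded_lattice "fibre F X"
    unfolding fibre_F by (rule equiv_fibre_bounded_lattice[OF uni small_T[OF assms(1)]])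
  show ?thesis by (rule L.le_antisym) fact+
qed

lemma Ker_eqI:
  assumes f: "f \<in> hom C X Y" and g: "g \<in> hom C X Z"
    and eq: "\<And>x y. \<lbrakk>x \<in> To X; y \<in> To X\<rbrakk> \<Longrightarrow> ap f x = ap f y \<longleftrightarrow> ap g x = ap g y"
  shows "Ker C F f = Ker C F g"
proof (rule le_antisym_F)
  show "Ker C F f \<sqsubseteq>\<^bsub>fibre F X\<^esub> Ker C F g" "Ker C F g \<sqsubseteq>\<^bsub>fibre F X\<^esub> Ker C F f"
    by (simp_all add: Ker_le_iff[OF f g] Ker_le_iff[OF g f] eq)
qed (use hom_Obj[OF f] Ker_in[OF f] Ker_in[OF g] in blast)+

lemma Im_eqI:
  assumes f: "f \<in> hom C X Z" and g: "g \<in> hom C Y Z" and eq: "ap f ` To X = ap g ` To Y"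
  shows "Im C F f = Im C F g"
proof (rule le_antisym_F)
  show "Im C F f \<sqsubseteq>\<^bsub>fibre F Z\<^esub> Im C F g" "Im C F g \<sqsubseteq>\<^bsub>fibre F Z\<^esub> Im C F f"
    by (simp_all add: Im_le_iff[OF f g] Im_le_iff[OF g f] eq)
qed (use hom_Obj[OF f] Im_in[OF f] Im_in[OF g] in blast)+

text \<open>\<open>T m\<close> is injective, so following \<open>e\<close> by \<open>m\<close>
  creates no new identifications.\<close>

lemma factor_Ker:
  assumes "e \<in> hom C X I" "m \<in> hom C I Y" "m \<in> M"
  shows "Ker C F (m \<cdot> e) = Ker C F e"
  by (rule Ker_eqI[OF Comp_in_hom[OF assms(1,2)] assms(1)])
    (simp add: ap_Comp[OF assms(1,2)] ap_inj[OF assms(3,2)] ap_closed[OF assms(1)])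

text \<open>\<open>T e\<close> is surjective, so preceding \<open>m\<close> by \<open>e\<close>
  loses no values.\<close>

lemma factor_Im:
  assumes "e \<in> hom C X I" "m \<in> hom C I Y" "e \<in> E"
  shows "Im C F (m \<cdot> e) = Im C F m"
proof (rule Im_eqI[OF Comp_in_hom[OF assms(1,2)] assms(2)])
  have "ap (m \<cdot> e) ` To X = ap m ` (ap e ` To X)"
    unfolding image_image by (rule image_cong) (simp_all add: ap_Comp[OF assms(1,2)])
  then show "ap (m \<cdot> e) ` To X = ap m ` To I" by (simp only: ap_surj[OF assms(3,1)])
qed

text \<open>If \<open>T d\<close> identifies at most what \<open>T e\<close> identifies, then the pushout of \<open>d\<close> along
  \<open>e\<close> is carried by \<open>T\<close> to a bijection, hence is an isomorphism by conservativity.\<close>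

lemma E_factor:
  assumes dE: "d \<in> E" and d: "d \<in> hom C X A" and eE: "e \<in> E" and e: "e \<in> hom C X B"
    and ker: "\<And>x y. \<lbrakk>x \<in> To X; y \<in> To X; ap d x = ap d y\<rbrakk> \<Longrightarrow> ap e x = ap e y"
  shows "\<exists>h\<in>hom C A B. e = h \<cdot> d"
proof -
  have "Dom C d = Dom C e" using d e by (simp add: hom_def)
  then obtain p q where po: "is_pushout C d e p q"
    using pushouts dE eE unfolding has_pushouts_of_def by blast
  obtain P where p: "p \<in> hom C A P" and q: "q \<in> hom C B P" and pq: "p \<cdot> d = q \<cdot> e"
    by (rule pushoutE[OF po d e])
  have Tpo: "is_pushout SET (Ta d) (Ta e) (Ta p) (Ta q)"
    using pres_pushouts dE eE po unfolding preserves_pushouts_of_def by blast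
  have Be: "small TYPE('u) (To B)" using small_T hom_Obj[OF e] by blast
  have eB: "ap e \<in> To X \<rightarrow> To B" by (rule fun_of_hom[OF T_hom[OF e]])
  \<comment> \<open>\<open>u\<close> is merely a function on the underlying sets, not the value of
    \<open>T\<close> at a morphism; it only serves to show that \<open>T q\<close> is
    invertible.\<close>
  obtain u where u: "u \<in> hom SET (To A) (To B)" "\<And>x. x \<in> To X \<Longrightarrow> fun_of u (ap d x) = ap e x"
    using SET_factor_surj[OF T_hom[OF d] E_surjective[OF dE] Be eB ker] by blast
  have "u \<cdot>\<^bsub>SET\<^esub> Ta d = Ta e"
    by (rule SET_eqI[OF category.Comp_in_hom[OF category_SET T_hom[OF d] u(1)] T_hom[OF e]])
      (simp add: fun_of_Comp[OF T_hom[OF d] u(1)] u(2))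
  then have "isomorphism SET (Ta q)"
    by (rule category.pushout_iso[OF category_SET Tpo T_hom[OF d] T_hom[OF e]
          SET_epic[OF T_hom[OF d] E_surjective[OF dE]] u(1)])
  then have "isomorphism C q" using conservative q unfolding conservative_def hom_def by blast
  from isomorphismE[OF this q] obtain r where r: "r \<in> hom C P B" "r \<cdot> q = Id C B" .
  have "(r \<cdot> p) \<cdot> d = (r \<cdot> q) \<cdot> e"
    using Comp_assoc[OF d p r(1)] Comp_assoc[OF e q r(1)] pq by simp
  then have "(r \<cdot> p) \<cdot> d = e" using r(2) Id_Comp[OF e] by simp
  then show ?thesis using Comp_in_hom[OF p r(1)] by blast
qed

text \<open>Dually, if the image of \<open>T n\<close> lies in that of \<open>T m\<close>, the
  pullback projection \<open>q\<close> onto the domain of \<open>n\<close> is a bijection under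
  \<open>T\<close>, hence invertible in \<open>C\<close>. Its inverse followed by \<open>p\<close>
  is the factorization.\<close>

lemma M_factor:
  assumes mM: "m \<in> M" and m: "m \<in> hom C A X" and nM: "n \<in> M" and n: "n \<in> hom C B X"
    and img: "ap n ` To B \<subseteq> ap m ` To A"
  shows "\<exists>h\<in>hom C B A. n = m \<cdot> h"
proof -
  have "Cod C m = Cod C n" using m n by (simp add: hom_def)
  then obtain p q where pb: "is_pullback C m n p q"
    using pullbacks mM nM unfolding has_pullbacks_of_def by blast
  obtain P where p: "p \<in> hom C P A" and q: "q \<in> hom C P B" and pq: "m \<cdot> p = n \<cdot> q"
    by (rule pullbackE[OF pb m n])
  have Tpb: "is_pullback SET (Ta m) (Ta n) (Ta p) (Ta q)"
    using pres_pullbacks mM nM pb unfolding preserves_pullbacks_of_def by blast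
  have Bn: "small TYPE('u) (To B)" using small_T hom_Obj[OF n] by blast
  obtain u where u: "u \<in> hom SET (To B) (To A)" "\<And>x. x \<in> To B \<Longrightarrow> ap m (fun_of u x) = ap n x"
    using SET_factor_inj[OF T_hom[OF m] Bn img] by blast
  have "Ta m \<cdot>\<^bsub>SET\<^esub> u = Ta n"
    by (rule SET_eqI[OF category.Comp_in_hom[OF category_SET u(1) T_hom[OF m]] T_hom[OF n]])
      (simp add: fun_of_Comp[OF u(1) T_hom[OF m]] u(2))
  then have "isomorphism SET (Ta q)"
    by (rule category.pullback_iso[OF category_SET Tpb T_hom[OF m] T_hom[OF n]
          SET_monic[OF T_hom[OF m] M_injective[OF mM]] u(1)])
  then have "isomorphism C q" using conservative q unfolding conservative_def hom_def by blast
  from isomorphismE[OF this q] obtain r where r: "r \<in> hom C B P" "r \<cdot> q = Id C P" "q \<cdot> r = Id C B" .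
  have "m \<cdot> (p \<cdot> r) = n \<cdot> (q \<cdot> r)"
    using Comp_assoc[OF r(1) p m] Comp_assoc[OF r(1) q n] pq by simp
  then have "m \<cdot> (p \<cdot> r) = n" using r(3) Comp_Id[OF n] by simp
  then show ?thesis using Comp_in_hom[OF r(1) p] by blast
qed

text \<open>An arbitrary \<open>g\<close> is reduced to its \<open>E\<close>-part: the
  \<open>M\<close>-part is injective under \<open>T\<close>, so \<open>g\<close> and its
  \<open>E\<close>-part make the same identifications, and \<open>E_factor\<close> applies.
  Uniqueness holds because \<open>e\<close> is epic.\<close>

lemma E_quotient:
  assumes eE: "e \<in> E" and e: "e \<in> hom C X Y"
  shows "is_quotient C F X (Ker C F e) e"
  unfolding is_quotient_def
proof (intro conjI ballI impI)
  show arr: "e \<in> Arr C" "Dom C e = X" using e by (simp_all add: hom_def)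
  then show "normal C F X (Ker C F e)" unfolding normal_def by blast
  fix g assume "g \<in> Arr C" and gX: "Dom C g = X \<and> Ker C F e \<sqsubseteq>\<^bsub>fibre F X\<^esub> Ker C F g"
  then have g: "g \<in> hom C X (Cod C g)" by (simp add: hom_def)
  have Y: "Cod C e = Y" using e by (simp add: hom_def)
  obtain e' n I where en: "e' \<in> E" "n \<in> M" "e' \<in> hom C X I" "n \<in> hom C I (Cod C g)" "g = n \<cdot> e'"
    by (rule factorE[OF g])
  have "ap e' x = ap e' y" if "x \<in> To X" "y \<in> To X" "ap e x = ap e y" for x y
  proof -
    have "ap g x = ap g y" using gX Ker_le_iff[OF e g] that by blast
    then have "ap n (ap e' x) = ap n (ap e' y)" using that by (simp add: en(5) ap_Comp[OF en(3,4)])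
    then show ?thesis using that by (simp add: ap_inj[OF en(2,4)] ap_closed[OF en(3)])
  qed
  then obtain h where h: "h \<in> hom C Y I" "e' = h \<cdot> e" using E_factor[OF eE e en(1,3)] by blast
  have nh: "n \<cdot> h \<in> hom C Y (Cod C g)" using Comp_in_hom[OF h(1) en(4)] .
  have nhe: "g = (n \<cdot> h) \<cdot> e" using Comp_assoc[OF e h(1) en(4)] en(5) h(2) by simp
  have Z: "Cod C g \<in> Obj C" using hom_Obj[OF g] by blast
  show "\<exists>!h. h \<in> hom C (Cod C e) (Cod C g) \<and> g = h \<cdot> e"
    unfolding Y
  proof (rule ex1I)
    show "n \<cdot> h \<in> hom C Y (Cod C g) \<and> g = (n \<cdot> h) \<cdot> e" using nh nhe by blast
    fix k assume k: "k \<in> hom C Y (Cod C g) \<and> g = k \<cdot> e"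
    then have "k \<cdot> e = (n \<cdot> h) \<cdot> e" using nhe by metis
    then show "k = n \<cdot> h" using epicD[OF E_epic[OF eE] e _ nh Z] k by blast
  qed
qed (rule refl)

text \<open>Here \<open>g\<close> is replaced by its \<open>M\<close>-part, which has the same image
  because the \<open>E\<close>-part is surjective under \<open>T\<close>; then
  \<open>M_factor\<close> applies, and \<open>m\<close> being monic gives uniqueness.\<close>

lemma M_embedding:
  assumes mM: "m \<in> M" and m: "m \<in> hom C Y X"
  shows "is_embedding C F X (Im C F m) m"
  unfolding is_embedding_def
proof (intro conjI ballI impI)
  show arr: "m \<in> Arr C" "Cod C m = X" using m by (simp_all add: hom_def)
  then show "conormal C F X (Im C F m)" unfolding conormal_def by blast
  fix g assume "g \<in> Arr C" and gX: "Cod C g = X \<and> Im C F g \<sqsubseteq>\<^bsub>fibre F X\<^esub> Im C F m"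
  then have g: "g \<in> hom C (Dom C g) X" by (simp add: hom_def)
  have Y: "Dom C m = Y" using m by (simp add: hom_def)
  obtain e n I where en: "e \<in> E" "n \<in> M" "e \<in> hom C (Dom C g) I" "n \<in> hom C I X" "g = n \<cdot> e"
    by (rule factorE[OF g])
  have "Im C F g = Im C F n" using factor_Im[OF en(3,4,1)] en(5) by simp
  then have "ap n ` To I \<subseteq> ap m ` To Y" using gX Im_le_iff[OF en(4) m] by simp
  then obtain h where h: "h \<in> hom C I Y" "n = m \<cdot> h" using M_factor[OF mM m en(2,4)] by blast
  have he: "h \<cdot> e \<in> hom C (Dom C g) Y" using Comp_in_hom[OF en(3) h(1)] .
  have mhe: "g = m \<cdot> (h \<cdot> e)" using Comp_assoc[OF en(3) h(1) m] en(5) h(2) by simp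
  have Z: "Dom C g \<in> Obj C" using hom_Obj[OF g] by blast
  show "\<exists>!h. h \<in> hom C (Dom C g) (Dom C m) \<and> g = m \<cdot> h"
    unfolding Y
  proof (rule ex1I)
    show "h \<cdot> e \<in> hom C (Dom C g) Y \<and> g = m \<cdot> (h \<cdot> e)" using he mhe by blast
    fix k assume k: "k \<in> hom C (Dom C g) Y \<and> g = m \<cdot> k"
    then have "m \<cdot> k = m \<cdot> (h \<cdot> e)" using mhe by metis
    then show "k = h \<cdot> e" using monicD[OF M_monic[OF mM] m _ he Z] k by blast
  qed
qed (rule refl)

text \<open>In a pushout of surjections of sets, the diagonal identifies exactly what the two given
  kernels generate; preservation by \<open>T\<close> makes this available for pushouts in
  \<open>C\<close>. It is the join half of (N3).\<close>

lemma Ker_join_pushout: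
  assumes dE: "d \<in> E" and d: "d \<in> hom C X A" and eE: "e \<in> E" and e: "e \<in> hom C X B"
    and po: "is_pushout C d e p q" and p: "p \<in> hom C A P" and q: "q \<in> hom C B P"
  shows "Ker C F d \<squnion>\<^bsub>fibre F X\<^esub> Ker C F e = Ker C F (p \<cdot> d)"
proof -
  have pd: "p \<cdot> d \<in> hom C X P" using Comp_in_hom[OF d p] .
  have pq: "p \<cdot> d = q \<cdot> e" using po by (simp add: is_pushout_def)
  have Tpo: "is_pushout SET (Ta d) (Ta e) (Ta p) (Ta q)"
    using pres_pushouts dE eE po unfolding preserves_pushouts_of_def by blast
  have pd_ap: "ap (p \<cdot> d) x = ap p (ap d x)" if "x \<in> To X" for x
    by (rule ap_Comp[OF d p that])
  have qe_ap: "ap (p \<cdot> d) x = ap q (ap e x)" if "x \<in> To X" for x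
    unfolding pq by (rule ap_Comp[OF e q that])
  have "Ker SET equiv_form (Ta d) \<squnion>\<^bsub>equiv_fibre (To X)\<^esub> Ker SET equiv_form (Ta e) =
      Ker SET equiv_form (Ta (p \<cdot> d))"
  proof (rule equiv_form_Ker_join[OF uni T_hom[OF d] T_hom[OF e] T_hom[OF pd]])
    show "ap (p \<cdot> d) x = ap (p \<cdot> d) y" if "x \<in> To X" "y \<in> To X" "ap d x = ap d y" for x y
      using pd_ap[OF that(1)] pd_ap[OF that(2)] that(3) by simp
    show "ap (p \<cdot> d) x = ap (p \<cdot> d) y" if "x \<in> To X" "y \<in> To X" "ap e x = ap e y" for x y
      using qe_ap[OF that(1)] qe_ap[OF that(2)] that(3) by simp
    fix t :: "'u \<Rightarrow> 'u" and x y
    assume td: "\<And>x y. \<lbrakk>x \<in> To X; y \<in> To X; ap d x = ap d y\<rbrakk> \<Longrightarrow> t x = t y"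
      and te: "\<And>x y. \<lbrakk>x \<in> To X; y \<in> To X; ap e x = ap e y\<rbrakk> \<Longrightarrow> t x = t y"
      and xy: "x \<in> To X" "y \<in> To X" "ap (p \<cdot> d) x = ap (p \<cdot> d) y"
    have "ap p (ap d x) = ap p (ap d y)" using pd_ap[OF xy(1)] pd_ap[OF xy(2)] xy(3) by simp
    then show "t x = t y"
      using SET_pushoutD[OF Tpo T_hom[OF d] T_hom[OF e] E_surjective[OF dE] E_surjective[OF eE],
          where t = t] td te xy(1,2) by blast
  qed
  then show ?thesis
    unfolding fibre_F Ker_reindex[OF fn d] Ker_reindex[OF fn e] Ker_reindex[OF fn pd] .
qed

text \<open>A pullback preserved by \<open>T\<close> has the intersection of the two images as the
  image of its diagonal. It is the meet half of (N3).\<close>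

lemma Im_meet_pullback:
  assumes mM: "m \<in> M" and m: "m \<in> hom C A X" and nM: "n \<in> M" and n: "n \<in> hom C B X"
    and pb: "is_pullback C m n p q" and p: "p \<in> hom C P A" and q: "q \<in> hom C P B"
  shows "Im C F m \<sqinter>\<^bsub>fibre F X\<^esub> Im C F n = Im C F (m \<cdot> p)"
proof -
  have mp: "m \<cdot> p \<in> hom C P X" using Comp_in_hom[OF p m] .
  have pq: "m \<cdot> p = n \<cdot> q" using pb by (simp add: is_pullback_def)
  have Tpb: "is_pullback SET (Ta m) (Ta n) (Ta p) (Ta q)"
    using pres_pullbacks mM nM pb unfolding preserves_pullbacks_of_def by blast
  have mp_ap: "ap (m \<cdot> p) x = ap m (ap p x)" if "x \<in> To P" for x
    by (rule ap_Comp[OF p m that])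
  have nq_ap: "ap (m \<cdot> p) x = ap n (ap q x)" if "x \<in> To P" for x
    unfolding pq by (rule ap_Comp[OF q n that])
  have DP: "Dom SET (Ta p) = To P" using T_hom[OF p] by (simp add: hom_def)
  have "ap (m \<cdot> p) ` To P = ap m ` To A \<inter> ap n ` To B"
  proof (intro subset_antisym subsetI)
    fix y assume "y \<in> ap m ` To A \<inter> ap n ` To B"
    then show "y \<in> ap (m \<cdot> p) ` To P"
      using SET_pullbackD[OF Tpb T_hom[OF m] T_hom[OF n] uni, of y] functor_Comp[OF fn p m] DP
      by simp
  next
    fix y assume "y \<in> ap (m \<cdot> p) ` To P"
    then obtain x where x: "x \<in> To P" "y = ap (m \<cdot> p) x" by (rule imageE)
    show "y \<in> ap m ` To A \<inter> ap n ` To B"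
      using imageI[OF ap_closed[OF p x(1)], of "ap m"] imageI[OF ap_closed[OF q x(1)], of "ap n"]
        mp_ap[OF x(1)] nq_ap[OF x(1)] x(2) by simp
  qed
  then show ?thesis
    using equiv_form_Im_meet[OF uni T_hom[OF m] T_hom[OF n] T_hom[OF mp]]
    unfolding fibre_F Im_reindex[OF fn m] Im_reindex[OF fn n] Im_reindex[OF fn mp] by blast
qed

text \<open>The \<open>M\<close>-part of a morphism does not affect its kernel, so it may be
  dropped; pushouts are assumed only for \<open>E\<close>.\<close>

lemma normal_E:
  assumes "normal C F X K" "X \<in> Obj C"
  obtains e Y where "e \<in> E" "e \<in> hom C X Y" "Ker C F e = K"
proof -
  obtain f where "f \<in> Arr C" "Dom C f = X" and K: "Ker C F f = K"
    using assms unfolding normal_def by blast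
  then have f: "f \<in> hom C X (Cod C f)" by (simp add: hom_def)
  obtain e m I where em: "e \<in> E" "m \<in> M" "e \<in> hom C X I" "m \<in> hom C I (Cod C f)" "f = m \<cdot> e"
    by (rule factorE[OF f])
  show thesis by (rule that[OF em(1,3)]) (use factor_Ker[OF em(3,4,2)] em(5) K in simp)
qed

text \<open>The \<open>E\<close>-part of a morphism does not affect its image, so it may be dropped;
  pullbacks are assumed only for \<open>M\<close>.\<close>

lemma conormal_M:
  assumes "conormal C F X S" "X \<in> Obj C"
  obtains m Y where "m \<in> M" "m \<in> hom C Y X" "Im C F m = S"
proof -
  obtain f where "f \<in> Arr C" "Cod C f = X" and S: "Im C F f = S"
    using assms unfolding conormal_def by blast
  then have f: "f \<in> hom C (Dom C f) X" by (simp add: hom_def)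
  obtain e m I where em: "e \<in> E" "m \<in> M" "e \<in> hom C (Dom C f) I" "m \<in> hom C I X" "f = m \<cdot> e"
    by (rule factorE[OF f])
  show thesis by (rule that[OF em(2,4)]) (use factor_Im[OF em(3,4,1)] em(5) S in simp)
qed

text \<open>(N1) is inherited from maps of sets, (N2) is the given factorization, and for (N3) the
  diagonals of a pushout and of a pullback in \<open>C\<close> have the required kernel and
  image.\<close>

lemma noetherian_F: "noetherian_form C F"
  unfolding noetherian_form_def
proof (intro conjI ballI allI impI)
  show "is_form C F" by (rule form_F)
next
  fix f S assume fA: "f \<in> Arr C" and S: "S \<in> carrier (fibre F (Dom C f))"
  from fA have f: "f \<in> hom C (Dom C f) (Cod C f)" by (rule homI)
  show "inv_im F f (dir F f S) = S \<squnion>\<^bsub>fibre F (Dom C f)\<^esub> Ker C F f"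
    using equiv_form_N1(1)[OF uni T_hom[OF f] S[unfolded fibre_F]]
    unfolding fibre_F Ker_reindex[OF fn f] by (simp add: reindex_def)
next
  fix f T assume fA: "f \<in> Arr C" and T: "T \<in> carrier (fibre F (Cod C f))"
  from fA have f: "f \<in> hom C (Dom C f) (Cod C f)" by (rule homI)
  show "dir F f (inv_im F f T) = T \<sqinter>\<^bsub>fibre F (Cod C f)\<^esub> Im C F f"
    using equiv_form_N1(2)[OF uni T_hom[OF f] T[unfolded fibre_F]]
    unfolding fibre_F Im_reindex[OF fn f] by (simp add: reindex_def)
next
  fix f assume "f \<in> Arr C"
  then have f: "f \<in> hom C (Dom C f) (Cod C f)" by (rule homI)
  obtain e m I where em: "e \<in> E" "m \<in> M" "e \<in> hom C (Dom C f) I" "m \<in> hom C I (Cod C f)" "f = m \<cdot> e"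
    by (rule factorE[OF f])
  have "is_quotient C F (Dom C f) (Ker C F f) e"
    using E_quotient[OF em(1,3)] factor_Ker[OF em(3,4,2)] em(5) by simp
  moreover have "is_embedding C F (Cod C f) (Im C F f) m"
    using M_embedding[OF em(2,4)] factor_Im[OF em(3,4,1)] em(5) by simp
  moreover have "Cod C e = Dom C m" using em(3,4) by (simp add: hom_def)
  ultimately show "\<exists>e m. is_quotient C F (Dom C f) (Ker C F f) e \<and>
      is_embedding C F (Cod C f) (Im C F f) m \<and> Cod C e = Dom C m \<and> f = m \<cdot> e"
    using em(5) by blast
next
  fix X K L assume X: "X \<in> Obj C" and KL: "normal C F X K \<and> normal C F X L"
  obtain d A where d: "d \<in> E" "d \<in> hom C X A" "Ker C F d = K"
    by (rule normal_E[OF KL[THEN conjunct1] X])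
  obtain e B where e: "e \<in> E" "e \<in> hom C X B" "Ker C F e = L"
    by (rule normal_E[OF KL[THEN conjunct2] X])
  have "Dom C d = Dom C e" using d(2) e(2) by (simp add: hom_def)
  then obtain p q where po: "is_pushout C d e p q"
    using pushouts d(1) e(1) unfolding has_pushouts_of_def by blast
  obtain P where p: "p \<in> hom C A P" and q: "q \<in> hom C B P"
    by (rule pushoutE[OF po d(2) e(2)])
  have "Ker C F (p \<cdot> d) = K \<squnion>\<^bsub>fibre F X\<^esub> L"
    using Ker_join_pushout[OF d(1,2) e(1,2) po p q] d(3) e(3) by simp
  moreover have "p \<cdot> d \<in> hom C X P" using Comp_in_hom[OF d(2) p] .
  ultimately show "normal C F X (K \<squnion>\<^bsub>fibre F X\<^esub> L)" unfolding normal_def hom_def by blast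
next
  fix X S T assume X: "X \<in> Obj C" and ST: "conormal C F X S \<and> conormal C F X T"
  obtain m A where m: "m \<in> M" "m \<in> hom C A X" "Im C F m = S"
    by (rule conormal_M[OF ST[THEN conjunct1] X])
  obtain n B where n: "n \<in> M" "n \<in> hom C B X" "Im C F n = T"
    by (rule conormal_M[OF ST[THEN conjunct2] X])
  have "Cod C m = Cod C n" using m(2) n(2) by (simp add: hom_def)
  then obtain p q where pb: "is_pullback C m n p q"
    using pullbacks m(1) n(1) unfolding has_pullbacks_of_def by blast
  obtain P where p: "p \<in> hom C P A" and q: "q \<in> hom C P B"
    by (rule pullbackE[OF pb m(2) n(2)])
  have "Im C F (m \<cdot> p) = S \<sqinter>\<^bsub>fibre F X\<^esub> T"
    using Im_meet_pullback[OF m(1,2) n(1,2) pb p q] m(3) n(3) by simp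
  moreover have "m \<cdot> p \<in> hom C P X" using Comp_in_hom[OF p m(2)] .
  ultimately show "conormal C F X (S \<sqinter>\<^bsub>fibre F X\<^esub> T)" unfolding conormal_def hom_def by blast
qed

text \<open>A quotient \<open>q\<close> with factorization \<open>q = m \<cdot> e\<close> has the
  same kernel as \<open>e\<close>, so each of \<open>q\<close> and \<open>e\<close> factors through
  the other. Cancelling \<open>q\<close> on one side and \<open>e\<close> on the other makes
  \<open>m\<close> an isomorphism, and \<open>E\<close> absorbs it.\<close>

lemma quotients_F: "quotients C F = E"
proof (intro subset_antisym subsetI)
  fix e assume eE: "e \<in> E"
  have e: "e \<in> hom C (Dom C e) (Cod C e)" by (rule homI[OF E_Arr[OF eE]])
  show "e \<in> quotients C F"
    unfolding quotients_def using E_quotient[OF eE e] hom_Obj[OF e] by blast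
next
  \<comment> \<open>Cancellation of \<open>q\<close> has to come from the noetherian form, since
    \<open>q\<close> is not yet known to belong to \<open>E\<close>.\<close>
  interpret N: noetherian_category C F by unfold_locales (rule noetherian_F)
  fix q assume "q \<in> quotients C F"
  then obtain X K where q: "is_quotient C F X K q" unfolding quotients_def by blast
  then have h: "q \<in> hom C X (Cod C q)" by (simp add: is_quotient_def hom_def)
  let ?Y = "Cod C q"
  obtain e m I where em: "e \<in> E" "m \<in> M" "e \<in> hom C X I" "m \<in> hom C I ?Y" "q = m \<cdot> e"
    by (rule factorE[OF h])
  have "K = Ker C F e"
    using q factor_Ker[OF em(3,4,2)] em(5) by (simp add: is_quotient_def)
  then have "K \<sqsubseteq>\<^bsub>fibre F X\<^esub> Ker C F e" by (simp add: Ker_le_iff[OF em(3,3)])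
  then obtain k where k: "k \<in> hom C ?Y I" "e = k \<cdot> q"
    using N.quotient_factor(1)[OF q h em(3)] by blast
  have Obs: "?Y \<in> Obj C" "I \<in> Obj C" using hom_Obj[OF em(4)] by auto
  have "(m \<cdot> k) \<cdot> q = Id C ?Y \<cdot> q"
    using Comp_assoc[OF h k(1) em(4)] k(2)[symmetric] em(5)[symmetric] Id_Comp[OF h] by simp
  then have mk: "m \<cdot> k = Id C ?Y"
    using N.quotient_epic[OF q h Comp_in_hom[OF k(1) em(4)] Id_in_hom[OF Obs(1)]] by blast
  have "(k \<cdot> m) \<cdot> e = Id C I \<cdot> e"
    using Comp_assoc[OF em(3,4) k(1)] k(2)[symmetric] em(5)[symmetric] Id_Comp[OF em(3)] by simp
  then have km: "k \<cdot> m = Id C I"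
    using epicD[OF E_epic[OF em(1)] em(3) Comp_in_hom[OF em(4) k(1)] Id_in_hom[OF Obs(2)] Obs(2)]
    by blast
  have "m \<cdot> e \<in> E" by (rule E_comp_iso[OF em(1,3,4) isomorphismI[OF em(4) k(1) km mk]])
  then show "q \<in> E" using em(5) by simp
qed

text \<open>Dually, an embedding and its \<open>M\<close>-part factor through each other, so the
  \<open>E\<close>-part is an isomorphism and \<open>M\<close> absorbs it.\<close>

lemma embeddings_F: "embeddings C F = M"
proof (intro subset_antisym subsetI)
  fix m assume mM: "m \<in> M"
  have m: "m \<in> hom C (Dom C m) (Cod C m)" by (rule homI[OF M_Arr[OF mM]])
  show "m \<in> embeddings C F"
    unfolding embeddings_def using M_embedding[OF mM m] hom_Obj[OF m] by blast
next
  interpret N: noetherian_category C F by unfold_locales (rule noetherian_F)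
  fix i assume "i \<in> embeddings C F"
  then obtain X S where i: "is_embedding C F X S i" unfolding embeddings_def by blast
  then have h: "i \<in> hom C (Dom C i) X" by (simp add: is_embedding_def hom_def)
  let ?Y = "Dom C i"
  obtain e m I where em: "e \<in> E" "m \<in> M" "e \<in> hom C ?Y I" "m \<in> hom C I X" "i = m \<cdot> e"
    by (rule factorE[OF h])
  have "S = Im C F m"
    using i factor_Im[OF em(3,4,1)] em(5) by (simp add: is_embedding_def)
  then have "Im C F m \<sqsubseteq>\<^bsub>fibre F X\<^esub> S" by (simp add: Im_le_iff[OF em(4,4)])
  then obtain k where k: "k \<in> hom C I ?Y" "m = i \<cdot> k"
    using N.embedding_factor(1)[OF i h em(4)] by blast
  have Obs: "?Y \<in> Obj C" "I \<in> Obj C" using hom_Obj[OF em(3)] by auto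
  have "i \<cdot> (k \<cdot> e) = i \<cdot> Id C ?Y"
    using Comp_assoc[OF em(3) k(1) h] k(2)[symmetric] em(5)[symmetric] Comp_Id[OF h] by simp
  then have ke: "k \<cdot> e = Id C ?Y"
    using N.embedding_monic[OF i h Comp_in_hom[OF em(3) k(1)] Id_in_hom[OF Obs(1)]] by blast
  have "m \<cdot> (e \<cdot> k) = m \<cdot> Id C I"
    using Comp_assoc[OF k(1) em(3,4)] k(2)[symmetric] em(5)[symmetric] Comp_Id[OF em(4)] by simp
  then have ek: "e \<cdot> k = Id C I"
    using monicD[OF M_monic[OF em(2)] em(4) Comp_in_hom[OF k(1) em(3)] Id_in_hom[OF Obs(2)] Obs(2)]
    by blast
  have "m \<cdot> e \<in> M" by (rule M_comp_iso[OF em(2,4,3) isomorphismI[OF em(3) k(1) ke ek]])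
  then show "i \<in> M" using em(5) by simp
qed

end

section \<open>Noetherian forms and conservative functors to sets determine each other's
  existence\<close>

theorem theorem3p12:
  fixes C :: "('o, 'a) cat" and E M :: "'a set"
  assumes "universe TYPE('u)"
    and "category C" and "locally_small TYPE('u) C"
    and "proper_factorization_system C E M"
    and "has_pullbacks_of C M" and "has_pushouts_of C E"
  shows "(\<exists>F :: ('o, 'a, 'u) form. noetherian_form C F \<and> induces C F E M) \<longleftrightarrow>
    (\<exists>(To :: 'o \<Rightarrow> 'u set) (Ta :: 'a \<Rightarrow> 'u set_map).
       is_functor C SET To Ta \<and> conservative C SET Ta \<and>
       (\<forall>e\<in>E. surjective_map (Ta e)) \<and> (\<forall>m\<in>M. injective_map (Ta m)) \<and>
       preserves_pullbacks_of C SET Ta M \<and> preserves_pushouts_of C SET Ta E)"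
proof
  interpret category C by fact
  assume "\<exists>F :: ('o, 'a, 'u) form. noetherian_form C F \<and> induces C F E M"
  then obtain F :: "('o, 'a, 'u) form" where F: "noetherian_form C F"
    and EM: "quotients C F = E" "embeddings C F = M"
    unfolding induces_def by blast
  interpret noetherian_category C F by unfold_locales (rule F)
  show "\<exists>(To :: 'o \<Rightarrow> 'u set) (Ta :: 'a \<Rightarrow> 'u set_map).
       is_functor C SET To Ta \<and> conservative C SET Ta \<and>
       (\<forall>e\<in>E. surjective_map (Ta e)) \<and> (\<forall>m\<in>M. injective_map (Ta m)) \<and>
       preserves_pullbacks_of C SET Ta M \<and> preserves_pushouts_of C SET Ta E"
    using cluster_functor cluster_conservative cluster_quotient_surjective
      cluster_embedding_injective cluster_preserves_pullbacks cluster_preserves_pushouts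
    unfolding EM by blast
next
  assume "\<exists>(To :: 'o \<Rightarrow> 'u set) (Ta :: 'a \<Rightarrow> 'u set_map).
       is_functor C SET To Ta \<and> conservative C SET Ta \<and>
       (\<forall>e\<in>E. surjective_map (Ta e)) \<and> (\<forall>m\<in>M. injective_map (Ta m)) \<and>
       preserves_pullbacks_of C SET Ta M \<and> preserves_pushouts_of C SET Ta E"
  then obtain To :: "'o \<Rightarrow> 'u set" and Ta :: "'a \<Rightarrow> 'u set_map" where
    "is_functor C SET To Ta" "conservative C SET Ta"
    "\<forall>e\<in>E. surjective_map (Ta e)" "\<forall>m\<in>M. injective_map (Ta m)"
    "preserves_pullbacks_of C SET Ta M" "preserves_pushouts_of C SET Ta E"
    by blast
  then interpret concrete_factorization C E M To Ta
    using assms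
    by (intro concrete_factorization.intro proper_factorization.intro
        proper_factorization_axioms.intro concrete_factorization_axioms.intro) auto
  show "\<exists>F :: ('o, 'a, 'u) form. noetherian_form C F \<and> induces C F E M"
    using noetherian_F quotients_F embeddings_F unfolding induces_def by blast
qed

end
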